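(* (Main Decomposition) Let $G$ be a compact connected Hausdorff abelian group of finite dimension. Then $G\cong_t K\times T$ (topological isomorphism) where $T$ is totally factored and $K$ is clipped. In particular, $\mathrm{cHom}(\mathbb{T},K)=0$ and $\mathrm{cHom}(K,\mathbb{Q}^\vee)=0$.
   Context: All groups are abelian; $\mathbb{T}=\mathbb{R}/\mathbb{Z}$; $\mathrm{cHom}(G,H)$ is the group of continuous homomorphisms; $G^\vee=\mathrm{cHom}(G,\mathbb{T})$ is the Pontryagin dual, and $\mathbb{Q}^\vee$ is the (compact) dual of the discrete group $\mathbb{Q}$. The dimension of a compact group $G$ is $\dim_\mathbb{R}\mathrm{cHom}(\mathbb{R},G)$ (equivalently $\operatorname{rk}(\mathbb{Q}\otimes G^\vee)$). A solenoid is a connected compact group of dimension $1$. A connected compact group is totally factored if it is topologically isomorphic to a (topological) product of solenoids (the trivial group counting as the empty product). A compact group is clipped if it has no factor that is a solenoid, i.e. it is not topologically isomorphic to $\Sigma\times L$ for any solenoid $\Sigma$ and topological group $L$. *)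

theory Defs
  imports "HOL-Analysis.Analysis" "HOL-Algebra.Product_Groups" "HOL-Algebra.FiniteProduct"
begin

definition top_ab_group :: "('a, 'b) monoid_scheme \<Rightarrow> 'a topology \<Rightarrow> bool" where
  "top_ab_group G X \<longleftrightarrow> comm_group G \<and> topspace X = carrier G \<and>
     continuous_map (prod_topology X X) X (\<lambda>(x, y). x \<otimes>\<^bsub>G\<^esub> y) \<and>
     continuous_map X X (m_inv G)"

definition top_iso :: "('a, 'c) monoid_scheme \<Rightarrow> 'a topology \<Rightarrow> ('b, 'd) monoid_scheme \<Rightarrow> 'b topology
    \<Rightarrow> ('a \<Rightarrow> 'b) \<Rightarrow> bool" where
  "top_iso G X H Y f \<longleftrightarrow> f \<in> iso G H \<and> homeomorphic_map X Y f"

definition cHomR :: "('a, 'b) monoid_scheme \<Rightarrow> 'a topology \<Rightarrow> (real \<Rightarrow> 'a) set" where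
  "cHomR G X = {\<phi>. continuous_map euclideanreal X \<phi> \<and> (\<forall>x y. \<phi> (x + y) = \<phi> x \<otimes>\<^bsub>G\<^esub> \<phi> y)}"

text \<open>dim_R cHom(R,G) = n: cHom(R,G) is a real vector space with
(\<phi> + \<psi>)(x) = \<phi> x \<otimes> \<psi> x and (c \<cdot> \<phi>)(x) = \<phi>(c x); it has dimension n iff it has a
basis b_0,...,b_{n-1}, i.e. every element is a unique linear combination of them.\<close>
definition has_dim :: "('a, 'b) monoid_scheme \<Rightarrow> 'a topology \<Rightarrow> nat \<Rightarrow> bool" where
  "has_dim G X n \<longleftrightarrow> (\<exists>b :: nat \<Rightarrow> real \<Rightarrow> 'a. (\<forall>i<n. b i \<in> cHomR G X) \<and>
      (\<forall>\<psi>\<in>cHomR G X. \<exists>!c :: nat \<Rightarrow> real. (\<forall>i\<ge>n. c i = 0) \<and>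
          \<psi> = (\<lambda>x. finprod G (\<lambda>i. b i (c i * x)) {..<n})))"

definition finite_dim :: "('a, 'b) monoid_scheme \<Rightarrow> 'a topology \<Rightarrow> bool" where
  "finite_dim G X \<longleftrightarrow> (\<exists>n. has_dim G X n)"

definition solenoid :: "('a, 'b) monoid_scheme \<Rightarrow> 'a topology \<Rightarrow> bool" where
  "solenoid G X \<longleftrightarrow> top_ab_group G X \<and> compact_space X \<and> Hausdorff_space X \<and>
     connected_space X \<and> has_dim G X 1"

text \<open>Totally factored: topologically isomorphic to a product of solenoids (empty product
allowed).  The index set and the factors are taken on the carrier type of the group
itself; this is no restriction, since every factor (and the index set) embeds into the group.\<close>
definition totally_factored :: "'a monoid \<Rightarrow> 'a topology \<Rightarrow> bool" where
  "totally_factored T Y \<longleftrightarrow> (\<exists>(I :: 'a set) (S :: 'a \<Rightarrow> 'a monoid) (Z :: 'a \<Rightarrow> 'a topology)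
      (f :: ('a \<Rightarrow> 'a) \<Rightarrow> 'a).
      (\<forall>i\<in>I. solenoid (S i) (Z i)) \<and> top_iso (product_group I S) (product_topology Z I) T Y f)"

text \<open>Clipped: no solenoid factor, i.e. G is not topologically isomorphic to
\<Sigma> \<times> L with \<Sigma> a solenoid. Stated internally: no pair of subgroups S, L (subspace topologies)
with S a solenoid such that (s,l) \<mapsto> s \<otimes> l is a topological isomorphism S \<times> L \<rightarrow> G.\<close>
definition clipped :: "'a monoid \<Rightarrow> 'a topology \<Rightarrow> bool" where
  "clipped G X \<longleftrightarrow> \<not> (\<exists>S L. subgroup S G \<and> subgroup L G \<and>
       solenoid (G\<lparr>carrier := S\<rparr>) (subtopology X S) \<and>
       top_iso (G\<lparr>carrier := S\<rparr> \<times>\<times> G\<lparr>carrier := L\<rparr>)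
               (prod_topology (subtopology X S) (subtopology X L)) G X (\<lambda>(s, l). s \<otimes>\<^bsub>G\<^esub> l))"

definition circle_group :: "complex monoid" where
  "circle_group = \<lparr>carrier = sphere 0 1, mult = (*), one = 1\<rparr>"

definition circle_top :: "complex topology" where
  "circle_top = top_of_set (sphere 0 1)"

text \<open>Pontryagin dual of the discrete group Q: characters Q \<rightarrow> T with the compact-open
topology, which for a discrete domain is the topology of pointwise convergence.\<close>
definition Qdual_group :: "(rat \<Rightarrow> complex) monoid" where
  "Qdual_group = \<lparr>carrier = {ch. (\<forall>q. ch q \<in> sphere 0 1) \<and> (\<forall>p q. ch (p + q) = ch p * ch q)},
                  mult = (\<lambda>ch eh q. ch q * eh q), one = (\<lambda>_. 1)\<rparr>"

definition Qdual_top :: "(rat \<Rightarrow> complex) topology" where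
  "Qdual_top = subtopology (product_topology (\<lambda>_. euclidean) UNIV) (carrier Qdual_group)"

end

theory Submission
  imports Defs "HOL-Algebra.Multiplicative_Group"
begin

text \<open>
Characters of a compact abelian group \<open>G\<close> are obtained from an invariant mean on all bounded
functions (a limit of averages over boxes of powers). For a unit vector \<open>h\<close> put
\<open>F x = M (\<lambda>y. h (x \<otimes> y) * cnj (h y))\<close>; on the spectral side \<open>F\<close> is a convex combination of
characters, so near-maximisers of the mean square of \<open>\<lambda>x. F (a \<otimes> x) - F x\<close> are nearly extreme,
hence nearly multiplicative, and can be rounded to a character that is nontrivial at \<open>a\<close>. So the
characters separate points, and comparing moments of trigonometric polynomials shows that
every homomorphism from the dual of \<open>G\<close> to the circle is evaluation at a point.

By duality, an idempotent endomorphism of the dual whose image has rank one splits a solenoid off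
\<open>G\<close>. A nontrivial homomorphism from the circle to \<open>G\<close> induces a degree map from the dual onto an
infinite cyclic group, which has a section; a nontrivial homomorphism from \<open>G\<close> to the dual of the
rationals embeds the rationals in the dual of \<open>G\<close> (torsion-free as \<open>G\<close> is connected), and the
rationals are injective. Hence neither exists on a clipped group. One-parameter subgroups of
successive solenoid factors are linearly independent, so splitting off solenoids terminates.
\<close>

section \<open>Invariant means\<close>

text \<open>A finitely additive mean replaces Haar measure. Compactness makes it good enough:
  finitely many translates of a nonempty open set cover the group, so a continuous nonnegative
  function that is not identically zero has positive mean. The mean square of
  \<open>F (a \<otimes> x) - F x\<close> is the right quantity because a character \<eta> enters it
  only through \<open>\<eta> a - 1\<close>, so large values steer towards characters that are
  nontrivial at \<open>a\<close>. The supremum over autocorrelations is not known to be attained;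
  hence extremality is always an inequality with an explicit error, and a rounding step has to
  produce a genuine character. On the dual side one mechanism recurs: a real-valued homomorphism on
  the dual is a one-parameter subgroup of the group, and a factor whose dual has rank one carries
  exactly one line of them. The induction runs on a bound for the number of independent
  one-parameter subgroups instead of on the dimension itself, because such a bound descends to a
  direct factor without a basis for that factor.\<close>

definition bounded_fun :: "('a, 'b) monoid_scheme \<Rightarrow> ('a \<Rightarrow> complex) \<Rightarrow> bool" where
  "bounded_fun G f \<longleftrightarrow> (\<exists>B. \<forall>x\<in>carrier G. cmod (f x) \<le> B)"

text \<open>Each clause equates or compares finitely many values of \<open>M\<close>, so it survives
  pointwise limits; this is how \<open>invariant_mean_exists\<close> obtains a mean. That real
  functions have real means is a consequence, \<open>M_of_real\<close>.\<close>

definition invariant_mean :: "('a, 'b) monoid_scheme \<Rightarrow> (('a \<Rightarrow> complex) \<Rightarrow> complex) \<Rightarrow> bool" where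
  "invariant_mean G M \<longleftrightarrow>
     (\<forall>f g. bounded_fun G f \<longrightarrow> bounded_fun G g \<longrightarrow> M (\<lambda>x. f x + g x) = M f + M g) \<and>
     (\<forall>c f. bounded_fun G f \<longrightarrow> M (\<lambda>x. c * f x) = c * M f) \<and>
     M (\<lambda>_. 1) = 1 \<and>
     (\<forall>f. bounded_fun G f \<longrightarrow> cmod (M f) \<le> Re (M (\<lambda>x. of_real (cmod (f x))))) \<and>
     (\<forall>f::'a \<Rightarrow> real. bounded_fun G (\<lambda>x. of_real (f x)) \<longrightarrow> (\<forall>x\<in>carrier G. 0 \<le> f x) \<longrightarrow>
        0 \<le> Re (M (\<lambda>x. of_real (f x)))) \<and>
     (\<forall>a\<in>carrier G. \<forall>f. bounded_fun G f \<longrightarrow> M (\<lambda>x. f (a \<otimes>\<^bsub>G\<^esub> x)) = M f)"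

lemma bounded_fun_const [simp]: "bounded_fun G (\<lambda>x. c)"
  unfolding bounded_fun_def by auto

lemma bounded_fun_add [intro]:
  assumes "bounded_fun G f" "bounded_fun G g" shows "bounded_fun G (\<lambda>x. f x + g x)"
proof -
  obtain A B where "\<forall>x\<in>carrier G. cmod (f x) \<le> A" "\<forall>x\<in>carrier G. cmod (g x) \<le> B"
    using assms unfolding bounded_fun_def by auto
  then have "\<forall>x\<in>carrier G. cmod (f x + g x) \<le> A + B"
    by (meson add_mono norm_triangle_ineq order_trans)
  then show ?thesis unfolding bounded_fun_def by blast
qed

lemma bounded_fun_mult [intro]:
  assumes "bounded_fun G f" "bounded_fun G g" shows "bounded_fun G (\<lambda>x. f x * g x)"
proof -
  obtain A B where "\<forall>x\<in>carrier G. cmod (f x) \<le> A" "\<forall>x\<in>carrier G. cmod (g x) \<le> B"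
    using assms unfolding bounded_fun_def by auto
  then have "\<forall>x\<in>carrier G. cmod (f x * g x) \<le> A * B"
    by (smt (verit) mult_mono norm_ge_zero norm_mult)
  then show ?thesis unfolding bounded_fun_def by blast
qed

lemma bounded_fun_minus [intro]: "bounded_fun G f \<Longrightarrow> bounded_fun G (\<lambda>x. - f x)"
  unfolding bounded_fun_def by simp

lemma bounded_fun_diff [intro]:
  "bounded_fun G f \<Longrightarrow> bounded_fun G g \<Longrightarrow> bounded_fun G (\<lambda>x. f x - g x)"
  using bounded_fun_add[OF _ bounded_fun_minus, of G f g] by simp

lemma bounded_fun_cnj [intro]: "bounded_fun G f \<Longrightarrow> bounded_fun G (\<lambda>x. cnj (f x))"
  unfolding bounded_fun_def by simp

lemma bounded_fun_norm [intro]: "bounded_fun G f \<Longrightarrow> bounded_fun G (\<lambda>x. of_real (cmod (f x)))"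
  unfolding bounded_fun_def by simp

lemma bounded_fun_norm2 [intro]: "bounded_fun G f \<Longrightarrow> bounded_fun G (\<lambda>x. of_real ((cmod (f x))\<^sup>2))"
  using bounded_fun_mult[OF bounded_fun_norm bounded_fun_norm, of G f f] by (simp add: power2_eq_square)

context comm_group
begin

lemma bounded_fun_translate [intro]:
  "bounded_fun G f \<Longrightarrow> a \<in> carrier G \<Longrightarrow> bounded_fun G (\<lambda>x. f (a \<otimes> x))"
  unfolding bounded_fun_def by (meson m_closed)

text \<open>Sum of \<open>f\<close> over the box of products of powers \<open>a [^] j\<close> with
  \<open>j < n\<close>, one factor for each list entry. Points are counted with multiplicity, so
  relations between the generators do no harm. These boxes play the role of Folner sets.\<close>

fun box_sum :: "nat \<Rightarrow> 'a list \<Rightarrow> ('a \<Rightarrow> complex) \<Rightarrow> complex" where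
  "box_sum n [] f = f \<one>"
| "box_sum n (a # as) f = (\<Sum>j<n. box_sum n as (\<lambda>x. f (a [^] j \<otimes> x)))"

lemma box_sum_add: "box_sum n as (\<lambda>x. f x + g x) = box_sum n as f + box_sum n as g"
  by (induction as arbitrary: f g) (auto simp: sum.distrib)

lemma box_sum_cmult: "box_sum n as (\<lambda>x. c * f x) = c * box_sum n as f"
  by (induction as arbitrary: f) (auto simp: sum_distrib_left)

lemma box_sum_one: "box_sum n as (\<lambda>x. 1) = of_nat n ^ length as"
  by (induction as) auto

lemma box_sum_norm: "cmod (box_sum n as f) \<le> Re (box_sum n as (\<lambda>x. of_real (cmod (f x))))"
proof (induction as arbitrary: f)
  case (Cons a as)
  show ?case
    by (simp, rule order_trans[OF norm_sum], rule sum_mono, rule Cons)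
qed simp

lemma box_sum_nonneg:
  assumes "set as \<subseteq> carrier G" "\<And>x. x \<in> carrier G \<Longrightarrow> 0 \<le> f x"
  shows "0 \<le> Re (box_sum n as (\<lambda>x. of_real (f x)))"
  using assms
proof (induction as arbitrary: f)
  case (Cons a as)
  show ?case
    by (simp, rule sum_nonneg, rule Cons.IH) (use Cons.prems in auto)
qed simp

lemma box_sum_bound:
  assumes "set as \<subseteq> carrier G" "\<And>x. x \<in> carrier G \<Longrightarrow> cmod (f x) \<le> B"
  shows "cmod (box_sum n as f) \<le> B * of_nat n ^ length as"
  using assms
proof (induction as arbitrary: f)
  case (Cons a as)
  have "cmod (box_sum n (a # as) f) \<le> (\<Sum>j<n. B * of_nat n ^ length as)"
    unfolding box_sum.simps
    by (rule order_trans[OF norm_sum], rule sum_mono, rule Cons.IH) (use Cons.prems in auto)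
  then show ?case by (simp add: mult_ac)
qed simp

lemma box_sum_cong:
  assumes "set as \<subseteq> carrier G" "\<And>x. x \<in> carrier G \<Longrightarrow> f x = g x"
  shows "box_sum n as f = box_sum n as g"
  using assms
proof (induction as arbitrary: f g)
  case (Cons a as)
  show ?case
    by (simp, rule sum.cong[OF refl], rule Cons.IH) (use Cons.prems in auto)
qed simp

text \<open>In the direction of \<open>b\<close> the sum telescopes: only two opposite faces of the
  box survive, each with a fraction 1/n of its points. In the other directions the estimate passes
  through the outer sum.\<close>

lemma box_sum_translate:
  assumes "set as \<subseteq> carrier G" "b \<in> set as" "\<And>x. x \<in> carrier G \<Longrightarrow> cmod (f x) \<le> B"
  shows "of_nat n * cmod (box_sum n as (\<lambda>x. f (b \<otimes> x)) - box_sum n as f) \<le> 2 * B * of_nat n ^ length as"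
  using assms
proof (induction as arbitrary: f)
  case (Cons a as)
  have a: "a \<in> carrier G" and b: "b \<in> carrier G" and as: "set as \<subseteq> carrier G"
    using Cons.prems by auto
  show ?case
  proof (cases "b = a")
    case True
    define F where "F = (\<lambda>j. box_sum n as (\<lambda>x. f (a [^] (j::nat) \<otimes> x)))"
    have *: "box_sum n as (\<lambda>x. f (a \<otimes> (a [^] j \<otimes> x))) = F (Suc j)" for j
    proof -
      have "a \<otimes> (a [^] j \<otimes> x) = a [^] Suc j \<otimes> x" if "x \<in> carrier G" for x
        by (subst nat_pow_Suc2) (use a that in \<open>simp_all add: m_assoc\<close>)
      then show ?thesis unfolding F_def by (intro box_sum_cong[OF as]) (simp del: nat_pow_Suc)
    qed
    have "box_sum n (a # as) (\<lambda>x. f (b \<otimes> x)) - box_sum n (a # as) f = (\<Sum>j<n. F (Suc j) - F j)"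
      using True by (simp add: * sum_subtractf) (simp add: F_def)
    also have "\<dots> = F n - F 0" by (rule sum_lessThan_telescope)
    also have "cmod \<dots> \<le> B * of_nat n ^ length as + B * of_nat n ^ length as"
      unfolding F_def
      by (rule order_trans[OF norm_triangle_ineq4], rule add_mono; rule box_sum_bound)
         (use as a Cons.prems in auto)
    finally have "of_nat n * cmod (box_sum n (a # as) (\<lambda>x. f (b \<otimes> x)) - box_sum n (a # as) f) 
       \<le> of_nat n * (B * of_nat n ^ length as + B * of_nat n ^ length as)"
      by (rule mult_left_mono) simp
    then show ?thesis by (simp add: algebra_simps)
  next
    case False
    then have bas: "b \<in> set as" using Cons.prems by auto
    define F where "F = (\<lambda>j x. f (a [^] (j::nat) \<otimes> x))"
    have *: "box_sum n as (\<lambda>x. f (b \<otimes> (a [^] j \<otimes> x))) = box_sum n as (\<lambda>x. F j (b \<otimes> x))" for j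
      unfolding F_def
      by (rule box_sum_cong[OF as]) (use a b in \<open>simp add: m_lcomm\<close>)
    have "of_nat n * cmod (box_sum n (a # as) (\<lambda>x. f (b \<otimes> x)) - box_sum n (a # as) f)
       = of_nat n * cmod (\<Sum>j<n. box_sum n as (\<lambda>x. F j (b \<otimes> x)) - box_sum n as (F j))"
      by (simp add: * sum_subtractf) (simp add: F_def)
    also have "\<dots> \<le> of_nat n * (\<Sum>j<n. cmod (box_sum n as (\<lambda>x. F j (b \<otimes> x)) - box_sum n as (F j)))"
      by (intro mult_left_mono norm_sum) simp
    also have "\<dots> \<le> (\<Sum>j<n. 2 * B * of_nat n ^ length as)"
      unfolding sum_distrib_left
      by (rule sum_mono, rule Cons.IH[OF as bas]) (use a Cons.prems in \<open>auto simp: F_def\<close>)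
    finally show ?thesis by (simp add: mult_ac)
  qed
qed simp

text \<open>Normalised box averages lie in a product of discs, compact by Tychonoff. Finitely many
  near-invariance conditions are met by a single box whose generators are the elements involved and
  whose side is at least every required precision; so all conditions hold simultaneously for some
  functional.\<close>

lemma invariant_mean_exists: "\<exists>M. invariant_mean G M"
proof -
  \<comment> \<open>Unbounded functions get radius 0: the functional vanishes on them, and the
    product over all functions stays compact.\<close>
  define B where "B f = (if bounded_fun G f then (SOME B. B \<ge> 0 \<and> (\<forall>x\<in>carrier G. cmod (f x) \<le> B)) else 0)"
    for f :: "'a \<Rightarrow> complex"
  have B: "B f \<ge> 0 \<and> (\<forall>x\<in>carrier G. cmod (f x) \<le> B f)" if f: "bounded_fun G f" for f
  proof -
    obtain C where "\<forall>x\<in>carrier G. cmod (f x) \<le> C" using f unfolding bounded_fun_def by auto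
    then have "\<exists>B. B \<ge> 0 \<and> (\<forall>x\<in>carrier G. cmod (f x) \<le> B)"
      by (intro exI[of _ "max 0 C"]) auto
    from someI_ex[OF this] show ?thesis using f unfolding B_def by simp
  qed
  define Z where "Z = Pi\<^sub>E UNIV (\<lambda>f. cball (0::complex) (B f))"
  have Z: "compact Z"
  proof -
    have "compactin (product_topology (\<lambda>f. euclidean) UNIV) Z"
      unfolding Z_def by (subst compactin_PiE) (auto simp: compactin_euclidean_iff)
    then show ?thesis by (simp add: euclidean_product_topology compactin_euclidean_iff)
  qed
  define P :: "(('a \<Rightarrow> complex) \<Rightarrow> complex) set" where
    "P = {M. (\<forall>f g. bounded_fun G f \<longrightarrow> bounded_fun G g \<longrightarrow> M (\<lambda>x. f x + g x) = M f + M g) \<and>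
     (\<forall>c f. bounded_fun G f \<longrightarrow> M (\<lambda>x. c * f x) = c * M f) \<and>
     M (\<lambda>_. 1) = 1 \<and>
     (\<forall>f. bounded_fun G f \<longrightarrow> cmod (M f) \<le> Re (M (\<lambda>x. of_real (cmod (f x))))) \<and>
     (\<forall>f::'a \<Rightarrow> real. bounded_fun G (\<lambda>x. of_real (f x)) \<longrightarrow> (\<forall>x\<in>carrier G. 0 \<le> f x) \<longrightarrow>
        0 \<le> Re (M (\<lambda>x. of_real (f x))))}"
  have P: "closed P"
    unfolding P_def
    by ((intro closed_Collect_conj closed_Collect_all closed_Collect_imp closed_Collect_eq
        closed_Collect_le open_Collect_const continuous_intros)?; rule continuous_on_product_coordinates)
  \<comment> \<open>Invariance under \<open>a\<close> up to an error of order
    \<open>1 / (k + 1)\<close>; exact invariance is the intersection over all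
    \<open>k\<close>.\<close>
  define C where "C = (\<lambda>(a,k). {M. \<forall>f. bounded_fun G f \<longrightarrow> cmod (M (\<lambda>x. f (a \<otimes> x)) - M f) \<le> 2 * B f / real (Suc k)})"
  have C: "closed (C i)" for i
    unfolding C_def split_def
    by ((intro closed_Collect_conj closed_Collect_all closed_Collect_imp closed_Collect_eq
        closed_Collect_le open_Collect_const continuous_intros)?; rule continuous_on_product_coordinates)
  have fip: "(Z \<inter> P) \<inter> (\<Inter>i\<in>I'. C i) \<noteq> {}"
    if I': "finite I'" "I' \<subseteq> carrier G \<times> UNIV" for I'
  proof -
    obtain as where as: "set as = fst ` I'" using finite_list[OF finite_imageI[OF I'(1), of fst]] by auto
    have asG: "set as \<subseteq> carrier G" 
    proof
      fix a assume "a \<in> set as"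
      then obtain i where i: "i \<in> I'" "a = fst i" unfolding as by (rule imageE) (rule that)
      have "i \<in> carrier G \<times> UNIV" using I'(2) i(1) by (rule subsetD)
      then show "a \<in> carrier G" unfolding i(2) by (rule SigmaE) simp
    qed
    \<comment> \<open>The inserted 0 keeps \<open>Max\<close> meaningful when \<open>I'\<close> is
      empty; \<open>n\<close> is at least \<open>k + 1\<close> for every precision \<open>k\<close>
      in \<open>I'\<close>.\<close>
    define n where "n = Suc (Max (insert 0 (snd ` I')))"
    have n: "n > 0" by (simp add: n_def)
    define D where "D = (of_nat n ^ length as :: complex)"
    have D: "D \<noteq> 0" "cmod D = of_nat n ^ length as" using n by (auto simp: D_def norm_power)
    have Dr: "D = of_real (cmod D)" unfolding D_def by (simp add: norm_power)
    have ReD: "Re (z / D) = Re z / cmod D" for z by (subst Dr) (simp add: Re_divide_of_real)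
    have Dpos: "cmod D > 0" using D(1) by simp
    define m where "m f = (if bounded_fun G f then box_sum n as f / D else 0)" for f
    have "m \<in> Z"
    proof -
      have "cmod (m f) \<le> B f" for f
      proof (cases "bounded_fun G f")
        case True
        have "cmod (box_sum n as f) \<le> B f * of_nat n ^ length as"
          by (rule box_sum_bound[OF asG]) (use B[OF True] in auto)
        then show ?thesis using True Dpos by (simp add: m_def norm_divide D(2)[symmetric] divide_le_eq)
      qed (simp add: m_def B_def)
      then show ?thesis by (auto simp: Z_def)
    qed
    moreover have "m \<in> P"
    proof -
      have "m (\<lambda>x. f x + g x) = m f + m g" if "bounded_fun G f" "bounded_fun G g" for f g
        using that by (simp add: m_def bounded_fun_add box_sum_add add_divide_distrib)
      moreover have "m (\<lambda>x. c * f x) = c * m f" if "bounded_fun G f" for c f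
        using that bounded_fun_mult[OF bounded_fun_const[of G c] that] by (simp add: m_def box_sum_cmult)
      moreover have "m (\<lambda>_. 1) = 1" using D by (simp add: m_def box_sum_one D_def)
      moreover have "cmod (m f) \<le> Re (m (\<lambda>x. of_real (cmod (f x))))" if "bounded_fun G f" for f
        using that bounded_fun_norm[OF that] box_sum_norm[of n as f] Dpos
        by (simp add: m_def norm_divide ReD divide_right_mono)
      moreover have "0 \<le> Re (m (\<lambda>x. of_real (f x)))"
        if "bounded_fun G (\<lambda>x. of_real (f x))" "\<forall>x\<in>carrier G. 0 \<le> f x" for f :: "'a \<Rightarrow> real"
        using that box_sum_nonneg[OF asG, of f n] by (simp add: m_def ReD)
      ultimately show ?thesis unfolding P_def by blast
    qed
    moreover have "m \<in> C i" if i: "i \<in> I'" for i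
    proof -
      obtain a k where ik: "i = (a,k)" by force
      have aas: "a \<in> set as" using i ik as by force
      then have a: "a \<in> carrier G" using asG by auto
      have k: "Suc k \<le> n" unfolding n_def using I'(1) i ik by (force intro!: Max_ge)
      have "cmod (m (\<lambda>x. f (a \<otimes> x)) - m f) \<le> 2 * B f / real (Suc k)" if f: "bounded_fun G f" for f
      proof -
        have "of_nat n * cmod (box_sum n as (\<lambda>x. f (a \<otimes> x)) - box_sum n as f) \<le> 2 * B f * cmod D"
          unfolding D(2) by (rule box_sum_translate[OF asG aas]) (use B[OF f] in auto)
        then have "of_nat n * (cmod (box_sum n as (\<lambda>x. f (a \<otimes> x)) - box_sum n as f) / cmod D) \<le> 2 * B f"
          using Dpos by (simp add: field_simps)
        then have "of_nat n * cmod (m (\<lambda>x. f (a \<otimes> x)) - m f) \<le> 2 * B f"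
          using f bounded_fun_translate[OF f a]
          by (simp add: m_def norm_divide flip: diff_divide_distrib)
        then have "cmod (m (\<lambda>x. f (a \<otimes> x)) - m f) \<le> 2 * B f / of_nat n"
          using n by (simp add: field_simps)
        also have "\<dots> \<le> 2 * B f / real (Suc k)"
          using B[OF f] k by (intro divide_left_mono) auto
        finally show ?thesis .
      qed
      then show ?thesis by (simp add: C_def ik)
    qed
    ultimately show ?thesis by blast
  qed
  have "(Z \<inter> P) \<inter> (\<Inter>i\<in>carrier G \<times> UNIV. C i) \<noteq> {}"
    by (rule compact_imp_fip_image[OF compact_Int_closed[OF Z P] C fip])
  then obtain M where M: "M \<in> P" "\<And>a k. a \<in> carrier G \<Longrightarrow> M \<in> C (a,k)" by auto
  have "M (\<lambda>x. f (a \<otimes> x)) = M f" if a: "a \<in> carrier G" and f: "bounded_fun G f" for a f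
  proof -
    have *: "cmod (M (\<lambda>x. f (a \<otimes> x)) - M f) \<le> 2 * B f / real (Suc k)" for k
      using M(2)[OF a, of k] f by (simp add: C_def)
    have "(\<lambda>k. 2 * B f / real (Suc k)) \<longlonglongrightarrow> 0"
      by (rule LIMSEQ_Suc[OF lim_const_over_n])
    then have "cmod (M (\<lambda>x. f (a \<otimes> x)) - M f) \<le> 0"
      by (rule tendsto_lowerbound) (use * in auto)
    then show ?thesis by simp
  qed
  then have "invariant_mean G M"
    using M(1) unfolding invariant_mean_def P_def mem_Collect_eq by simp
  then show ?thesis by (intro exI[of _ M])
qed

end

text \<open>Restates continuity on an abstract topology as limits, so that limit arithmetic settles
  the continuity of compound functions.\<close>

lemma continuous_map_euclidean_iff:
  "continuous_map X euclidean f \<longleftrightarrow> (\<forall>x\<in>topspace X. (f \<longlongrightarrow> f x) (atin X x))"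
  by (simp add: continuous_map_atin)

section \<open>Compact groups with an invariant mean\<close>

locale compact_ab_group =
  fixes G :: "('a, 'b) monoid_scheme" (structure) and X :: "'a topology"
  assumes top_group: "top_ab_group G X" and compact: "compact_space X" and Hausdorff: "Hausdorff_space X"
begin

sublocale comm_group G
  using top_group by (simp add: top_ab_group_def)

lemma topspace_eq [simp]: "topspace X = carrier G"
  using top_group by (simp add: top_ab_group_def)

lemma continuous_map_m:
  assumes "continuous_map Y X f" "continuous_map Y X g"
  shows "continuous_map Y X (\<lambda>y. f y \<otimes> g y)"
proof -
  have "continuous_map (prod_topology X X) X (\<lambda>(x, y). x \<otimes> y)"
    using top_group by (simp add: top_ab_group_def)
  from continuous_map_compose[OF continuous_map_pairedI[OF assms] this]
  show ?thesis by (simp add: o_def)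
qed

lemma continuous_map_inv:
  assumes "continuous_map Y X f"
  shows "continuous_map Y X (\<lambda>y. inv (f y))"
proof -
  have "continuous_map X X (m_inv G)"
    using top_group by (simp add: top_ab_group_def)
  from continuous_map_compose[OF assms this] show ?thesis by (simp add: o_def)
qed

lemma continuous_map_translate: "a \<in> carrier G \<Longrightarrow> continuous_map X X (\<lambda>x. a \<otimes> x)"
  by (intro continuous_map_m) auto

lemma continuous_map_comp_translate:
  "a \<in> carrier G \<Longrightarrow> continuous_map X Y f \<Longrightarrow> continuous_map X Y (\<lambda>x. f (a \<otimes> x))"
  using continuous_map_compose[OF continuous_map_translate] by (simp add: o_def)

lemma bounded_fun_continuous:
  assumes "continuous_map X euclidean f" shows "bounded_fun G f"
proof -
  have "compactin euclidean (f ` topspace X)"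
    using assms compact by (intro image_compactin[of X]) (auto simp: compact_space_def)
  then have "bounded (f ` carrier G)" by (simp add: compact_imp_bounded)
  then show ?thesis unfolding bounded_fun_def bounded_iff by auto
qed

end

locale compact_ab_group_mean = compact_ab_group +
  fixes M :: "('a \<Rightarrow> complex) \<Rightarrow> complex"
  assumes mean: "invariant_mean G M"
begin

definition rmean :: "('a \<Rightarrow> real) \<Rightarrow> real" where
  "rmean f = Re (M (\<lambda>x. of_real (f x)))"

abbreviation bdd :: "('a \<Rightarrow> complex) \<Rightarrow> bool" where "bdd \<equiv> bounded_fun G"
abbreviation bdr :: "('a \<Rightarrow> real) \<Rightarrow> bool" where "bdr f \<equiv> bounded_fun G (\<lambda>x. of_real (f x))"

lemma M_add: "bdd f \<Longrightarrow> bdd g \<Longrightarrow> M (\<lambda>x. f x + g x) = M f + M g"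
  using mean unfolding invariant_mean_def by simp

lemma M_cmult: "bdd f \<Longrightarrow> M (\<lambda>x. c * f x) = c * M f"
  using mean unfolding invariant_mean_def by simp

lemma M_diff: assumes "bdd f" "bdd g" shows "M (\<lambda>x. f x - g x) = M f - M g"
  using M_add[OF assms(1) bounded_fun_minus[OF assms(2)]] M_cmult[OF assms(2), of "-1"] by simp

lemma M_const [simp]: "M (\<lambda>_. c) = c"
proof -
  have "M (\<lambda>_. c * 1) = c * M (\<lambda>_. 1)" by (rule M_cmult) simp
  moreover have "M (\<lambda>_. 1) = 1" using mean unfolding invariant_mean_def by simp
  ultimately show ?thesis by simp
qed

lemma M_translate: "a \<in> carrier G \<Longrightarrow> bdd f \<Longrightarrow> M (\<lambda>x. f (a \<otimes> x)) = M f"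
  using mean unfolding invariant_mean_def by simp

lemma M_norm: "bdd f \<Longrightarrow> cmod (M f) \<le> rmean (\<lambda>x. cmod (f x))"
  using mean unfolding invariant_mean_def rmean_def by simp

lemma rmean_nonneg: "bdr f \<Longrightarrow> (\<And>x. x \<in> carrier G \<Longrightarrow> 0 \<le> f x) \<Longrightarrow> 0 \<le> rmean f"
  using mean unfolding invariant_mean_def rmean_def by simp

lemma rmean_add: "bdr f \<Longrightarrow> bdr g \<Longrightarrow> rmean (\<lambda>x. f x + g x) = rmean f + rmean g"
  by (simp add: rmean_def M_add)

lemma rmean_diff: "bdr f \<Longrightarrow> bdr g \<Longrightarrow> rmean (\<lambda>x. f x - g x) = rmean f - rmean g"
  by (simp add: rmean_def M_diff)

lemma rmean_cmult: "bdr f \<Longrightarrow> rmean (\<lambda>x. c * f x) = c * rmean f"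
  by (simp add: rmean_def M_cmult)

lemma rmean_const [simp]: "rmean (\<lambda>_. c) = c"
  by (simp add: rmean_def)

lemma rmean_mono:
  assumes "bdr f" "bdr g" "\<And>x. x \<in> carrier G \<Longrightarrow> f x \<le> g x" shows "rmean f \<le> rmean g"
proof -
  have "0 \<le> rmean (\<lambda>x. g x - f x)"
    by (rule rmean_nonneg) (use assms bounded_fun_diff[OF assms(2,1)] in auto)
  then show ?thesis using rmean_diff[OF assms(2,1)] by simp
qed

lemma rmean_translate: "a \<in> carrier G \<Longrightarrow> bdr f \<Longrightarrow> rmean (\<lambda>x. f (a \<otimes> x)) = rmean f"
  unfolding rmean_def by (simp add: M_translate[of a "\<lambda>x. of_real (f x)"])

lemma rmean_sum:
  "finite A \<Longrightarrow> (\<And>i. i \<in> A \<Longrightarrow> bdr (f i)) \<Longrightarrow> bdr (\<lambda>x. \<Sum>i\<in>A. f i x) \<and> rmean (\<lambda>x. \<Sum>i\<in>A. f i x) = (\<Sum>i\<in>A. rmean (f i))"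
proof (induction A rule: finite_induct)
  case (insert i A)
  then have "bdr (f i)" "bdr (\<lambda>x. \<Sum>i\<in>A. f i x)" by auto
  with insert show ?case
    using bounded_fun_add[of G "\<lambda>x. of_real (f i x)" "\<lambda>x. of_real (\<Sum>i\<in>A. f i x)"]
    by (simp add: rmean_add)
qed auto

lemma M_bound:
  assumes "bdd f" "\<And>x. x \<in> carrier G \<Longrightarrow> cmod (f x) \<le> B" shows "cmod (M f) \<le> B"
proof -
  have "cmod (M f) \<le> rmean (\<lambda>x. cmod (f x))" by (rule M_norm[OF assms(1)])
  also have "\<dots> \<le> rmean (\<lambda>_. B)"
    by (rule rmean_mono) (use assms bounded_fun_norm[OF assms(1)] in auto)
  finally show ?thesis by simp
qed

lemma M_cong:
  assumes "bdd f" "\<And>x. x \<in> carrier G \<Longrightarrow> f x = g x" shows "M f = M g"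
proof -
  have g: "bdd g" using assms unfolding bounded_fun_def by auto
  have "cmod (M (\<lambda>x. f x - g x)) \<le> 0"
    by (rule M_bound) (use assms g in auto)
  then show ?thesis using M_diff[OF assms(1) g] by simp
qed

lemma rmean_cong: "bdr f \<Longrightarrow> (\<And>x. x \<in> carrier G \<Longrightarrow> f x = g x) \<Longrightarrow> rmean f = rmean g"
  unfolding rmean_def by (subst M_cong[of "\<lambda>x. of_real (f x)" "\<lambda>x. of_real (g x)"]) auto

text \<open>Adding a constant makes the function nonnegative; then
  \<open>cmod (M g) \<le> Re (M g)\<close> leaves no room for an imaginary part.\<close>

lemma M_of_real:
  assumes f: "bdr f" shows "M (\<lambda>x. of_real (f x)) = of_real (rmean f)"
proof -
  obtain B where B: "\<And>x. x \<in> carrier G \<Longrightarrow> \<bar>f x\<bar> \<le> B"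
    using f unfolding bounded_fun_def by auto
  define g where "g = (\<lambda>x. f x + B)"
  have g: "bdr g" "\<And>x. x \<in> carrier G \<Longrightarrow> 0 \<le> g x"
    using bounded_fun_add[OF f bounded_fun_const[of G "of_real B"]] B
    by (auto simp: g_def) (smt (verit))
  have "cmod (M (\<lambda>x. of_real (g x))) \<le> rmean (\<lambda>x. cmod (of_real (g x)))" by (rule M_norm[OF g(1)])
  also have "\<dots> = rmean g"
    by (rule rmean_cong) (use g bounded_fun_norm[OF g(1)] in auto)
  finally have "cmod (M (\<lambda>x. of_real (g x))) \<le> Re (M (\<lambda>x. of_real (g x)))" by (simp add: rmean_def)
  then have "Im (M (\<lambda>x. of_real (g x))) = 0"
    using cmod_eq_Re complex_Re_le_cmod[of "M (\<lambda>x. of_real (g x))"]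
    by (metis abs_of_nonneg antisym cmod_power2 add_cancel_right_right power2_eq_iff zero_eq_power2 order_trans norm_ge_zero power2_abs)
  moreover have "M (\<lambda>x. of_real (g x)) = M (\<lambda>x. of_real (f x)) + of_real B"
    using M_add[OF f bounded_fun_const[of G "of_real B"]] by (simp add: g_def)
  ultimately show ?thesis by (simp add: rmean_def complex_eq_iff)
qed

lemma bdr_Re: "bdd f \<Longrightarrow> bdr (\<lambda>x. Re (f x))" 
  unfolding bounded_fun_def using abs_Re_le_cmod by (auto intro: order_trans)

lemma bdr_Im: "bdd f \<Longrightarrow> bdr (\<lambda>x. Im (f x))"
  unfolding bounded_fun_def using abs_Im_le_cmod by (auto intro: order_trans)

lemma M_Re_Im:
  assumes "bdd f"
  shows "M f = of_real (rmean (\<lambda>x. Re (f x))) + \<i> * of_real (rmean (\<lambda>x. Im (f x)))"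
proof -
  note b = bdr_Re[OF assms] bdr_Im[OF assms]
  have "M f = M (\<lambda>x. of_real (Re (f x)) + \<i> * of_real (Im (f x)))"
    by (simp add: complex_eq[symmetric])
  also have "\<dots> = of_real (rmean (\<lambda>x. Re (f x))) + \<i> * of_real (rmean (\<lambda>x. Im (f x)))"
    using b bounded_fun_mult[OF bounded_fun_const[of G \<i>] b(2)] by (simp add: M_add M_cmult M_of_real)
  finally show ?thesis .
qed

lemma M_cnj: assumes f: "bdd f" shows "M (\<lambda>x. cnj (f x)) = cnj (M f)"
proof -
  have "rmean (\<lambda>x. - Im (f x)) = - rmean (\<lambda>x. Im (f x))"
    using rmean_cmult[OF bdr_Im[OF f], of "-1"] by simp
  then show ?thesis
    by (simp add: M_Re_Im[OF bounded_fun_cnj[OF f]] M_Re_Im[OF f])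
qed

text \<open>By the tube lemma \<open>F (x, y)\<close> is close to \<open>F (x0, y)\<close> uniformly
  in \<open>y\<close> once \<open>x\<close> is near \<open>x0\<close>, and the mean respects uniform
  bounds.\<close>

lemma M_continuous:
  assumes F: "continuous_map (prod_topology X X) euclidean F"
  shows "continuous_map X euclidean (\<lambda>x. M (\<lambda>y. F (x, y)))"
proof -
  define g where "g = (\<lambda>x. M (\<lambda>y. F (x, y)))"
  have sec: "continuous_map X euclidean (\<lambda>y. F (x, y))" if "x \<in> carrier G" for x
    using continuous_map_compose[OF continuous_map_pairedI[of X X "\<lambda>y. x" X "\<lambda>y. y"] F] that
    by (simp add: o_def)
  have "openin X {x \<in> topspace X. g x \<in> U}" if U: "open U" for U
  proof (subst openin_subopen, intro ballI)
    fix x0 assume "x0 \<in> {x \<in> topspace X. g x \<in> U}"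
    then have x0: "x0 \<in> carrier G" "g x0 \<in> U" by auto
    then obtain e where e: "e > 0" "ball (g x0) e \<subseteq> U" using U open_contains_ball by blast
    define W where "W = {p \<in> topspace (prod_topology X X). cmod (F p - F (x0, snd p)) \<in> {..<e/2}}"
    have "continuous_map (prod_topology X X) euclidean (F \<circ> (\<lambda>p. (x0, snd p)))"
      by (rule continuous_map_compose[OF _ F])
         (use x0 in \<open>intro continuous_map_pairedI continuous_map_snd, auto\<close>)
    then have "continuous_map (prod_topology X X) euclidean (\<lambda>p. cmod (F p - F (x0, snd p)))"
      using F unfolding continuous_map_euclidean_iff by (auto intro!: tendsto_intros simp: o_def)
    then have W: "openin (prod_topology X X) W"
      unfolding W_def by (rule openin_continuous_map_preimage) simp
    have "{x0} \<times> carrier G \<subseteq> W" using x0 e by (auto simp: W_def)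
    then obtain U' V where U': "openin X U'" "x0 \<in> U'" "carrier G \<subseteq> V" "U' \<times> V \<subseteq> W"
      using tube_lemma_right[OF W, of "carrier G" x0] compact x0 unfolding compact_space_def by auto
    have "g x \<in> U" if x: "x \<in> U'" for x
    proof -
      have xG: "x \<in> carrier G" using U'(1) x openin_subset by fastforce
      note b = bounded_fun_continuous[OF sec[OF xG]] bounded_fun_continuous[OF sec[OF x0(1)]]
      have "cmod (M (\<lambda>y. F (x, y) - F (x0, y))) \<le> e/2"
      proof (rule M_bound)
        fix y assume "y \<in> carrier G"
        then have "(x, y) \<in> W" using U' x by auto
        then show "cmod (F (x, y) - F (x0, y)) \<le> e/2" by (simp add: W_def)
      qed (use b in auto)
      then have "cmod (g x - g x0) \<le> e/2" unfolding g_def using M_diff[OF b] by simp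
      then have "g x \<in> ball (g x0) e" using e by (simp add: dist_norm norm_minus_commute)
      then show ?thesis using e by auto
    qed
    then show "\<exists>T. openin X T \<and> x0 \<in> T \<and> T \<subseteq> {x \<in> topspace X. g x \<in> U}"
      using U' openin_subset by (intro exI[of _ U']) fastforce
  qed
  then show ?thesis unfolding g_def by (simp add: continuous_map_def)
qed

text \<open>Finitely many translates of \<open>U\<close> cover the group and all weigh the same, so
  \<open>c\<close> can be one over their number. That \<open>c\<close> depends on neither
  \<open>f\<close> nor \<open>s\<close> is what the moment comparison in
  \<open>finite_duality\<close> exploits.\<close>

lemma open_mass:
  assumes U: "openin X U" "U \<noteq> {}"
  obtains c where "c > 0" "\<And>f s. bdr f \<Longrightarrow> (\<And>x. x \<in> carrier G \<Longrightarrow> 0 \<le> f x) \<Longrightarrow> (\<And>x. x \<in> U \<Longrightarrow> s \<le> f x)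
     \<Longrightarrow> c * s \<le> rmean f"
proof -
  obtain u0 where u0: "u0 \<in> U" using U by auto
  have UG: "U \<subseteq> carrier G" using openin_subset[OF U(1)] by simp
  define T where "T a = {x \<in> topspace X. a \<otimes> x \<in> U}" for a
  have "openin X (T a)" if "a \<in> carrier G" for a
    unfolding T_def by (rule openin_continuous_map_preimage[OF continuous_map_translate[OF that] U(1)])
  moreover have "x \<in> T (u0 \<otimes> inv x)" if "x \<in> carrier G" for x
    using u0 UG that by (auto simp: T_def m_assoc)
  then have "topspace X \<subseteq> \<Union> (T ` carrier G)"
    using u0 UG by fastforce
  ultimately obtain \<F> where F: "finite \<F>" "\<F> \<subseteq> T ` carrier G" "topspace X \<subseteq> \<Union> \<F>"
    using compact unfolding compact_space_alt by (smt (verit) imageE)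
  then obtain A where A: "A \<subseteq> carrier G" "finite A" "\<F> = T ` A"
    by (meson finite_subset_image)
  have cov: "\<exists>a\<in>A. a \<otimes> x \<in> U" if "x \<in> carrier G" for x
    using F(3) that unfolding A(3) by (auto simp: T_def)
  have Ane: "A \<noteq> {}" using cov[OF one_closed] by auto
  show ?thesis
  proof
    show c: "1 / real (card A) > 0" using A Ane by (simp add: card_gt_0_iff)
    fix f s assume f: "bdr f" "\<And>x. x \<in> carrier G \<Longrightarrow> 0 \<le> f x" "\<And>x. x \<in> U \<Longrightarrow> s \<le> f x"
    have ft: "bdr (\<lambda>x. f (a \<otimes> x))" if "a \<in> A" for a
      using bounded_fun_translate[OF f(1), of a] that A by auto
    have "rmean (\<lambda>_. s) \<le> rmean (\<lambda>x. \<Sum>a\<in>A. f (a \<otimes> x))"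
    proof (rule rmean_mono)
      show "bdr (\<lambda>x. \<Sum>a\<in>A. f (a \<otimes> x))" using rmean_sum[OF A(2), of "\<lambda>a x. f (a \<otimes> x)"] ft by auto
      fix x assume x: "x \<in> carrier G"
      then obtain a where a: "a \<in> A" "a \<otimes> x \<in> U" using cov by auto
      have "s \<le> f (a \<otimes> x)" using f a by auto
      also have "\<dots> \<le> (\<Sum>a\<in>A. f (a \<otimes> x))"
        by (rule member_le_sum) (use a A x f in auto)
      finally show "s \<le> (\<Sum>a\<in>A. f (a \<otimes> x))" .
    qed simp
    also have "\<dots> = (\<Sum>a\<in>A. rmean (\<lambda>x. f (a \<otimes> x)))"
      using rmean_sum[OF A(2), of "\<lambda>a x. f (a \<otimes> x)"] ft by auto
    also have "\<dots> = (\<Sum>a\<in>A. rmean f)"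
      by (rule sum.cong[OF refl]) (use A f in \<open>auto intro: rmean_translate\<close>)
    finally have "s \<le> real (card A) * rmean f" by simp
    then show "1 / real (card A) * s \<le> rmean f" using c by (simp add: field_simps)
  qed
qed

lemma rmean_pos:
  assumes f: "continuous_map X euclideanreal f" "\<And>x. x \<in> carrier G \<Longrightarrow> 0 \<le> f x" "x0 \<in> carrier G" "f x0 > 0"
  shows "rmean f > 0"
proof -
  define U where "U = {x \<in> topspace X. f x \<in> {f x0 / 2 <..}}"
  have "openin X U" unfolding U_def by (rule openin_continuous_map_preimage[OF f(1)]) auto
  moreover have "U \<noteq> {}" using f by (auto simp: U_def)
  ultimately obtain c where c: "c > 0" "\<And>f s. bdr f \<Longrightarrow> (\<And>x. x \<in> carrier G \<Longrightarrow> 0 \<le> f x) \<Longrightarrow> (\<And>x. x \<in> U \<Longrightarrow> s \<le> f x)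
     \<Longrightarrow> c * s \<le> rmean f" using open_mass by metis
  have "bdr f"
    by (rule bounded_fun_continuous) (use f(1) in \<open>auto simp: continuous_map_euclidean_iff intro!: tendsto_intros\<close>)
  then have "c * (f x0 / 2) \<le> rmean f"
    by (rule c(2)) (use f in \<open>auto simp: U_def\<close>)
  moreover have "c * (f x0 / 2) > 0" using c f by simp
  ultimately show ?thesis by linarith
qed

end

section \<open>Autocorrelations\<close>

text \<open>The value 1 outside the carrier makes a character a unique function, so that characters
  equal on the group are equal.\<close>

definition char_group :: "('a, 'b) monoid_scheme \<Rightarrow> 'a topology \<Rightarrow> ('a \<Rightarrow> complex) set" where
  "char_group G X = {\<eta>. continuous_map X euclidean \<eta> \<and> (\<forall>x\<in>carrier G. cmod (\<eta> x) = 1) \<and>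
     (\<forall>x\<in>carrier G. \<forall>y\<in>carrier G. \<eta> (x \<otimes>\<^bsub>G\<^esub> y) = \<eta> x * \<eta> y) \<and> (\<forall>x. x \<notin> carrier G \<longrightarrow> \<eta> x = 1)}"

lemma bounded_fun_power [intro]: "bounded_fun G f \<Longrightarrow> bounded_fun G (\<lambda>x. f x ^ n)"
  by (induction n) auto

declare bounded_fun_add [simp] bounded_fun_mult [simp] bounded_fun_minus [simp] bounded_fun_diff [simp]
  bounded_fun_cnj [simp] bounded_fun_norm [simp] bounded_fun_power [simp]
declare (in comm_group) bounded_fun_translate [simp]

text \<open>Powers of a value of modulus above 1 would escape the bound; applying this to inverses
  as well forces modulus exactly 1.\<close>

lemma (in compact_ab_group) bounded_hom_char:
  assumes cont: "continuous_map X euclidean \<eta>" and bound: "\<And>x. x \<in> carrier G \<Longrightarrow> cmod (\<eta> x) \<le> B"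
    and nz: "\<And>x. x \<in> carrier G \<Longrightarrow> \<eta> x \<noteq> 0"
    and hom: "\<And>x y. x \<in> carrier G \<Longrightarrow> y \<in> carrier G \<Longrightarrow> \<eta> (x \<otimes> y) = \<eta> x * \<eta> y"
  shows "(\<lambda>x. if x \<in> carrier G then \<eta> x else 1) \<in> char_group G X"
proof -
  have one: "\<eta> \<one> = 1" using hom[of \<one> \<one>] nz[of \<one>] by simp
  have pow: "\<eta> (x [^] (n::nat)) = \<eta> x ^ n" if "x \<in> carrier G" for x n
    by (induction n) (use that one hom in auto)
  have le: "cmod (\<eta> x) \<le> 1" if x: "x \<in> carrier G" for x
  proof (rule ccontr)
    assume "\<not> cmod (\<eta> x) \<le> 1"
    then obtain n where "B < cmod (\<eta> x) ^ n" using real_arch_pow by (meson not_le)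
    moreover have "cmod (\<eta> x) ^ n \<le> B" using bound[of "x [^] n"] pow[OF x, of n] x by (simp add: norm_power)
    ultimately show False by simp
  qed
  have "cmod (\<eta> x) = 1" if x: "x \<in> carrier G" for x
  proof -
    have "\<eta> x * \<eta> (inv x) = 1" using hom[of x "inv x"] x one by simp
    then have "cmod (\<eta> x) * cmod (\<eta> (inv x)) = 1" by (metis norm_mult norm_one)
    moreover have "cmod (\<eta> x) * cmod (\<eta> (inv x)) \<le> cmod (\<eta> x) * 1"
      by (rule mult_left_mono) (use le[of "inv x"] x in auto)
    ultimately show ?thesis using le[OF x] by simp
  qed
  moreover have "continuous_map X euclidean (\<lambda>x. if x \<in> carrier G then \<eta> x else 1)"
    by (rule continuous_map_eq[OF cont]) simp
  ultimately show ?thesis unfolding char_group_def using hom by auto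
qed

context compact_ab_group_mean
begin

text \<open>The squared L2 seminorm belonging to the mean.\<close>

definition msq :: "('a \<Rightarrow> complex) \<Rightarrow> real" where
  "msq f = rmean (\<lambda>x. (cmod (f x))\<^sup>2)"

lemma msq_nonneg: "bdd f \<Longrightarrow> 0 \<le> msq f"
  unfolding msq_def by (rule rmean_nonneg) auto

lemma msq_cmult: "bdd f \<Longrightarrow> msq (\<lambda>x. c * f x) = (cmod c)\<^sup>2 * msq f"
  unfolding msq_def norm_mult power_mult_distrib by (rule rmean_cmult) auto

lemma msq_translate: "a \<in> carrier G \<Longrightarrow> bdd f \<Longrightarrow> msq (\<lambda>x. f (a \<otimes> x)) = msq f"
  unfolding msq_def using rmean_translate[of a "\<lambda>x. (cmod (f x))\<^sup>2"] by auto

lemma msq_cong: "bdd f \<Longrightarrow> (\<And>x. x \<in> carrier G \<Longrightarrow> f x = g x) \<Longrightarrow> msq f = msq g"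
  unfolding msq_def by (rule rmean_cong) auto

lemma msq_bound:
  assumes "bdd f" "\<And>x. x \<in> carrier G \<Longrightarrow> cmod (f x) \<le> B" shows "msq f \<le> B\<^sup>2"
proof -
  have "msq f \<le> rmean (\<lambda>_. B\<^sup>2)" unfolding msq_def
    by (rule rmean_mono) (use assms in \<open>auto intro!: power_mono\<close>)
  then show ?thesis by simp
qed

lemma msq_add_le: assumes "bdd f" "bdd g" shows "msq (\<lambda>x. f x + g x) \<le> 2 * msq f + 2 * msq g"
proof -
  have b: "bdr (\<lambda>x. 2 * (cmod (f x))\<^sup>2)" "bdr (\<lambda>x. 2 * (cmod (g x))\<^sup>2)"
    using bounded_fun_mult[OF bounded_fun_const[of G 2] bounded_fun_norm2[OF assms(1)]]
      bounded_fun_mult[OF bounded_fun_const[of G 2] bounded_fun_norm2[OF assms(2)]] by simp_all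
  have "msq (\<lambda>x. f x + g x) \<le> rmean (\<lambda>x. 2 * (cmod (f x))\<^sup>2 + 2 * (cmod (g x))\<^sup>2)"
    unfolding msq_def
  proof (rule rmean_mono)
    show "bdr (\<lambda>x. (cmod (f x + g x))\<^sup>2)" using assms by auto
    show "bdr (\<lambda>x. 2 * (cmod (f x))\<^sup>2 + 2 * (cmod (g x))\<^sup>2)"
      using bounded_fun_add[OF b] by simp
    fix x
    have "(cmod (f x + g x))\<^sup>2 \<le> (cmod (f x) + cmod (g x))\<^sup>2"
      by (intro power_mono norm_triangle_ineq) simp
    also have "\<dots> \<le> 2 * (cmod (f x))\<^sup>2 + 2 * (cmod (g x))\<^sup>2"
      using sum_squares_ge_zero[of "cmod (f x) - cmod (g x)" 0] by (simp add: power2_eq_square algebra_simps)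
    finally show "(cmod (f x + g x))\<^sup>2 \<le> 2 * (cmod (f x))\<^sup>2 + 2 * (cmod (g x))\<^sup>2" .
  qed
  also have "\<dots> = 2 * msq f + 2 * msq g"
    unfolding msq_def using b assms rmean_add[OF b] by (simp add: rmean_cmult bounded_fun_norm2)
  finally show ?thesis .
qed

text \<open>The quantitative strict convexity of the squared norm. With
  \<open>A = \<alpha> u\<close> and \<open>B = \<beta> v\<close> it measures the distance of
  \<open>u\<close> and \<open>v\<close> by the convexity defect at their weighted sum. The form
  without denominators also covers a vanishing \<alpha> or \<beta>.\<close>

lemma msq_convex_identity:
  fixes \<alpha> \<beta> :: real
  assumes A: "bdd A" and B: "bdd B"
  shows "msq (\<lambda>x. of_real \<beta> * A x - of_real \<alpha> * B x) + \<alpha> * \<beta> * msq (\<lambda>x. A x + B x)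
     = \<beta> * (\<alpha> + \<beta>) * msq A + \<alpha> * (\<alpha> + \<beta>) * msq B"
proof -
  have bc: "bdr (\<lambda>x. c * (cmod (f x))\<^sup>2)" if "bdd f" for c f
    using bounded_fun_mult[OF bounded_fun_const[of G "of_real c"] bounded_fun_norm2[OF that]] by simp
  have b: "bdd (\<lambda>x. of_real \<beta> * A x - of_real \<alpha> * B x)" "bdd (\<lambda>x. A x + B x)"
    using A B by (auto intro!: bounded_fun_diff bounded_fun_mult)
  have pt: "(cmod (of_real \<beta> * a - of_real \<alpha> * b))\<^sup>2 + \<alpha> * \<beta> * (cmod (a + b))\<^sup>2
     = \<beta> * (\<alpha> + \<beta>) * (cmod a)\<^sup>2 + \<alpha> * (\<alpha> + \<beta>) * (cmod b)\<^sup>2" for a b :: complex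
    unfolding cmod_power2 by (simp add: power2_eq_square algebra_simps)
  have "msq (\<lambda>x. of_real \<beta> * A x - of_real \<alpha> * B x) + \<alpha> * \<beta> * msq (\<lambda>x. A x + B x)
     = rmean (\<lambda>x. (cmod (of_real \<beta> * A x - of_real \<alpha> * B x))\<^sup>2 + \<alpha> * \<beta> * (cmod (A x + B x))\<^sup>2)"
    unfolding msq_def using rmean_add[OF bounded_fun_norm2[OF b(1)] bc[OF b(2)], of "\<alpha> * \<beta>"]
    by (simp add: rmean_cmult[OF bounded_fun_norm2[OF b(2)]])
  also have "\<dots> = rmean (\<lambda>x. \<beta> * (\<alpha> + \<beta>) * (cmod (A x))\<^sup>2 + \<alpha> * (\<alpha> + \<beta>) * (cmod (B x))\<^sup>2)"
    unfolding pt ..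
  also have "\<dots> = \<beta> * (\<alpha> + \<beta>) * msq A + \<alpha> * (\<alpha> + \<beta>) * msq B"
    unfolding msq_def using rmean_add[OF bc[OF A] bc[OF B], of "\<beta> * (\<alpha> + \<beta>)" "\<alpha> * (\<alpha> + \<beta>)"] 
    by (simp add: rmean_cmult bounded_fun_norm2 A B)
  finally show ?thesis .
qed

text \<open>A matrix coefficient of the regular representation, hence a positive definite function.
  The normalised extreme positive definite functions are the characters.\<close>

definition autocorr :: "('a \<Rightarrow> complex) \<Rightarrow> 'a \<Rightarrow> complex" where
  "autocorr h x = M (\<lambda>y. h (x \<otimes> y) * cnj (h y))"

lemma bdd_corr: "bdd h \<Longrightarrow> bdd k \<Longrightarrow> x \<in> carrier G \<Longrightarrow> bdd (\<lambda>y. h (x \<otimes> y) * cnj (k y))"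
  by auto

lemma autocorr_continuous:
  assumes h: "continuous_map X euclidean h" shows "continuous_map X euclidean (autocorr h)"
proof -
  have "continuous_map (prod_topology X X) euclidean (h \<circ> (\<lambda>p. fst p \<otimes> snd p))"
       "continuous_map (prod_topology X X) euclidean (h \<circ> snd)"
    by (rule continuous_map_compose[OF _ h], intro continuous_map_m continuous_map_fst continuous_map_snd)+
  then have "continuous_map (prod_topology X X) euclidean (\<lambda>p. h (fst p \<otimes> snd p) * cnj (h (snd p)))"
    unfolding continuous_map_euclidean_iff by (auto intro!: tendsto_intros simp: o_def)
  from M_continuous[OF this] show ?thesis by (simp add: autocorr_def[abs_def])
qed

lemma autocorr_one: "bdd h \<Longrightarrow> autocorr h \<one> = of_real (msq h)"
proof -
  assume h: "bdd h"
  have "autocorr h \<one> = M (\<lambda>y. of_real ((cmod (h y))\<^sup>2))"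
    unfolding autocorr_def by (rule M_cong) (use h bdd_corr[OF h h one_closed] in \<open>auto simp: complex_norm_square[symmetric] simp del: of_real_power\<close>)
  then show ?thesis using h by (subst (asm) M_of_real) (auto simp: msq_def)
qed

text \<open>The inequality \<open>2 * (u * v) \<le> u^2 + v^2\<close> suffices in place of
  Cauchy-Schwarz, since translation invariance gives both factors the same mean square.\<close>

lemma autocorr_bound:
  assumes h: "bdd h" and x: "x \<in> carrier G" shows "cmod (autocorr h x) \<le> msq h"
proof -
  let ?g = "\<lambda>y. 1/2 * (cmod (h (x \<otimes> y)))\<^sup>2" and ?k = "\<lambda>y. 1/2 * (cmod (h y))\<^sup>2"
  have b2: "bdd (\<lambda>y. h (x \<otimes> y))" using h x by auto
  have b: "bdr ?g" "bdr ?k"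
    using bounded_fun_mult[OF bounded_fun_const[of G "1/2"] bounded_fun_norm2[OF b2]]
      bounded_fun_mult[OF bounded_fun_const[of G "1/2"] bounded_fun_norm2[OF h]] by simp_all
  have "cmod (autocorr h x) \<le> rmean (\<lambda>y. cmod (h (x \<otimes> y) * cnj (h y)))"
    unfolding autocorr_def by (rule M_norm[OF bdd_corr[OF h h x]])
  also have "\<dots> \<le> rmean (\<lambda>y. ?g y + ?k y)"
  proof (rule rmean_mono)
    show "bdr (\<lambda>y. cmod (h (x \<otimes> y) * cnj (h y)))" using bdd_corr[OF h h x] by auto
    show "bdr (\<lambda>y. ?g y + ?k y)" using bounded_fun_add[OF b] by simp
    fix y
    have "2 * (u * v) \<le> u\<^sup>2 + v\<^sup>2" for u v :: real 
      using sum_squares_ge_zero[of "u - v" 0] by (simp add: power2_eq_square algebra_simps)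
    from this[of "cmod (h (x \<otimes> y))" "cmod (h y)"]
    show "cmod (h (x \<otimes> y) * cnj (h y)) \<le> ?g y + ?k y" by (simp add: norm_mult)
  qed
  also have "\<dots> = 1/2 * rmean (\<lambda>y. (cmod (h (x \<otimes> y)))\<^sup>2) + 1/2 * rmean (\<lambda>y. (cmod (h y))\<^sup>2)"
    by (subst rmean_add[OF b]) (simp only: rmean_cmult[OF bounded_fun_norm2[OF h]] rmean_cmult[OF bounded_fun_norm2[OF b2]])
  also have "rmean (\<lambda>y. (cmod (h (x \<otimes> y)))\<^sup>2) = rmean (\<lambda>y. (cmod (h y))\<^sup>2)"
    using msq_translate[OF x h] by (simp add: msq_def)
  finally show ?thesis by (simp add: msq_def)
qed

lemma corr_inv:
  assumes h: "bdd h" and k: "bdd k" and x: "x \<in> carrier G"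
  shows "M (\<lambda>y. h y * cnj (k (x \<otimes> y))) = M (\<lambda>y. h (inv x \<otimes> y) * cnj (k y))"
proof -
  have b: "bdd (\<lambda>y. h (inv x \<otimes> y) * cnj (k y))" using h k x by auto
  have "M (\<lambda>y. h (inv x \<otimes> y) * cnj (k y)) = M (\<lambda>y. h (inv x \<otimes> (x \<otimes> y)) * cnj (k (x \<otimes> y)))"
    using M_translate[OF x b] by simp
  also have "\<dots> = M (\<lambda>y. h y * cnj (k (x \<otimes> y)))"
    by (rule M_cong) (use M_translate[OF x b] bounded_fun_translate[OF b x] x in \<open>auto simp: m_assoc[symmetric]\<close>)
  finally show ?thesis ..
qed

lemma autocorr_inv: assumes h: "bdd h" and x: "x \<in> carrier G" shows "autocorr h (inv x) = cnj (autocorr h x)"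
proof -
  have "cnj (autocorr h x) = M (\<lambda>y. h y * cnj (h (x \<otimes> y)))"
    unfolding autocorr_def by (subst M_cnj[symmetric, OF bdd_corr[OF h h x]]) (simp add: mult.commute)
  then show ?thesis using corr_inv[OF h h x] by (simp add: autocorr_def)
qed

text \<open>Spectrally, the weight of a character \<eta> is multiplied by
  \<open>cmod (1 + c * \<eta> b)^2 = 2 + 2 * Re (c * \<eta> b)\<close>. The choices \<open>c\<close>
  and \<open>-c\<close> together restore four times the original autocorrelation, which exhibits it
  as a sum of two others.\<close>

lemma autocorr_perturb:
  assumes h: "bdd h" and b: "b \<in> carrier G" and x: "x \<in> carrier G" and c: "cmod c = 1"
  shows "autocorr (\<lambda>y. h y + c * h (b \<otimes> y)) x = 2 * autocorr h x + (c * autocorr h (b \<otimes> x) + cnj c * autocorr h (inv b \<otimes> x))"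
proof -
  let ?hx = "\<lambda>y. h (x \<otimes> y)" and ?hb = "\<lambda>y. h (b \<otimes> y)" and ?hxb = "\<lambda>y. h (x \<otimes> (b \<otimes> y))"
  have bd: "bdd ?hx" "bdd ?hb" using h x b by auto
  have bd': "bdd ?hxb" using bounded_fun_translate[OF bd(1) b] .
  have "autocorr (\<lambda>y. h y + c * h (b \<otimes> y)) x
     = M (\<lambda>y. (?hx y * cnj (h y) + ?hxb y * cnj (?hb y)) + (c * (?hxb y * cnj (h y)) + cnj c * (?hx y * cnj (?hb y))))"
    unfolding autocorr_def
  proof (rule M_cong)
    show "bdd (\<lambda>y. (h (x \<otimes> y) + c * h (b \<otimes> (x \<otimes> y))) * cnj (h y + c * h (b \<otimes> y)))"
      by (intro bounded_fun_mult bounded_fun_add bounded_fun_cnj bounded_fun_const bd h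
          bounded_fun_translate[OF bounded_fun_translate[OF h b] x])
    fix y assume "y \<in> carrier G"
    then have "b \<otimes> (x \<otimes> y) = x \<otimes> (b \<otimes> y)" using b x by (simp add: m_lcomm)
    moreover have "c * cnj c = 1" using c by (simp add: complex_norm_square[symmetric])
    ultimately show "(h (x \<otimes> y) + c * h (b \<otimes> (x \<otimes> y))) * cnj (h y + c * h (b \<otimes> y)) =
      (?hx y * cnj (h y) + ?hxb y * cnj (?hb y)) + (c * (?hxb y * cnj (h y)) + cnj c * (?hx y * cnj (?hb y)))"
      by (simp add: algebra_simps)
  qed
  also have "\<dots> = (M (\<lambda>y. ?hx y * cnj (h y)) + M (\<lambda>y. ?hxb y * cnj (?hb y)))
      + (c * M (\<lambda>y. ?hxb y * cnj (h y)) + cnj c * M (\<lambda>y. ?hx y * cnj (?hb y)))"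
    by (simp add: M_add M_cmult bounded_fun_add bounded_fun_mult bounded_fun_cnj bd bd' h)
  also have "M (\<lambda>y. ?hx y * cnj (h y)) = autocorr h x" by (simp add: autocorr_def)
  also have "M (\<lambda>y. ?hxb y * cnj (?hb y)) = autocorr h x"
    unfolding autocorr_def using M_translate[OF b bdd_corr[OF h h x]] by simp
  also have "M (\<lambda>y. ?hxb y * cnj (h y)) = autocorr h (b \<otimes> x)"
    unfolding autocorr_def by (rule M_cong) (use bd' h b x in \<open>auto simp: m_ac\<close>)
  also have "M (\<lambda>y. ?hx y * cnj (?hb y)) = M (\<lambda>y. h (x \<otimes> (inv b \<otimes> y)) * cnj (h y))"
    by (rule corr_inv[OF bd(1) h b])
  also have "\<dots> = autocorr h (inv b \<otimes> x)"
    unfolding autocorr_def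
    by (rule M_cong) (use bounded_fun_translate[OF bd(1), of "inv b"] h b x in \<open>auto simp: m_ac\<close>)
  finally show ?thesis by simp
qed

end

section \<open>Near-extremal autocorrelations and rounding to characters\<close>

context compact_ab_group_mean
begin

abbreviation cont :: "('a \<Rightarrow> complex) \<Rightarrow> bool" where "cont \<equiv> continuous_map X euclidean"

lemma cont_add [simp]: "cont f \<Longrightarrow> cont g \<Longrightarrow> cont (\<lambda>x. f x + g x)"
  unfolding continuous_map_euclidean_iff by (auto intro!: tendsto_intros)

lemma cont_diff [simp]: "cont f \<Longrightarrow> cont g \<Longrightarrow> cont (\<lambda>x. f x - g x)"
  unfolding continuous_map_euclidean_iff by (auto intro!: tendsto_intros)

lemma cont_mult [simp]: "cont f \<Longrightarrow> cont g \<Longrightarrow> cont (\<lambda>x. f x * g x)"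
  unfolding continuous_map_euclidean_iff by (auto intro!: tendsto_intros)

lemma cont_const [simp]: "cont (\<lambda>x. c)" by simp

text \<open>Acts on a character \<eta> as multiplication by \<open>\<eta> a - 1\<close>, so it
  forgets the characters that are trivial at \<open>a\<close>.\<close>

definition shift_diff :: "'a \<Rightarrow> ('a \<Rightarrow> complex) \<Rightarrow> 'a \<Rightarrow> complex" where
  "shift_diff a f x = f (a \<otimes> x) - f x"

lemma shift_diff_cont: "a \<in> carrier G \<Longrightarrow> cont f \<Longrightarrow> cont (shift_diff a f)"
  unfolding shift_diff_def[abs_def] by (intro cont_diff continuous_map_comp_translate)

lemmas cont_bdd = bounded_fun_continuous

context
  fixes a h L \<epsilon>
  assumes a: "a \<in> carrier G" and h: "cont h" and qh: "msq h = 1"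
    and max: "\<And>k. cont k \<Longrightarrow> msq (shift_diff a (autocorr k)) \<le> L * (msq k)\<^sup>2"
    and near: "L - \<epsilon> \<le> msq (shift_diff a (autocorr h))"
begin

text \<open>Four times \<open>autocorr h\<close> is the sum of the autocorrelations of
  \<open>hp\<close> and \<open>hm\<close>, of masses \<alpha> and \<beta> with \<alpha> + \<beta> =
  4. Each summand obeys the bound with constant \<open>L\<close>, while the sum nearly attains it,
  so the convexity defect is at most
  \<open>\<alpha> * \<beta> * \<epsilon> \<le> 4 * \<epsilon>\<close>. Thus, seen through
  \<open>shift_diff a\<close>, \<open>D\<close> is almost a multiple of
  \<open>autocorr h\<close>.\<close>

lemma convex_step:
  assumes b: "b \<in> carrier G" and c: "cmod c = 1"
  defines "D \<equiv> \<lambda>x. c * autocorr h (b \<otimes> x) + cnj c * autocorr h (inv b \<otimes> x)"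
  shows "msq (\<lambda>x. shift_diff a D x - D \<one> * shift_diff a (autocorr h) x) \<le> 4 * \<epsilon>"
proof -
  define hp where "hp = (\<lambda>y. h y + c * h (b \<otimes> y))"
  define hm where "hm = (\<lambda>y. h y + (- c) * h (b \<otimes> y))"
  have hb: "cont (\<lambda>y. h (b \<otimes> y))" by (rule continuous_map_comp_translate[OF b h])
  have hp: "cont hp" and hm: "cont hm"
    unfolding hp_def hm_def by (intro cont_add cont_mult cont_const h hb)+
  note ph = autocorr_continuous[OF h]
  have D: "cont D" unfolding D_def
    by (intro cont_add cont_mult cont_const continuous_map_comp_translate ph b inv_closed)
  have A: "autocorr hp x = 2 * autocorr h x + D x" if "x \<in> carrier G" for x
    unfolding hp_def D_def using autocorr_perturb[OF cont_bdd[OF h] b that c] .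
  have B: "autocorr hm x = 2 * autocorr h x - D x" if "x \<in> carrier G" for x
    unfolding hm_def D_def using autocorr_perturb[OF cont_bdd[OF h] b that, of "- c"] c by simp
  define \<alpha> where "\<alpha> = msq hp"
  define \<beta> where "\<beta> = msq hm"
  have p1: "autocorr h \<one> = 1" using autocorr_one[OF cont_bdd[OF h]] qh by simp
  have \<alpha>: "of_real \<alpha> = 2 + D \<one>" using autocorr_one[OF cont_bdd[OF hp]] A[OF one_closed] p1 by (simp add: \<alpha>_def)
  have \<beta>: "of_real \<beta> = 2 - D \<one>" using autocorr_one[OF cont_bdd[OF hm]] B[OF one_closed] p1 by (simp add: \<beta>_def)
  have "complex_of_real (\<alpha> + \<beta>) = of_real 4" unfolding of_real_add \<alpha> \<beta> by simp
  then have ab4: "\<alpha> + \<beta> = 4" by (simp only: of_real_eq_iff)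
  have nn: "0 \<le> \<alpha>" "0 \<le> \<beta>" unfolding \<alpha>_def \<beta>_def using hp hm by (auto intro: msq_nonneg cont_bdd)
  have ab: "\<alpha> * \<beta> \<le> 4"
  proof -
    have *: "\<beta> = 4 - \<alpha>" using ab4 by linarith
    show ?thesis using zero_le_square[of "\<alpha> - 2"] unfolding * by (simp add: algebra_simps)
  qed
  have eps: "0 \<le> \<epsilon>" using max[OF h] near qh by simp
  let ?A = "shift_diff a (autocorr hp)" and ?B = "shift_diff a (autocorr hm)" and ?v = "shift_diff a (autocorr h)" and ?D = "shift_diff a D"
  have bd: "bdd ?A" "bdd ?B" "bdd ?v" "bdd ?D"
    by (auto intro!: cont_bdd shift_diff_cont a autocorr_continuous hp hm h D)
  have AB: "?A x = 2 * ?v x + ?D x" "?B x = 2 * ?v x - ?D x" if "x \<in> carrier G" for x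
    unfolding shift_diff_def using that a by (simp_all add: A B algebra_simps)
  have "msq (\<lambda>x. of_real \<beta> * ?A x - of_real \<alpha> * ?B x) + \<alpha> * \<beta> * msq (\<lambda>x. ?A x + ?B x)
     = \<beta> * (\<alpha> + \<beta>) * msq ?A + \<alpha> * (\<alpha> + \<beta>) * msq ?B"
    by (rule msq_convex_identity[OF bd(1,2)])
  \<comment> \<open>With d the value of \<open>D\<close> at \<one>, v for \<open>?v\<close> and D
    for \<open>?D\<close>: (2 - d)(2 v + D) - (2 + d)(2 v - D) = 4 (D - d v).\<close>
  moreover have "msq (\<lambda>x. of_real \<beta> * ?A x - of_real \<alpha> * ?B x) = msq (\<lambda>x. 4 * (?D x - D \<one> * ?v x))"
    by (rule msq_cong) (use bd in \<open>auto simp: AB \<alpha> \<beta> algebra_simps\<close>)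
  moreover have "\<dots> = 16 * msq (\<lambda>x. ?D x - D \<one> * ?v x)"
    by (subst msq_cmult) (use bd in auto)
  moreover have "msq (\<lambda>x. ?A x + ?B x) = msq (\<lambda>x. 4 * ?v x)"
    by (rule msq_cong) (use bd in \<open>auto simp: AB\<close>)
  moreover have "\<dots> = 16 * msq ?v"
    by (subst msq_cmult) (use bd in auto)
  ultimately have id: "16 * msq (\<lambda>x. ?D x - D \<one> * ?v x) + \<alpha> * \<beta> * (16 * msq ?v)
      = 4 * (\<beta> * msq ?A + \<alpha> * msq ?B)"
    by (simp add: ab4)
  have "\<beta> * msq ?A + \<alpha> * msq ?B \<le> \<beta> * (L * \<alpha>\<^sup>2) + \<alpha> * (L * \<beta>\<^sup>2)"
    by (intro add_mono mult_left_mono nn) (use max[OF hp] max[OF hm] in \<open>auto simp: \<alpha>_def \<beta>_def\<close>)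
  also have "\<dots> = (\<alpha> + \<beta>) * (L * (\<alpha> * \<beta>))" by (simp add: power2_eq_square algebra_simps)
  also have "\<dots> = 4 * (L * (\<alpha> * \<beta>))" by (simp add: ab4)
  finally have 1: "\<beta> * msq ?A + \<alpha> * msq ?B \<le> 4 * (L * (\<alpha> * \<beta>))" .
  have 2: "\<alpha> * \<beta> * (L - \<epsilon>) \<le> \<alpha> * \<beta> * msq ?v"
    by (rule mult_left_mono[OF near]) (use nn in simp)
  have 3: "\<alpha> * \<beta> * \<epsilon> \<le> 4 * \<epsilon>" by (rule mult_right_mono[OF ab eps])
  from id 1 2 3 show ?thesis by (simp add: algebra_simps)
qed

text \<open>\<open>D\<close> mixes the translates by \<open>b\<close> and by \<open>inv b\<close>.
  The combination of the cases c = 1 and c = \<i> with weights 1 and -\<i> cancels the second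
  translate and doubles the first.\<close>

lemma near_eigenvector:
  assumes b: "b \<in> carrier G"
  shows "msq (\<lambda>x. shift_diff a (autocorr h) (b \<otimes> x) - autocorr h b * shift_diff a (autocorr h) x) \<le> 4 * \<epsilon>"
proof -
  define D where "D = (\<lambda>c x. c * autocorr h (b \<otimes> x) + cnj c * autocorr h (inv b \<otimes> x))"
  define E where "E = (\<lambda>c x. shift_diff a (D c) x - D c \<one> * shift_diff a (autocorr h) x)"
  note ph = autocorr_continuous[OF h]
  have E: "msq (E c) \<le> 4 * \<epsilon>" if "cmod c = 1" for c
    unfolding E_def D_def by (rule convex_step[OF b that])
  have cE: "bdd (E c)" for c
    unfolding E_def D_def
    by (intro cont_bdd cont_diff cont_mult cont_add cont_const shift_diff_cont a continuous_map_comp_translate ph b inv_closed)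
  have "msq (\<lambda>x. shift_diff a (autocorr h) (b \<otimes> x) - autocorr h b * shift_diff a (autocorr h) x) = msq (\<lambda>x. 1/2 * (E 1 x + (- \<i>) * E \<i> x))"
  proof (rule msq_cong)
    show "bdd (\<lambda>x. shift_diff a (autocorr h) (b \<otimes> x) - autocorr h b * shift_diff a (autocorr h) x)"
      by (intro cont_bdd cont_diff cont_mult cont_const shift_diff_cont a continuous_map_comp_translate ph b)
    fix x assume x: "x \<in> carrier G"
    then have "b \<otimes> (a \<otimes> x) = a \<otimes> (b \<otimes> x)" using a b by (simp add: m_lcomm)
    then show "shift_diff a (autocorr h) (b \<otimes> x) - autocorr h b * shift_diff a (autocorr h) x = 1/2 * (E 1 x + (- \<i>) * E \<i> x)"
      using b x by (simp add: E_def D_def shift_diff_def algebra_simps)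
  qed
  also have "\<dots> = 1/4 * msq (\<lambda>x. E 1 x + (- \<i>) * E \<i> x)"
    by (subst msq_cmult) (use cE bounded_fun_mult[OF bounded_fun_const[of G "-\<i>"] cE[of \<i>]] in \<open>auto simp: power2_eq_square intro: bounded_fun_diff\<close>)
  also have "\<dots> \<le> 1/4 * (2 * msq (E 1) + 2 * msq (\<lambda>x. (- \<i>) * E \<i> x))"
    by (intro mult_left_mono msq_add_le) (use cE bounded_fun_mult[OF bounded_fun_const[of G "-\<i>"] cE[of \<i>]] in auto)
  also have "msq (\<lambda>x. (- \<i>) * E \<i> x) = msq (E \<i>)"
    by (subst msq_cmult) (use cE in auto)
  finally show ?thesis using E[of 1] E[of \<i>] by simp
qed

text \<open>Translating by \<open>b \<otimes> c\<close> at once, or by \<open>c\<close> and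
  \<open>b\<close> in turn, gives two approximate eigenvalues for the same vector, so they must be
  close. The constant is 40 = 2 * 4 + 2 * (2 * 4 + 2 * 4).\<close>

lemma near_multiplicative:
  assumes b: "b \<in> carrier G" and c: "c \<in> carrier G"
  shows "(cmod (autocorr h (b \<otimes> c) - autocorr h b * autocorr h c))\<^sup>2 * msq (shift_diff a (autocorr h)) \<le> 40 * \<epsilon>"
proof -
  let ?v = "shift_diff a (autocorr h)"
  define u where "u = (\<lambda>b x. ?v (b \<otimes> x) - autocorr h b * ?v x)"
  have v: "cont ?v" by (intro shift_diff_cont a autocorr_continuous h)
  have u: "bdd (u b)" if "b \<in> carrier G" for b
    unfolding u_def by (intro cont_bdd cont_diff cont_mult cont_const continuous_map_comp_translate v that)
  have qu: "msq (u b) \<le> 4 * \<epsilon>" if "b \<in> carrier G" for b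
    unfolding u_def by (rule near_eigenvector[OF that])
  have bc: "b \<otimes> c \<in> carrier G" using b c by simp
  have bu: "bdd (\<lambda>x. (-1) * u (b \<otimes> c) x)" "bdd (\<lambda>x. u b (c \<otimes> x))" "bdd (\<lambda>x. autocorr h b * u c x)"
    using bounded_fun_mult[OF bounded_fun_const[of G "-1"] u[OF bc]] bounded_fun_translate[OF u[OF b] c]
      bounded_fun_mult[OF bounded_fun_const[of G "autocorr h b"] u[OF c]] by auto
  have eps: "0 \<le> \<epsilon>" using max[OF h] near qh by simp
  have "(cmod (autocorr h (b \<otimes> c) - autocorr h b * autocorr h c))\<^sup>2 * msq ?v = msq (\<lambda>x. (autocorr h (b \<otimes> c) - autocorr h b * autocorr h c) * ?v x)"
    by (simp add: msq_cmult cont_bdd[OF v])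
  also have "\<dots> = msq (\<lambda>x. (-1) * u (b \<otimes> c) x + (u b (c \<otimes> x) + autocorr h b * u c x))"
    by (rule msq_cong) (use cont_bdd[OF v] b c in \<open>auto simp: u_def m_assoc algebra_simps\<close>)
  also have "\<dots> \<le> 2 * msq (\<lambda>x. (-1) * u (b \<otimes> c) x) + 2 * msq (\<lambda>x. u b (c \<otimes> x) + autocorr h b * u c x)"
    by (rule msq_add_le) (use bu in auto)
  also have "\<dots> \<le> 2 * msq (\<lambda>x. (-1) * u (b \<otimes> c) x) + 2 * (2 * msq (\<lambda>x. u b (c \<otimes> x)) + 2 * msq (\<lambda>x. autocorr h b * u c x))"
    by (intro add_mono mult_left_mono msq_add_le) (use bu in auto)
  also have "msq (\<lambda>x. (-1) * u (b \<otimes> c) x) = msq (u (b \<otimes> c))"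
    by (subst msq_cmult) (use u[OF bc] in auto)
  also have "msq (\<lambda>x. u b (c \<otimes> x)) = msq (u b)" by (rule msq_translate[OF c u[OF b]])
  also have "msq (\<lambda>x. autocorr h b * u c x) = (cmod (autocorr h b))\<^sup>2 * msq (u c)" by (rule msq_cmult[OF u[OF c]])
  finally have *: "(cmod (autocorr h (b \<otimes> c) - autocorr h b * autocorr h c))\<^sup>2 * msq ?v
     \<le> 2 * msq (u (b \<otimes> c)) + 2 * (2 * msq (u b) + 2 * ((cmod (autocorr h b))\<^sup>2 * msq (u c)))" .
  have "(cmod (autocorr h b))\<^sup>2 \<le> 1"
    using autocorr_bound[OF cont_bdd[OF h] b] qh by (simp add: power_le_one)
  then have "(cmod (autocorr h b))\<^sup>2 * msq (u c) \<le> 1 * msq (u c)"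
    by (rule mult_right_mono) (rule msq_nonneg[OF u[OF c]])
  with * qu[OF bc] qu[OF b] qu[OF c] show ?thesis by simp
qed

end

text \<open>The cocycle \<open>Ln (f (x \<otimes> y) / (f x * f y))\<close> of a nearly multiplicative \<open>f\<close> is the
coboundary of its mean in the second variable.\<close>

lemma round_to_character:
  assumes f: "cont f" and mult: "\<And>x y. x \<in> carrier G \<Longrightarrow> y \<in> carrier G \<Longrightarrow> cmod (f (x \<otimes> y) - f x * f y) \<le> \<delta>"
    and le: "\<And>x. x \<in> carrier G \<Longrightarrow> cmod (f x) \<le> 1"
    and inv: "\<And>x. x \<in> carrier G \<Longrightarrow> f (inv x) = cnj (f x)" and one: "f \<one> = 1"
    and \<delta>: "\<delta> \<le> 1/40"
  obtains \<eta> where "\<eta> \<in> char_group G X" "\<And>x. x \<in> carrier G \<Longrightarrow> cmod (\<eta> x - f x) \<le> 16 * \<delta>"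
proof -
  have \<delta>0: "0 \<le> \<delta>" using mult[OF one_closed one_closed] norm_ge_zero order_trans by blast
  \<comment> \<open>The product of \<open>f x\<close> and \<open>f (inv x)\<close> is the squared
    modulus and must be near \<open>f \<one> = 1\<close>; so \<open>f\<close> stays away from 0 and
    can be divided by.\<close>
  have sq: "1 - \<delta> \<le> (cmod (f x))\<^sup>2" if x: "x \<in> carrier G" for x
  proof -
    have "cmod (1 - f x * cnj (f x)) \<le> \<delta>" using mult[OF x inv_closed[OF x]] x by (simp add: one inv)
    then have "cmod (of_real (1 - (cmod (f x))\<^sup>2)) \<le> \<delta>" by (simp add: complex_norm_square del: of_real_power)
    then have "\<bar>1 - (cmod (f x))\<^sup>2\<bar> \<le> \<delta>" by (simp only: norm_of_real)
    then show ?thesis by linarith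
  qed
  have ge: "1 - \<delta> \<le> cmod (f x)" if x: "x \<in> carrier G" for x
    using sq[OF x] le[OF x] mult_left_mono[OF le[OF x], of "cmod (f x)"] by (simp add: power2_eq_square)
  have nz: "f x \<noteq> 0" if "x \<in> carrier G" for x using ge[OF that] \<delta> by auto
  define e where "e = (\<lambda>x y. f (x \<otimes> y) / (f x * f y))"
  define l where "l = (\<lambda>x y. Ln (e x y))"
  have e: "cmod (e x y - 1) \<le> 2 * \<delta>" if x: "x \<in> carrier G" and y: "y \<in> carrier G" for x y
  proof -
    have "e x y - 1 = (f (x \<otimes> y) - f x * f y) / (f x * f y)" using nz x y by (simp add: e_def field_simps)
    then have "cmod (e x y - 1) = cmod (f (x \<otimes> y) - f x * f y) / (cmod (f x) * cmod (f y))"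
      by (simp add: norm_divide norm_mult)
    moreover have "(1 - \<delta>) * (1 - \<delta>) \<le> cmod (f x) * cmod (f y)"
      by (rule mult_mono) (use ge x y \<delta> in auto)
    moreover have "1/2 \<le> (1 - \<delta>) * (1 - \<delta>)"
      using mult_mono[of "39/40" "1 - \<delta>" "39/40" "1 - \<delta>"] \<delta> by simp
    ultimately have "cmod (e x y - 1) \<le> \<delta> / (1/2)"
      using mult[OF x y] \<delta>0 by (smt (verit) frac_le zero_less_divide_1_iff zero_less_numeral)
    then show ?thesis by simp
  qed
  have enz: "e x y \<noteq> 0" if "x \<in> carrier G" "y \<in> carrier G" for x y
    using nz that by (simp add: e_def)
  have l: "cmod (l x y) \<le> 4 * \<delta>" if x: "x \<in> carrier G" and y: "y \<in> carrier G" for x y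
    using norm_Ln_le[of "e x y - 1"] e[OF x y] \<delta> by (simp add: l_def)
  have bl: "bdd (l x)" if "x \<in> carrier G" for x
    unfolding bounded_fun_def using l[OF that] by auto
  have cocycle: "l x y + l (x \<otimes> y) z = l y z + l x (y \<otimes> z)"
    if x: "x \<in> carrier G" and y: "y \<in> carrier G" and z: "z \<in> carrier G" for x y z
  proof -
    \<comment> \<open>The cocycle identity is clear after exponentiation. The four logarithms have
      total size at most 16 \<delta> < 1, which rules out a nonzero multiple of 2 \<pi>
      \<i>.\<close>
    define w where "w = l x y + l (x \<otimes> y) z - (l y z + l x (y \<otimes> z))"
    have "exp w = (e x y * e (x \<otimes> y) z) / (e y z * e x (y \<otimes> z))"
      unfolding w_def l_def exp_diff exp_add using x y z by (simp add: exp_Ln enz)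
    also have "\<dots> = 1" unfolding e_def using nz x y z by (simp add: m_assoc)
    finally have w1: "exp w = 1" .
    have "cmod w \<le> cmod (l x y) + cmod (l (x \<otimes> y) z) + (cmod (l y z) + cmod (l x (y \<otimes> z)))"
      unfolding w_def by (meson norm_triangle_ineq4 norm_triangle_ineq order_trans add_mono)
    also have "\<dots> \<le> 16 * \<delta>" 
      using l[OF x y] l[OF m_closed[OF x y] z] l[OF y z] l[OF x m_closed[OF y z]] by linarith
    finally have "cmod w < 1" using \<delta> by linarith
    then have "\<bar>Im w\<bar> < 1" using abs_Im_le_cmod[of w] by linarith
    then have "Ln (exp w) = w" using pi_gt3 by (intro Ln_exp) auto
    then have "w = 0" using w1 by simp
    then show ?thesis by (simp add: w_def)
  qed
  define c where "c = (\<lambda>x. M (l x))"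
  have c: "cmod (c x) \<le> 4 * \<delta>" if "x \<in> carrier G" for x
    unfolding c_def by (rule M_bound[OF bl[OF that]]) (rule l[OF that])
  have coboundary: "l x y + c (x \<otimes> y) = c y + c x" if x: "x \<in> carrier G" and y: "y \<in> carrier G" for x y
  proof -
    have xy: "x \<otimes> y \<in> carrier G" using x y by simp
    have "l x y + c (x \<otimes> y) = M (\<lambda>z. l x y + l (x \<otimes> y) z)"
      unfolding c_def by (subst M_add[OF bounded_fun_const bl[OF xy]]) simp
    also have "\<dots> = M (\<lambda>z. l y z + l x (y \<otimes> z))"
      by (rule M_cong) (use bl[OF xy] cocycle x y in auto)
    also have "\<dots> = c y + M (\<lambda>z. l x (y \<otimes> z))"
      unfolding c_def by (rule M_add[OF bl[OF y] bounded_fun_translate[OF bl[OF x] y]])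
    also have "M (\<lambda>z. l x (y \<otimes> z)) = c x" unfolding c_def by (rule M_translate[OF y bl[OF x]])
    finally show ?thesis .
  qed
  have "continuous_map (prod_topology X X) euclidean (f \<circ> (\<lambda>p. fst p \<otimes> snd p))"
       "continuous_map (prod_topology X X) euclidean (f \<circ> fst)"
       "continuous_map (prod_topology X X) euclidean (f \<circ> snd)"
    by (rule continuous_map_compose[OF _ f], intro continuous_map_m continuous_map_fst continuous_map_snd)+
  then have "continuous_map (prod_topology X X) euclidean (\<lambda>p. Ln (f (fst p \<otimes> snd p) / (f (fst p) * f (snd p))))"
    unfolding continuous_map_euclidean_iff
  proof (intro ballI tendsto_intros)
    fix p assume "p \<in> topspace (prod_topology X X)"
    then have p: "fst p \<in> carrier G" "snd p \<in> carrier G" by auto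
    then show "f (fst p) * f (snd p) \<noteq> 0" using nz by simp
    show "f (fst p \<otimes> snd p) / (f (fst p) * f (snd p)) \<notin> \<real>\<^sub>\<le>\<^sub>0"
    proof
      assume "f (fst p \<otimes> snd p) / (f (fst p) * f (snd p)) \<in> \<real>\<^sub>\<le>\<^sub>0"
      then have "Re (e (fst p) (snd p)) \<le> 0" by (simp add: e_def complex_nonpos_Reals_iff)
      moreover have "\<bar>Re (e (fst p) (snd p) - 1)\<bar> \<le> 2 * \<delta>"
        using e[OF p] abs_Re_le_cmod order_trans by blast
      ultimately show False using \<delta> by simp
    qed
  qed (auto simp: o_def)
  from M_continuous[OF this] have cc: "cont c" by (simp add: c_def[abs_def] l_def e_def)
  \<comment> \<open>By the coboundary relation the factor \<open>exp (c x)\<close> cancels the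
    multiplicative error of \<open>f\<close> exactly.\<close>
  define \<eta> where "\<eta> = (\<lambda>x. f x * exp (c x))"
  have \<eta>: "cont \<eta>" using f cc unfolding \<eta>_def continuous_map_euclidean_iff by (auto intro!: tendsto_intros)
  have "(\<lambda>x. if x \<in> carrier G then \<eta> x else 1) \<in> char_group G X"
  proof (rule bounded_hom_char[OF \<eta>])
    fix x y assume x: "x \<in> carrier G" and y: "y \<in> carrier G"
    have "f (x \<otimes> y) = f x * f y * exp (l x y)"
      using nz x y by (simp add: l_def exp_Ln[OF enz[OF x y]]) (simp add: e_def)
    then have "\<eta> (x \<otimes> y) = f x * f y * exp (l x y + c (x \<otimes> y))" by (simp add: \<eta>_def exp_add)
    also have "\<dots> = \<eta> x * \<eta> y" by (simp add: coboundary[OF x y] exp_add \<eta>_def)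
    finally show "\<eta> (x \<otimes> y) = \<eta> x * \<eta> y" .
  next
    fix x assume x: "x \<in> carrier G"
    show "\<eta> x \<noteq> 0" using nz[OF x] by (simp add: \<eta>_def)
    have "cmod (\<eta> x) \<le> 1 * exp (cmod (c x))"
      unfolding \<eta>_def norm_mult by (rule mult_mono) (use le[OF x] complex_Re_le_cmod in auto)
    also have "\<dots> \<le> exp (4 * \<delta>)" using c[OF x] by simp
    finally show "cmod (\<eta> x) \<le> exp (4 * \<delta>)" .
  qed
  moreover have "cmod ((if x \<in> carrier G then \<eta> x else 1) - f x) \<le> 16 * \<delta>" if x: "x \<in> carrier G" for x
  proof -
    have "cmod (exp (c x) - 1) \<le> exp \<bar>Re (c x)\<bar> * cmod (c x)"
      using Taylor_exp[of "c x" 0] by simp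
    also have "\<dots> \<le> 2 * (4 * \<delta>)"
    proof (rule mult_mono)
      have "\<bar>Re (c x)\<bar> \<le> 1/2" using abs_Re_le_cmod[of "c x"] c[OF x] \<delta> by linarith
      then show "exp \<bar>Re (c x)\<bar> \<le> 2" using exp_bound_half[of "\<bar>Re (c x)\<bar>"] by simp
    qed (use c[OF x] in auto)
    finally have 1: "cmod (exp (c x) - 1) \<le> 8 * \<delta>" by simp
    have "\<eta> x - f x = f x * (exp (c x) - 1)" by (simp add: \<eta>_def algebra_simps)
    then have "cmod (\<eta> x - f x) = cmod (f x) * cmod (exp (c x) - 1)" by (simp add: norm_mult)
    also have "\<dots> \<le> 1 * (8 * \<delta>)" by (rule mult_mono) (use le[OF x] 1 in auto)
    finally show ?thesis using x \<delta>0 by simp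
  qed
  ultimately show ?thesis by (rule that)
qed

end

text \<open>\<open>L\<close> is the supremum of the mean square for the given \<open>a\<close>, and
  a near-maximiser is rounded to \<eta>. If \<eta> were trivial at \<open>a\<close>, the
  autocorrelation would be almost invariant under \<open>a\<close> and its mean square far below
  \<open>L\<close>.\<close>

theorem (in compact_ab_group) characters_separate:
  assumes a: "a \<in> carrier G" and a1: "a \<noteq> \<one>"
  obtains \<eta> where "\<eta> \<in> char_group G X" "\<eta> a \<noteq> 1"
proof -
  obtain M where "invariant_mean G M" using invariant_mean_exists by auto
  then interpret compact_ab_group_mean G X M by unfold_locales
  define S where "S = {msq (shift_diff a (autocorr h)) | h. cont h \<and> msq h = 1}"
  have dbound: "msq (shift_diff a (autocorr h)) \<le> (2 * msq h)\<^sup>2" if h: "cont h" for h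
  proof (rule msq_bound)
    show "bdd (shift_diff a (autocorr h))" by (intro cont_bdd shift_diff_cont a autocorr_continuous h)
    fix x assume x: "x \<in> carrier G"
    have "cmod (shift_diff a (autocorr h) x) \<le> cmod (autocorr h (a \<otimes> x)) + cmod (autocorr h x)"
      unfolding shift_diff_def by (rule norm_triangle_ineq4)
    also have "\<dots> \<le> msq h + msq h"
      by (intro add_mono autocorr_bound cont_bdd h) (use a x in auto)
    finally show "cmod (shift_diff a (autocorr h) x) \<le> 2 * msq h" by simp
  qed
  have S4: "s \<le> 4" if "s \<in> S" for s using that dbound unfolding S_def by fastforce
  then have bddS: "bdd_above S" by (meson bdd_aboveI)
  define L where "L = Sup S"
  \<comment> \<open>Scaling \<open>h\<close> by \<open>t\<close> scales its autocorrelation by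
    \<open>t^2\<close>, so the bound for unit vectors becomes one with the factor
    \<open>(msq h)^2\<close>.\<close>
  have normalise: "\<exists>k. cont k \<and> msq k = 1 \<and> msq (shift_diff a (autocorr k)) = msq (shift_diff a (autocorr h)) / (msq h)\<^sup>2"
    if h: "cont h" and pos: "msq h > 0" for h
  proof -
    define t where "t = 1 / sqrt (msq h)"
    have t2: "t\<^sup>2 = 1 / msq h" using pos by (simp add: t_def power_divide)
    define k where "k = (\<lambda>x. complex_of_real t * h x)"
    have k: "cont k" unfolding k_def by (intro cont_mult cont_const h)
    have qk: "msq k = 1" unfolding k_def using pos by (simp add: msq_cmult cont_bdd[OF h] t2)
    have ph: "autocorr k x = complex_of_real (1 / msq h) * autocorr h x" if x: "x \<in> carrier G" for x
    proof -
      have "autocorr k x = M (\<lambda>y. complex_of_real (t\<^sup>2) * (h (x \<otimes> y) * cnj (h y)))"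
        unfolding autocorr_def k_def by (simp add: power2_eq_square mult_ac)
      also have "\<dots> = complex_of_real (t\<^sup>2) * autocorr h x"
        unfolding autocorr_def by (rule M_cmult[OF bdd_corr[OF cont_bdd[OF h] cont_bdd[OF h] x]])
      finally show ?thesis by (simp only: t2)
    qed
    have "msq (shift_diff a (autocorr k)) = msq (\<lambda>x. complex_of_real (1 / msq h) * shift_diff a (autocorr h) x)"
      by (rule msq_cong[OF cont_bdd[OF shift_diff_cont[OF a autocorr_continuous[OF k]]]])
         (use a in \<open>simp add: shift_diff_def ph algebra_simps\<close>)
    also have "\<dots> = msq (shift_diff a (autocorr h)) / (msq h)\<^sup>2"
      by (subst msq_cmult) (auto intro!: cont_bdd shift_diff_cont autocorr_continuous a h simp: norm_divide power_divide)
    finally show ?thesis using k qk by blast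
  qed
  have max: "msq (shift_diff a (autocorr h)) \<le> L * (msq h)\<^sup>2" if h: "cont h" for h
  proof (cases "msq h > 0")
    case True
    obtain k where "cont k" "msq k = 1" and k: "msq (shift_diff a (autocorr k)) = msq (shift_diff a (autocorr h)) / (msq h)\<^sup>2"
      using normalise[OF h True] by auto
    then have "msq (shift_diff a (autocorr h)) / (msq h)\<^sup>2 \<in> S" unfolding S_def by (simp flip: k) blast
    then have "msq (shift_diff a (autocorr h)) / (msq h)\<^sup>2 \<le> L" unfolding L_def using bddS by (rule cSup_upper)
    then show ?thesis using True by (simp add: field_simps)
  next
    case False
    then have "msq h = 0" using msq_nonneg[OF cont_bdd[OF h]] by simp
    then show ?thesis using dbound[OF h] by simp
  qed
  \<comment> \<open>A bump supported where translation by \<open>a\<close> leaves the support: its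
    autocorrelation vanishes at \<open>a\<close> but not at \<one>, whence
    \<open>L > 0\<close>.\<close>
  obtain h0 where h0: "cont h0" "msq h0 > 0" "msq (shift_diff a (autocorr h0)) > 0"
  proof -
    obtain U V where UV: "openin X U" "openin X V" "\<one> \<in> U" "a \<in> V" "disjnt U V"
      using Hausdorff a a1 unfolding Hausdorff_space_def by (metis one_closed topspace_eq)
    define W where "W = U \<inter> {x \<in> topspace X. a \<otimes> x \<in> V}"
    have W: "openin X W"
      unfolding W_def using UV openin_continuous_map_preimage[OF continuous_map_translate[OF a] UV(2)] by auto
    have W1: "\<one> \<in> W" unfolding W_def using UV a by auto
    have "completely_regular_space X"
      using compact_Hausdorff_or_regular_imp_normal_space normal_imp_completely_regular_space compact Hausdorff by blast
    then obtain g where g: "continuous_map X euclideanreal g" "g \<one> = 0" "g ` (topspace X - W) \<subseteq> {1}"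
      using W W1 unfolding completely_regular_space_alt' by blast
    define h where "h = (\<lambda>x. complex_of_real (1 - g x))"
    have h: "cont h" unfolding h_def
      using g(1) unfolding continuous_map_euclidean_iff by (auto intro!: tendsto_intros)
    have h1: "h \<one> = 1" using g by (simp add: h_def)
    have h0: "h x = 0" if "x \<in> carrier G" "x \<notin> W" for x using g that by (auto simp: h_def)
    have prod0: "h (a \<otimes> y) * cnj (h y) = 0" if y: "y \<in> carrier G" for y
    proof (rule ccontr)
      assume "h (a \<otimes> y) * cnj (h y) \<noteq> 0"
      then have "y \<in> W" "a \<otimes> y \<in> W" using h0[OF y] h0[of "a \<otimes> y"] a y by auto
      then show False using UV(5) unfolding W_def disjnt_def by auto
    qed
    have "autocorr h a = M (\<lambda>y. 0)"
      unfolding autocorr_def by (rule M_cong) (use bdd_corr[OF cont_bdd[OF h] cont_bdd[OF h] a] prod0 in auto)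
    then have pa: "autocorr h a = 0" by simp
    have pos: "msq f > 0" if f: "cont f" "f \<one> \<noteq> 0" for f
      unfolding msq_def
      by (rule rmean_pos[of _ \<one>])
         (use f in \<open>auto simp: continuous_map_euclidean_iff intro!: tendsto_intros\<close>)
    have qh: "msq h > 0" by (rule pos[OF h]) (simp add: h1)
    have "msq (shift_diff a (autocorr h)) > 0"
      by (rule pos[OF shift_diff_cont[OF a autocorr_continuous[OF h]]])
         (use a qh in \<open>simp add: shift_diff_def pa autocorr_one[OF cont_bdd[OF h]]\<close>)
    then show ?thesis using that h qh by blast
  qed
  have L: "0 < L"
  proof -
    have "0 < L * (msq h0)\<^sup>2" using max[OF h0(1)] h0(3) by linarith
    then show ?thesis using h0(2) by (simp add: zero_less_mult_iff)
  qed
  have Sne: "S \<noteq> {}" using normalise[OF h0(1,2)] unfolding S_def by blast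
  have L4: "L \<le> 4" unfolding L_def by (rule cSup_least[OF Sne]) (rule S4)
  \<comment> \<open>Proportional to \<open>L^2\<close>, so that
    \<open>\<delta>^2 = 80 * \<epsilon> / L\<close> is proportional to \<open>L\<close>. The factor
    makes \<delta> at most 1/40 (as \<open>L \<le> 4\<close>), as rounding requires, and keeps
    \<open>(17 * \<delta>)^2\<close>, about 0.023 L, below \<open>L / 2\<close> in the final
    contradiction; 17 is one \<delta> for multiplicativity plus 16 for rounding.\<close>
  define \<epsilon> where "\<epsilon> = L\<^sup>2 / 1000000"
  have \<epsilon>: "0 < \<epsilon>" using L by (simp add: \<epsilon>_def)
  have "L - \<epsilon> < Sup S" using \<epsilon> by (simp add: L_def)
  then obtain s where "s \<in> S" "L - \<epsilon> < s" using less_cSupD[OF Sne] by blast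
  then obtain h where h: "cont h" "msq h = 1" and near: "L - \<epsilon> \<le> msq (shift_diff a (autocorr h))"
    unfolding S_def by auto
  have "L * L \<le> L * 4" using L L4 by (intro mult_left_mono) auto
  then have "\<epsilon> \<le> L / 2" using L by (simp add: \<epsilon>_def power2_eq_square)
  then have v: "L / 2 \<le> msq (shift_diff a (autocorr h))" using near by linarith
  define \<delta> where "\<delta> = sqrt (80 * \<epsilon> / L)"
  have \<delta>2: "\<delta>\<^sup>2 = 80 * \<epsilon> / L" using \<epsilon> L by (simp add: \<delta>_def)
  have \<delta>0: "0 \<le> \<delta>" using \<epsilon> L by (simp add: \<delta>_def)
  have \<delta>L: "\<delta>\<^sup>2 = 80 * L / 1000000" unfolding \<delta>2 \<epsilon>_def using L by (simp add: power2_eq_square)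
  have \<delta>40: "\<delta> \<le> 1/40"
  proof (rule power2_le_imp_le)
    show "\<delta>\<^sup>2 \<le> (1/40)\<^sup>2" unfolding \<delta>L using L4 by (simp add: power2_eq_square)
  qed simp
  have mult: "cmod (autocorr h (x \<otimes> y) - autocorr h x * autocorr h y) \<le> \<delta>" if "x \<in> carrier G" "y \<in> carrier G" for x y
  proof (rule power2_le_imp_le[OF _ \<delta>0])
    have "(cmod (autocorr h (x \<otimes> y) - autocorr h x * autocorr h y))\<^sup>2 * (L / 2)
       \<le> (cmod (autocorr h (x \<otimes> y) - autocorr h x * autocorr h y))\<^sup>2 * msq (shift_diff a (autocorr h))"
      by (rule mult_left_mono[OF v]) simp
    also have "\<dots> \<le> 40 * \<epsilon>"
      by (rule near_multiplicative[OF a h max near that])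
    finally show "(cmod (autocorr h (x \<otimes> y) - autocorr h x * autocorr h y))\<^sup>2 \<le> \<delta>\<^sup>2"
      unfolding \<delta>2 using L by (simp add: field_simps)
  qed
  note bh = cont_bdd[OF h(1)]
  have le: "cmod (autocorr h x) \<le> 1" if "x \<in> carrier G" for x using autocorr_bound[OF bh that] h(2) by simp
  obtain \<eta> where \<eta>: "\<eta> \<in> char_group G X" "\<And>x. x \<in> carrier G \<Longrightarrow> cmod (\<eta> x - autocorr h x) \<le> 16 * \<delta>"
    using round_to_character[OF autocorr_continuous[OF h(1)] mult le autocorr_inv[OF bh] _ \<delta>40] autocorr_one[OF bh] h(2)
    by auto
  have "\<eta> a \<noteq> 1"
  proof
    assume "\<eta> a = 1"
    then have d1: "cmod (autocorr h a - 1) \<le> 16 * \<delta>" using \<eta>(2)[OF a] by (simp add: norm_minus_commute)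
    have "msq (shift_diff a (autocorr h)) \<le> (17 * \<delta>)\<^sup>2"
    proof (rule msq_bound)
      show "bdd (shift_diff a (autocorr h))" by (intro cont_bdd shift_diff_cont a autocorr_continuous h)
      fix x assume x: "x \<in> carrier G"
      have "cmod (shift_diff a (autocorr h) x) = cmod ((autocorr h (a \<otimes> x) - autocorr h a * autocorr h x) + (autocorr h a - 1) * autocorr h x)"
        by (simp add: shift_diff_def algebra_simps)
      also have "\<dots> \<le> cmod (autocorr h (a \<otimes> x) - autocorr h a * autocorr h x) + cmod ((autocorr h a - 1) * autocorr h x)"
        by (rule norm_triangle_ineq)
      also have "\<dots> \<le> \<delta> + 16 * \<delta> * 1"
        unfolding norm_mult by (intro add_mono mult_mono mult a x d1 le) (use \<delta>0 in auto)
      finally show "cmod (shift_diff a (autocorr h) x) \<le> 17 * \<delta>" by simp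
    qed
    then have "L / 2 \<le> 289 * \<delta>\<^sup>2" using v by (simp add: power_mult_distrib)
    then show False using L by (simp add: \<delta>L)
  qed
  then show ?thesis using that \<eta>(1) by blast
qed

section \<open>Pontryagin duality\<close>

text \<open>A continuous logarithm \<open>g\<close> exists on the line. Its failure to be additive
  is a continuous function with values in a discrete set, hence constant; corrected by this
  constant, \<open>g\<close> is additive and continuous, so linear.\<close>

lemma real_character_cis:
  fixes f :: "real \<Rightarrow> complex"
  assumes cont: "continuous_on UNIV f" and add: "\<And>x y. f (x + y) = f x * f y" and norm: "\<And>x. cmod (f x) = 1"
  obtains c where "\<And>x. f x = cis (c * x)"
proof -
  have nz: "f x \<noteq> 0" for x using norm[of x] by auto
  obtain g where g: "continuous_on UNIV g" "\<And>x. f x = exp (g x)"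
    using continuous_logarithm_on_contractible[OF cont] nz
    by (metis UNIV_I contractible_UNIV)
  define H where "H p = g (fst p + snd p) - g (fst p) - g (snd p)" for p :: "real \<times> real"
  have expH: "exp (H p) = 1" for p
    unfolding H_def exp_diff g(2)[symmetric] add using nz by simp
  have contH: "continuous_on UNIV H"
    unfolding H_def by (intro continuous_intros continuous_on_compose2[OF g(1)]) auto
  have "H constant_on UNIV"
  proof (rule continuous_discrete_range_constant[OF connected_UNIV contH])
    fix p :: "real \<times> real"
    have "1 \<le> cmod (H p' - H p)" if ne: "H p' \<noteq> H p" for p'
    proof (rule ccontr)
      assume "\<not> 1 \<le> cmod (H p' - H p)"
      then have "\<bar>Im (H p' - H p)\<bar> < 1" using abs_Im_le_cmod[of "H p' - H p"] by linarith
      then have "Ln (exp (H p' - H p)) = H p' - H p" using pi_gt3 by (intro Ln_exp) auto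
      moreover have "exp (H p' - H p) = 1" using expH by (simp add: exp_diff)
      ultimately show False using ne by simp
    qed
    then show "\<exists>e>0. \<forall>y. y \<in> UNIV \<and> H y \<noteq> H p \<longrightarrow> e \<le> cmod (H y - H p)"
      by (intro exI[of _ 1]) auto
  qed
  then obtain h0 where h0: "\<And>p. H p = h0" unfolding constant_on_def by auto
  define c where "c = Im (g 1 + h0)"
  \<comment> \<open>Subtracting the linear function with the same value at 1 leaves an additive
    function that vanishes on the rationals, and by continuity everywhere.\<close>
  define D where "D x = g x + h0 - of_real x * (g 1 + h0)" for x
  have Dadd: "D (x + y) = D x + D y" for x y
    using h0[of "(x,y)"] unfolding H_def D_def by (simp add: algebra_simps)
  have D0: "D 0 = 0" using Dadd[of 0 0] by simp
  have Dn: "D (of_nat n * x) = of_nat n * D x" for n x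
    by (induction n) (simp_all add: D0 Dadd algebra_simps)
  have D1: "D 1 = 0" by (simp add: D_def)
  have Dm: "D (- x) = - D x" for x
    using Dadd[of x "-x"] D0 by (simp add: eq_neg_iff_add_eq_0 add.commute)
  have Dint: "D (of_int k) = 0" for k
  proof (cases "0 \<le> k")
    case True then show ?thesis using Dn[of "nat k" 1] D1 by simp
  next
    case False
    then have *: "of_int k = - (of_nat (nat (- k)) * (1::real))" by simp
    show ?thesis unfolding * Dm Dn D1 by simp
  qed
  have Drat: "D x = 0" if x: "x \<in> \<rat>" for x
  proof -
    obtain k n where "n > 0" and x: "x = of_int k / of_int n" using Rats_cases'[OF x] by metis
    then have "of_nat (nat n) * x = of_int k" by simp
    then have "of_nat (nat n) * D x = 0" unfolding Dn[symmetric] by (simp only: Dint)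
    then show ?thesis using \<open>n > 0\<close> by simp
  qed
  have contD: "continuous_on UNIV D"
    unfolding D_def by (intro continuous_intros g(1))
  have Dall: "D x = 0" for x
    by (rule continuous_constant_on_closure[of \<rat> D 0])
       (use contD Drat in \<open>auto simp: Rats_closure_real\<close>)
  have h00: "exp h0 = 1" using expH[of "(0,0)"] h0 by simp
  have "f x = cis (c * x)" for x
  proof -
    have "g x + h0 = of_real x * (g 1 + h0)" using Dall[of x] by (simp add: D_def)
    then have fx: "f x = exp (of_real x * (g 1 + h0))" 
      by (metis exp_add g(2) h00 mult.right_neutral)
    have "cmod (exp (of_real 1 * (g 1 + h0))) = 1" using norm[of 1] g(2)[of 1] h00 by (simp add: exp_add)
    then have "Re (g 1 + h0) = 0" by simp
    then have "g 1 + h0 = \<i> * of_real c" by (simp add: c_def complex_eq_iff)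
    then show ?thesis unfolding fx by (simp add: cis_conv_exp mult_ac)
  qed
  then show ?thesis by (rule that)
qed

lemma cis_linear_inj:
  assumes "\<And>x. cis (c * x) = cis (d * x)" shows "c = d"
proof (rule ccontr)
  assume ne: "c \<noteq> d"
  define x where "x = pi / (c - d)"
  have "cis (c * x) = cis (d * x) * cis ((c - d) * x)" by (simp add: cis_mult algebra_simps)
  also have "cis ((c - d) * x) = -1" using ne by (simp add: x_def)
  finally show False using assms[of x] by simp
qed

section \<open>The character group and its own characters\<close>

lemma char_group_mult:
  assumes "\<eta> \<in> char_group G X" "\<kappa> \<in> char_group G X"
  shows "(\<lambda>x. \<eta> x * \<kappa> x) \<in> char_group G X"
  using assms unfolding char_group_def continuous_map_euclidean_iff
  by (auto intro!: tendsto_intros simp: norm_mult)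

lemma char_group_cnj: "\<eta> \<in> char_group G X \<Longrightarrow> (\<lambda>x. cnj (\<eta> x)) \<in> char_group G X"
  unfolding char_group_def continuous_map_euclidean_iff by (auto intro!: tendsto_intros)

lemma char_group_one: "(\<lambda>x. 1) \<in> char_group G X"
  unfolding char_group_def by auto

lemma char_group_power: "\<eta> \<in> char_group G X \<Longrightarrow> (\<lambda>x. \<eta> x ^ n) \<in> char_group G X"
  by (induction n) (auto intro: char_group_one char_group_mult)

lemma char_group_continuous: "\<eta> \<in> char_group G X \<Longrightarrow> continuous_map X euclidean \<eta>"
  by (simp add: char_group_def)

lemma char_group_norm: "\<eta> \<in> char_group G X \<Longrightarrow> cmod (\<eta> x) = 1"
  unfolding char_group_def by (cases "x \<in> carrier G") auto

lemma char_group_hom: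
  "\<eta> \<in> char_group G X \<Longrightarrow> x \<in> carrier G \<Longrightarrow> y \<in> carrier G \<Longrightarrow> \<eta> (x \<otimes>\<^bsub>G\<^esub> y) = \<eta> x * \<eta> y"
  by (simp add: char_group_def)

lemma (in compact_ab_group) char_one:
  assumes "\<eta> \<in> char_group G X" shows "\<eta> \<one> = 1"
proof -
  have "\<eta> \<one> * \<eta> \<one> = \<eta> \<one>" using char_group_hom[OF assms one_closed one_closed] by simp
  then show ?thesis using char_group_norm[OF assms, of \<one>] by auto
qed

lemma char_group_cnj_mult: "\<eta> \<in> char_group G X \<Longrightarrow> \<eta> x * cnj (\<eta> x) = 1"
  using char_group_norm[of \<eta> G X x] by (simp add: complex_norm_square[symmetric] del: of_real_power)

lemma char_group_eqI:
  "\<eta> \<in> char_group G X \<Longrightarrow> \<kappa> \<in> char_group G X \<Longrightarrow> (\<And>x. x \<in> carrier G \<Longrightarrow> \<eta> x = \<kappa> x) \<Longrightarrow> \<eta> = \<kappa>"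
  by (rule ext) (metis (mono_tags, lifting) char_group_def mem_Collect_eq)

text \<open>The dual of a compact group is discrete, so its characters are all homomorphisms to the
  circle and no continuity is asked. Values outside \<open>char_group G X\<close> are
  unconstrained.\<close>

definition bidual :: "('a, 'b) monoid_scheme \<Rightarrow> 'a topology \<Rightarrow> (('a \<Rightarrow> complex) \<Rightarrow> complex) \<Rightarrow> bool" where
  "bidual G X \<omega> \<longleftrightarrow> (\<forall>\<eta>\<in>char_group G X. cmod (\<omega> \<eta>) = 1) \<and>
     (\<forall>\<eta>\<in>char_group G X. \<forall>\<kappa>\<in>char_group G X. \<omega> (\<lambda>x. \<eta> x * \<kappa> x) = \<omega> \<eta> * \<omega> \<kappa>)"

lemma bidual_mult:
  "bidual G X \<omega> \<Longrightarrow> \<eta> \<in> char_group G X \<Longrightarrow> \<kappa> \<in> char_group G X \<Longrightarrow> \<omega> (\<lambda>x. \<eta> x * \<kappa> x) = \<omega> \<eta> * \<omega> \<kappa>"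
  by (simp add: bidual_def)

lemma bidual_norm: "bidual G X \<omega> \<Longrightarrow> \<eta> \<in> char_group G X \<Longrightarrow> cmod (\<omega> \<eta>) = 1"
  by (simp add: bidual_def)

lemma bidual_one: "bidual G X \<omega> \<Longrightarrow> \<omega> (\<lambda>x. 1) = 1"
proof -
  assume w: "bidual G X \<omega>"
  then show ?thesis
    using bidual_mult[OF w char_group_one char_group_one] bidual_norm[OF w char_group_one] by auto
qed

lemma bidual_cnj:
  assumes w: "bidual G X \<omega>" and \<eta>: "\<eta> \<in> char_group G X"
  shows "\<omega> (\<lambda>x. cnj (\<eta> x)) = cnj (\<omega> \<eta>)"
proof -
  have "\<omega> \<eta> * \<omega> (\<lambda>x. cnj (\<eta> x)) = \<omega> (\<lambda>x. \<eta> x * cnj (\<eta> x))"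
    by (rule bidual_mult[OF w \<eta> char_group_cnj[OF \<eta>], symmetric])
  also have "\<dots> = 1" using bidual_one[OF w] by (simp add: char_group_cnj_mult[OF \<eta>])
  finally have 1: "\<omega> \<eta> * \<omega> (\<lambda>x. cnj (\<eta> x)) = 1" .
  have "cmod (\<omega> \<eta>) = 1" by (rule bidual_norm[OF w \<eta>])
  then have 2: "cnj (\<omega> \<eta>) * \<omega> \<eta> = 1" by (simp add: complex_norm_square[symmetric] mult.commute del: of_real_power)
  have "cnj (\<omega> \<eta>) * (\<omega> \<eta> * \<omega> (\<lambda>x. cnj (\<eta> x))) = \<omega> (\<lambda>x. cnj (\<eta> x))"
    by (simp add: mult.assoc[symmetric] 2)
  then show ?thesis by (simp add: 1)
qed

text \<open>\<open>twisted \<omega> f g\<close>: \<open>f\<close> is a trigonometric polynomial and \<open>g\<close> arises from it by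
multiplying the coefficient of each character \<open>\<eta>\<close> by \<open>cnj (\<omega> \<eta>)\<close>.\<close>

inductive twisted :: "('a, 'b) monoid_scheme \<Rightarrow> 'a topology \<Rightarrow> (('a \<Rightarrow> complex) \<Rightarrow> complex)
    \<Rightarrow> ('a \<Rightarrow> complex) \<Rightarrow> ('a \<Rightarrow> complex) \<Rightarrow> bool" for G X \<omega> where
  char: "\<eta> \<in> char_group G X \<Longrightarrow> twisted G X \<omega> (\<lambda>x. c * \<eta> x) (\<lambda>x. c * (cnj (\<omega> \<eta>) * \<eta> x))"
| add: "twisted G X \<omega> f g \<Longrightarrow> twisted G X \<omega> f' g' \<Longrightarrow> twisted G X \<omega> (\<lambda>x. f x + f' x) (\<lambda>x. g x + g' x)"

lemma twisted_char_mult: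
  assumes w: "bidual G X \<omega>" and \<eta>: "\<eta> \<in> char_group G X" and t: "twisted G X \<omega> f g"
  shows "twisted G X \<omega> (\<lambda>x. c * \<eta> x * f x) (\<lambda>x. c * (cnj (\<omega> \<eta>) * \<eta> x) * g x)"
  using t
proof induction
  case (char \<kappa> d)
  have "\<omega> (\<lambda>x. \<eta> x * \<kappa> x) = \<omega> \<eta> * \<omega> \<kappa>" by (rule bidual_mult[OF w \<eta> char])
  then show ?case
    using twisted.char[OF char_group_mult[OF \<eta> char], of \<omega> "c * d"] by (simp add: mult_ac)
next
  case (add f g f' g')
  then show ?case using twisted.add[OF add.IH] by (simp add: distrib_left)
qed

text \<open>Holds because \<omega> is multiplicative; it lets twisting pass to powers, and so to
  moments. Since \<open>twisted\<close> is a relation, the coefficients of a trigonometric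
  polynomial need not be shown unique.\<close>

lemma twisted_mult:
  assumes w: "bidual G X \<omega>" and t: "twisted G X \<omega> f g" "twisted G X \<omega> f' g'"
  shows "twisted G X \<omega> (\<lambda>x. f x * f' x) (\<lambda>x. g x * g' x)"
  using t(1)
proof induction
  case (char \<eta> c)
  show ?case by (rule twisted_char_mult[OF w char t(2)])
next
  case (add f g f' g')
  then show ?case using twisted.add[OF add.IH] by (simp add: distrib_right)
qed

lemma twisted_const: "bidual G X \<omega> \<Longrightarrow> twisted G X \<omega> (\<lambda>x. c) (\<lambda>x. c)"
  using twisted.char[OF char_group_one, of G X \<omega> c] by (simp add: bidual_one)

lemma twisted_power: "bidual G X \<omega> \<Longrightarrow> twisted G X \<omega> f g \<Longrightarrow> twisted G X \<omega> (\<lambda>x. f x ^ n) (\<lambda>x. g x ^ n)"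
  by (induction n) (auto intro: twisted_mult twisted_const)

lemma twisted_sum:
  assumes w: "bidual G X \<omega>" and "finite A" "\<And>i. i \<in> A \<Longrightarrow> twisted G X \<omega> (f i) (g i)"
  shows "twisted G X \<omega> (\<lambda>x. \<Sum>i\<in>A. f i x) (\<lambda>x. \<Sum>i\<in>A. g i x)"
  using assms(2,3) by (induction A rule: finite_induct) (auto intro: twisted.add twisted_const[OF w])

lemma (in compact_ab_group) twisted_continuous:
  "twisted G X \<omega> f g \<Longrightarrow> continuous_map X euclidean f \<and> continuous_map X euclidean g"
  by (induction rule: twisted.induct)
     (auto simp: continuous_map_euclidean_iff char_group_def intro!: tendsto_intros)

text \<open>By invariance the mean kills every nontrivial character, and on the trivial one \<omega>
  is 1.\<close>

lemma (in compact_ab_group_mean) twisted_mean: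
  assumes w: "bidual G X \<omega>" and t: "twisted G X \<omega> f g" shows "M f = M g"
  using t
proof induction
  case (char \<eta> c)
  have b: "bdd \<eta>" by (rule cont_bdd[OF char_group_continuous[OF char]])
  show ?case
  proof (cases "\<exists>a\<in>carrier G. \<eta> a \<noteq> 1")
    case True
    then obtain a where a: "a \<in> carrier G" "\<eta> a \<noteq> 1" by auto
    have "M \<eta> = M (\<lambda>x. \<eta> (a \<otimes> x))" by (rule M_translate[OF a(1) b, symmetric])
    also have "\<dots> = M (\<lambda>x. \<eta> a * \<eta> x)"
      by (rule M_cong) (use a b char in \<open>auto simp: char_group_hom\<close>)
    also have "\<dots> = \<eta> a * M \<eta>" by (rule M_cmult[OF b])
    finally have "M \<eta> = 0" using a(2) by simp
    then have "M (\<lambda>x. d * \<eta> x) = 0" for d by (simp add: M_cmult[OF b])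
    from this[of c] this[of "c * cnj (\<omega> \<eta>)"] show ?thesis by (simp add: mult.assoc)
  next
    case False
    then have "\<eta> = (\<lambda>x. 1)" by (intro char_group_eqI[OF char char_group_one]) auto
    then show ?thesis by (simp add: bidual_one[OF w])
  qed
next
  case (add f g f' g')
  have "bdd f" "bdd g" "bdd f'" "bdd g'"
    using twisted_continuous[OF add.hyps(1)] twisted_continuous[OF add.hyps(2)] by (auto intro: cont_bdd)
  then show ?case by (simp add: M_add add.IH)
qed

text \<open>Twisting preserves all moments, hence the supremum, of a nonnegative trigonometric
polynomial.\<close>

lemma (in compact_ab_group) finite_duality:
  assumes w: "bidual G X \<omega>" and F: "finite F" "F \<subseteq> char_group G X"
  obtains k where "k \<in> carrier G" "\<And>\<eta>. \<eta> \<in> F \<Longrightarrow> \<eta> k = \<omega> \<eta>"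
proof -
  obtain M where "invariant_mean G M" using invariant_mean_exists by auto
  then interpret compact_ab_group_mean G X M by unfold_locales
  \<comment> \<open>Each summand lies between 0 and 4 and equals 4 only where its unit number is 1.
    So \<open>p\<close> reaches the top value \<open>4 * card F\<close> at \<one>, and a point where
    \<open>p'\<close> reaches it realises \<omega> on all of \<open>F\<close>.\<close>
  define p where "p = (\<lambda>x. \<Sum>\<eta>\<in>F. 2 + 2 * Re (\<eta> x))"
  define p' where "p' = (\<lambda>x. \<Sum>\<eta>\<in>F. 2 + 2 * Re (cnj (\<omega> \<eta>) * \<eta> x))"
  have "twisted G X \<omega> (\<lambda>x. \<Sum>\<eta>\<in>F. 2 + (1 * \<eta> x + 1 * cnj (\<eta> x)))
     (\<lambda>x. \<Sum>\<eta>\<in>F. 2 + (1 * (cnj (\<omega> \<eta>) * \<eta> x) + 1 * (cnj (\<omega> (\<lambda>x. cnj (\<eta> x))) * cnj (\<eta> x))))"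
    by (intro twisted_sum[OF w F(1)] twisted.add twisted_const[OF w] twisted.char char_group_cnj)
       (use F in auto)
  also have "(\<lambda>x. \<Sum>\<eta>\<in>F. 2 + (1 * \<eta> x + 1 * cnj (\<eta> x))) = (\<lambda>x. of_real (p x))"
    unfolding p_def of_real_sum by (intro ext sum.cong) (auto simp: complex_eq_iff)
  also have "(\<lambda>x. \<Sum>\<eta>\<in>F. 2 + (1 * (cnj (\<omega> \<eta>) * \<eta> x) + 1 * (cnj (\<omega> (\<lambda>x. cnj (\<eta> x))) * cnj (\<eta> x))))
     = (\<lambda>x. of_real (p' x))"
    unfolding p'_def of_real_sum
    by (intro ext sum.cong) (use F in \<open>auto simp: complex_eq_iff bidual_cnj[OF w] subset_iff\<close>)
  finally have tw: "twisted G X \<omega> (\<lambda>x. of_real (p x)) (\<lambda>x. of_real (p' x))" .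
  have bd: "bdr (\<lambda>x. p x ^ N)" "bdr (\<lambda>x. p' x ^ N)" for N
    using twisted_continuous[OF tw] by (auto intro: cont_bdd)
  have moments: "rmean (\<lambda>x. p x ^ N) = rmean (\<lambda>x. p' x ^ N)" for N
    using twisted_mean[OF w twisted_power[OF w tw, of N]] by (simp add: rmean_def)
  have cr: "continuous_map X euclideanreal f" if "cont (\<lambda>x. complex_of_real (f x))" for f
    using that unfolding continuous_map_euclidean_iff by (auto dest!: tendsto_Re)
  have cp: "continuous_map X euclideanreal p" "continuous_map X euclideanreal p'"
    using twisted_continuous[OF tw] by (auto intro: cr)
  have bnd: "0 \<le> 2 + 2 * Re z" "2 + 2 * Re z \<le> 4" if "cmod z = 1" for z
    using abs_Re_le_cmod[of z] that by auto
  have unit: "cmod (\<eta> x) = 1" "cmod (cnj (\<omega> \<eta>) * \<eta> x) = 1" if "\<eta> \<in> F" for \<eta> x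
    using that F w char_group_norm[of \<eta> G X x] unfolding bidual_def by (auto simp: norm_mult)
  have nn: "0 \<le> p x" "0 \<le> p' x" for x
    unfolding p_def p'_def by (intro sum_nonneg bnd unit; simp)+
  have "compactin euclideanreal (p' ` topspace X)"
    using cp(2) compact by (intro image_compactin[of X]) (auto simp: compact_space_def)
  then have "compact (p' ` carrier G)" by simp
  then obtain k where k: "k \<in> carrier G" "\<And>x. x \<in> carrier G \<Longrightarrow> p' x \<le> p' k"
    using compact_attains_sup[of "p' ` carrier G"] by auto
  have le4: "p' k \<le> 4 * real (card F)"
    unfolding p'_def using sum_bounded_above[of F "\<lambda>\<eta>. 2 + 2 * Re (cnj (\<omega> \<eta>) * \<eta> k)" 4] bnd(2)[OF unit(2)]
    by (simp add: mult.commute)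
  have p1: "p \<one> = 4 * real (card F)"
  proof -
    have "p \<one> = (\<Sum>\<eta>\<in>F. 4)"
      unfolding p_def
    proof (rule sum.cong)
      fix \<eta> assume "\<eta> \<in> F"
      then show "2 + 2 * Re (\<eta> \<one>) = 4" using char_one[of \<eta>] F(2) by (auto simp only: subset_iff one_complex.simps)
    qed simp
    then show ?thesis by simp
  qed
  have "p' k = 4 * real (card F)"
  proof (rule ccontr)
    assume "p' k \<noteq> 4 * real (card F)"
    then have lt: "p' k < p \<one>" using le4 p1 by simp
    \<comment> \<open>Between the two suprema: the moments of \<open>p\<close> are at least
      \<open>c * B ^ N\<close>, those of \<open>p'\<close> at most \<open>p' k ^ N\<close>, which is
      impossible for large \<open>N\<close>.\<close>
    define B where "B = (p' k + p \<one>) / 2"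
    have B: "p' k < B" "B < p \<one>" "0 < B" using lt nn(2)[of k] by (auto simp: B_def)
    define U where "U = {x \<in> topspace X. p x \<in> {B<..}}"
    have "openin X U" unfolding U_def by (rule openin_continuous_map_preimage[OF cp(1)]) auto
    moreover have "U \<noteq> {}" using B by (auto simp: U_def)
    ultimately obtain c where c: "c > 0" "\<And>f s. bdr f \<Longrightarrow> (\<And>x. x \<in> carrier G \<Longrightarrow> 0 \<le> f x) \<Longrightarrow>
       (\<And>x. x \<in> U \<Longrightarrow> s \<le> f x) \<Longrightarrow> c * s \<le> rmean f" using open_mass by metis
    have *: "c \<le> (p' k / B) ^ N" for N
    proof -
      have "c * B ^ N \<le> rmean (\<lambda>x. p x ^ N)"
        by (rule c(2)) (use bd nn B in \<open>auto simp: U_def intro!: power_mono\<close>)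
      also have "\<dots> \<le> rmean (\<lambda>x. p' k ^ N)"
        unfolding moments by (rule rmean_mono) (use bd nn k in \<open>auto intro!: power_mono\<close>)
      finally have "c * B ^ N \<le> p' k ^ N" by simp
      then show ?thesis using B by (simp add: power_divide field_simps)
    qed
    have "p' k / B < 1" using B by simp
    then obtain N where "(p' k / B) ^ N < c" using real_arch_pow_inv[OF c(1)] by blast
    then show False using *[of N] by simp
  qed
  then have eq: "(\<Sum>\<eta>\<in>F. 2 + 2 * Re (cnj (\<omega> \<eta>) * \<eta> k)) = (\<Sum>\<eta>\<in>F. 4)" by (simp add: p'_def)
  have "\<eta> k = \<omega> \<eta>" if \<eta>: "\<eta> \<in> F" for \<eta>
  proof -
    define z where "z = cnj (\<omega> \<eta>) * \<eta> k"
    have "2 + 2 * Re z = 4"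
      unfolding z_def by (rule sum_mono_inv[OF eq bnd(2)[OF unit(2)] \<eta> F(1)])
    then have "Re z = 1" by simp
    moreover have "cmod z = 1" unfolding z_def by (rule unit(2)[OF \<eta>])
    ultimately have "z = 1" using cmod_power2[of z] by (simp add: complex_eq_iff)
    moreover have "\<omega> \<eta> * cnj (\<omega> \<eta>) = 1"
      using w \<eta> F unfolding bidual_def by (auto simp: complex_norm_square[symmetric] simp del: of_real_power)
    ultimately show ?thesis unfolding z_def by (metis mult.assoc mult.left_neutral mult.right_neutral)
  qed
  then show ?thesis using that k by blast
qed

text \<open>The points realising \<omega> at one character form a closed set, and
  \<open>finite_duality\<close> says that finitely many of these sets meet; compactness does the
  rest.\<close>

theorem (in compact_ab_group) duality:
  assumes w: "bidual G X \<omega>"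
  obtains k where "k \<in> carrier G" "\<And>\<eta>. \<eta> \<in> char_group G X \<Longrightarrow> \<eta> k = \<omega> \<eta>"
proof -
  define C where "C = (\<lambda>\<eta>. {k \<in> topspace X. \<eta> k \<in> {\<omega> \<eta>}})"
  have cl: "closedin X (C \<eta>)" if "\<eta> \<in> char_group G X" for \<eta>
    unfolding C_def by (rule closedin_continuous_map_preimage[OF char_group_continuous[OF that]]) auto
  have "\<Inter> (C ` char_group G X) \<noteq> {}"
  proof (rule compact[unfolded compact_space_fip, rule_format], intro conjI ballI allI impI)
    fix \<F> assume "finite \<F> \<and> \<F> \<subseteq> C ` char_group G X"
    then obtain F where F: "finite F" "F \<subseteq> char_group G X" "\<F> = C ` F" by (meson finite_subset_image)
    obtain k where "k \<in> carrier G" "\<And>\<eta>. \<eta> \<in> F \<Longrightarrow> \<eta> k = \<omega> \<eta>" using finite_duality[OF w F(1,2)] by metis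
    then show "\<Inter>\<F> \<noteq> {}" unfolding F(3) C_def by auto
  qed (use cl in auto)
  then obtain k where k: "\<And>\<eta>. \<eta> \<in> char_group G X \<Longrightarrow> k \<in> C \<eta>" by auto
  show ?thesis
    by (rule that[of k]) (use k k[OF char_group_one] in \<open>auto simp: C_def\<close>)
qed

lemma (in compact_ab_group) char_ext:
  assumes x: "x \<in> carrier G" and y: "y \<in> carrier G" and eq: "\<And>\<eta>. \<eta> \<in> char_group G X \<Longrightarrow> \<eta> x = \<eta> y"
  shows "x = y"
proof (rule ccontr)
  assume ne: "x \<noteq> y"
  have "x \<otimes> inv y \<noteq> \<one>" using ne x y by (metis inv_equality inv_inv inv_closed)
  then obtain \<eta> where \<eta>: "\<eta> \<in> char_group G X" "\<eta> (x \<otimes> inv y) \<noteq> 1"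
    using characters_separate[of "x \<otimes> inv y"] x y by auto
  have "\<eta> (x \<otimes> inv y) = \<eta> (y \<otimes> inv y)"
    unfolding char_group_hom[OF \<eta>(1) x inv_closed[OF y]] char_group_hom[OF \<eta>(1) y inv_closed[OF y]]
    by (simp only: eq[OF \<eta>(1)])
  then show False using \<eta>(2) y char_one[OF \<eta>(1)] by simp
qed

text \<open>The characters jointly embed the group in a product of complex planes, as an injective
  continuous map from a compact to a Hausdorff space. So the group topology is the one induced by
  its characters.\<close>

lemma (in compact_ab_group) continuous_map_charI:
  assumes f: "f ` topspace Y \<subseteq> carrier G"
    and c: "\<And>\<eta>. \<eta> \<in> char_group G X \<Longrightarrow> continuous_map Y euclidean (\<lambda>y. \<eta> (f y))"
  shows "continuous_map Y X f"
proof -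
  define P where "P = product_topology (\<lambda>_. euclidean :: complex topology) (char_group G X)"
  define E where "E = (\<lambda>x. \<lambda>\<eta>\<in>char_group G X. \<eta> x)"
  have E: "continuous_map X P E"
    unfolding P_def E_def by (subst continuous_map_componentwise) (auto simp: char_group_continuous)
  have "inj_on E (topspace X)"
    unfolding E_def inj_on_def by (auto intro!: char_ext) (metis restrict_apply')
  then have "embedding_map X P E"
    using E compact by (intro continuous_imp_embedding_map)
      (auto simp: P_def Hausdorff_space_product_topology)
  then obtain g where g: "homeomorphic_maps X (subtopology P (E ` topspace X)) E g"
    unfolding embedding_map_def homeomorphic_map_maps by auto
  have "continuous_map Y P (\<lambda>y. E (f y))"
    unfolding P_def E_def by (subst continuous_map_componentwise) (auto simp: c)
  then have "continuous_map Y (subtopology P (E ` topspace X)) (\<lambda>y. E (f y))"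
    using f by (auto simp: continuous_map_in_subtopology)
  then have "continuous_map Y X (g \<circ> (\<lambda>y. E (f y)))"
    using g unfolding homeomorphic_maps_def by (auto intro: continuous_map_compose)
  then show ?thesis
    by (rule continuous_map_eq) (use g f in \<open>auto simp: homeomorphic_maps_def\<close>)
qed

section \<open>Splitting off rank one quotients of the dual\<close>

context compact_ab_group
begin

lemma subgroup_top_ab_group:
  assumes H: "subgroup H G"
  shows "top_ab_group (G\<lparr>carrier := H\<rparr>) (subtopology X H)"
proof -
  have HG: "H \<subseteq> carrier G" using H by (rule subgroup.subset)
  have "comm_group (G\<lparr>carrier := H\<rparr>)"
    by (rule group.group_comm_groupI[OF subgroup_imp_group[OF H]]) (use HG m_comm in auto)
  moreover have "continuous_map (prod_topology (subtopology X H) (subtopology X H)) (subtopology X H)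
      (\<lambda>(x, y). x \<otimes> y)"
  proof -
    have "continuous_map (prod_topology (subtopology X H) (subtopology X H)) X (\<lambda>p. fst p \<otimes> snd p)"
      by (intro continuous_map_m continuous_map_into_fulltopology[OF continuous_map_fst]
          continuous_map_into_fulltopology[OF continuous_map_snd])
    then show ?thesis
      using subgroup.m_closed[OF H] by (auto simp: continuous_map_in_subtopology case_prod_unfold)
  qed
  moreover have "continuous_map (subtopology X H) (subtopology X H) (m_inv (G\<lparr>carrier := H\<rparr>))"
  proof -
    have "continuous_map (subtopology X H) X (\<lambda>x. inv x)"
      by (intro continuous_map_inv continuous_map_from_subtopology) simp
    then have "continuous_map (subtopology X H) (subtopology X H) (\<lambda>x. inv x)"
      using subgroup.m_inv_closed[OF H] by (auto simp: continuous_map_in_subtopology)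
    then show ?thesis by (rule continuous_map_eq) (use H in simp)
  qed
  ultimately show ?thesis
    using HG unfolding top_ab_group_def by auto
qed

lemma closed_subgroup:
  assumes H: "subgroup H G" and cl: "closedin X H"
  shows "compact_ab_group (G\<lparr>carrier := H\<rparr>) (subtopology X H)"
  by unfold_locales
     (use subgroup_top_ab_group[OF H] closedin_compact_space[OF compact cl] Hausdorff in
      \<open>auto simp: compact_space_subtopology Hausdorff_space_subtopology\<close>)

lemma direct_product_unique:
  assumes A: "subgroup A G" and B: "subgroup B G" and int: "A \<inter> B \<subseteq> {\<one>}"
    and in': "a \<in> A" "b \<in> B" "a' \<in> A" "b' \<in> B" and eq: "a \<otimes> b = a' \<otimes> b'"
  shows "a = a' \<and> b = b'"
proof -
  have G: "a \<in> carrier G" "b \<in> carrier G" "a' \<in> carrier G" "b' \<in> carrier G"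
    using in' subgroup.subset[OF A] subgroup.subset[OF B] by auto
  have "inv a' \<otimes> a = inv a' \<otimes> (a \<otimes> b) \<otimes> inv b" using G by (simp add: m_assoc)
  also have "\<dots> = b' \<otimes> inv b" unfolding eq using G by (simp add: m_assoc[symmetric])
  finally have *: "inv a' \<otimes> a = b' \<otimes> inv b" .
  have "inv a' \<otimes> a \<in> A" "b' \<otimes> inv b \<in> B"
    using in' A B by (auto intro: subgroup.m_closed subgroup.m_inv_closed)
  then have 1: "inv a' \<otimes> a = \<one>" "b' \<otimes> inv b = \<one>" using int * by auto
  have "a' \<otimes> (inv a' \<otimes> a) = a" "(b' \<otimes> inv b) \<otimes> b = b'"
    using G by (simp_all add: m_assoc[symmetric], simp add: m_assoc)
  then show ?thesis using 1 G by simp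
qed

lemma connected_space_image:
  assumes "connected_space X" "continuous_map X Y f"
  shows "connected_space (subtopology Y (f ` carrier G))"
proof -
  have "connectedin X (carrier G)" using assms(1) connectedin_topspace[of X] by (simp only: topspace_eq)
  from connectedin_continuous_map_image[OF assms(2) this] show ?thesis by (simp only: connectedin_def)
qed

lemma internal_direct_product:
  assumes A: "subgroup A G" "closedin X A" and B: "subgroup B G" "closedin X B"
    and int: "A \<inter> B \<subseteq> {\<one>}" and prod: "\<And>x. x \<in> carrier G \<Longrightarrow> \<exists>a\<in>A. \<exists>b\<in>B. x = a \<otimes> b"
  shows "top_iso (G\<lparr>carrier := A\<rparr> \<times>\<times> G\<lparr>carrier := B\<rparr>)
               (prod_topology (subtopology X A) (subtopology X B)) G X (\<lambda>(a, b). a \<otimes> b)"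
proof -
  have AG: "A \<subseteq> carrier G" and BG: "B \<subseteq> carrier G" using A B subgroup.subset by blast+
  have inj: "inj_on (\<lambda>(a, b). a \<otimes> b) (A \<times> B)"
  proof (rule inj_onI, clarify)
    fix a b a' b' assume "a \<in> A" "b \<in> B" "a' \<in> A" "b' \<in> B" "a \<otimes> b = a' \<otimes> b'"
    then show "a = a' \<and> b = b'" by (rule direct_product_unique[OF A(1) B(1) int])
  qed
  have img: "(\<lambda>(a, b). a \<otimes> b) ` (A \<times> B) = carrier G"
    using AG BG prod by (auto simp: image_iff)
  have "(\<lambda>(a, b). a \<otimes> b) \<in> iso (G\<lparr>carrier := A\<rparr> \<times>\<times> G\<lparr>carrier := B\<rparr>) G"
    using inj img AG BG by (auto simp: iso_def hom_def bij_betw_def subset_iff m_ac)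
  moreover have "homeomorphic_map (prod_topology (subtopology X A) (subtopology X B)) X (\<lambda>(a, b). a \<otimes> b)"
  proof (rule continuous_imp_homeomorphic_map)
    show "continuous_map (prod_topology (subtopology X A) (subtopology X B)) X (\<lambda>(a, b). a \<otimes> b)"
      unfolding case_prod_unfold
      by (intro continuous_map_m continuous_map_into_fulltopology[OF continuous_map_fst]
          continuous_map_into_fulltopology[OF continuous_map_snd])
    show "compact_space (prod_topology (subtopology X A) (subtopology X B))"
      using closedin_compact_space[OF compact A(2)] closedin_compact_space[OF compact B(2)]
      by (simp add: compact_space_prod_topology compact_space_subtopology)
  qed (use inj img AG BG Hausdorff in \<open>auto simp: Int_absorb1\<close>)
  ultimately show ?thesis unfolding top_iso_def by blast
qed

text \<open>As for linear projections, \<open>x\<close> is the product of \<open>p x\<close> and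
  \<open>inv p x \<otimes> x\<close>. Compactness makes the image closed and the algebraic splitting
  topological.\<close>

lemma idempotent_splits:
  assumes pc: "continuous_map X X p" and hom: "\<And>x y. x \<in> carrier G \<Longrightarrow> y \<in> carrier G \<Longrightarrow> p (x \<otimes> y) = p x \<otimes> p y"
    and idem: "\<And>x. x \<in> carrier G \<Longrightarrow> p (p x) = p x"
  defines "S \<equiv> p ` carrier G" and "L \<equiv> {x \<in> carrier G. p x = \<one>}"
  shows "subgroup S G" "subgroup L G" "closedin X S"
    "top_iso (G\<lparr>carrier := S\<rparr> \<times>\<times> G\<lparr>carrier := L\<rparr>)
               (prod_topology (subtopology X S) (subtopology X L)) G X (\<lambda>(s, l). s \<otimes> l)"
proof -
  have cl: "p x \<in> carrier G" if "x \<in> carrier G" for x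
    using pc that by (auto simp: continuous_map_def)
  interpret p: group_hom G G p
    by unfold_locales (use cl hom in \<open>auto simp: hom_def\<close>)
  show S: "subgroup S G" unfolding S_def by (rule p.img_is_subgroup)
  have Lk: "L = kernel G G p" by (auto simp: L_def kernel_def)
  show L: "subgroup L G" unfolding Lk by (rule p.subgroup_kernel)
  show cS: "closedin X S"
    unfolding S_def using image_compactin[OF _ pc, of "carrier G"] compact Hausdorff
    by (auto simp: compact_space_def intro: compactin_imp_closedin)
  have "closedin X {x \<in> topspace X. p x \<in> {\<one>}}"
    by (rule closedin_continuous_map_preimage[OF pc]) (use Hausdorff in \<open>auto intro: closedin_Hausdorff_singleton\<close>)
  then have cL: "closedin X L" by (simp add: L_def)
  show "top_iso (G\<lparr>carrier := S\<rparr> \<times>\<times> G\<lparr>carrier := L\<rparr>)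
               (prod_topology (subtopology X S) (subtopology X L)) G X (\<lambda>(s, l). s \<otimes> l)"
  proof (rule internal_direct_product[OF S cS L cL])
    show "S \<inter> L \<subseteq> {\<one>}" using idem by (auto simp: S_def L_def)
    fix x assume x: "x \<in> carrier G"
    have px: "p x \<in> carrier G" by (rule cl[OF x])
    have "x = p x \<otimes> (inv p x \<otimes> x)" using x px m_assoc[of "p x" "inv p x" x] by simp
    moreover have "inv p x \<otimes> x \<in> L"
      unfolding L_def using x px idem[OF x] by simp
    moreover have "p x \<in> S" unfolding S_def using x by (rule imageI)
    ultimately show "\<exists>a\<in>S. \<exists>b\<in>L. x = a \<otimes> b" by (intro bexI)
  qed
qed

text \<open>For each real \<open>x\<close> the map sending \<eta> to
  \<open>cis (x * \<rho> \<eta>)\<close> is a character of the dual, hence evaluation at a point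
  \<open>b x\<close>. Additivity and continuity in \<open>x\<close> are tested on
  characters.\<close>

lemma one_parameter_subgroup:
  assumes \<rho>: "\<forall>\<eta>\<in>char_group G X. \<forall>\<kappa>\<in>char_group G X. \<rho> (\<lambda>x. \<eta> x * \<kappa> x) = \<rho> \<eta> + \<rho> \<kappa>"
  obtains b where "continuous_map euclideanreal X b" "\<And>x y. b (x + y) = b x \<otimes> b y" "\<And>x. b x \<in> carrier G"
    "\<And>\<eta> x. \<eta> \<in> char_group G X \<Longrightarrow> \<eta> (b x) = cis (x * \<rho> \<eta>)"
proof -
  have "\<exists>k\<in>carrier G. \<forall>\<eta>\<in>char_group G X. \<eta> k = cis (x * \<rho> \<eta>)" for x
  proof -
    have "bidual G X (\<lambda>\<eta>. cis (x * \<rho> \<eta>))"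
      unfolding bidual_def using \<rho> by (simp add: cis_mult distrib_left)
    from duality[OF this] show ?thesis by metis
  qed
  then obtain b where b: "\<And>x. b x \<in> carrier G" "\<And>\<eta> x. \<eta> \<in> char_group G X \<Longrightarrow> \<eta> (b x) = cis (x * \<rho> \<eta>)"
    by metis
  show ?thesis
  proof
    show "continuous_map euclideanreal X b"
    proof (rule continuous_map_charI)
      fix \<eta> assume \<eta>: "\<eta> \<in> char_group G X"
      show "continuous_map euclideanreal euclidean (\<lambda>x. \<eta> (b x))"
        unfolding b(2)[OF \<eta>] by (simp add: continuous_intros)
    qed (use b in auto)
    show "b (x + y) = b x \<otimes> b y" for x y
    proof (rule char_ext)
      fix \<eta> assume \<eta>: "\<eta> \<in> char_group G X"
      show "\<eta> (b (x + y)) = \<eta> (b x \<otimes> b y)"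
        unfolding char_group_hom[OF \<eta> b(1) b(1)] b(2)[OF \<eta>] by (simp add: cis_mult distrib_right)
    qed (use b in auto)
  qed (use b in auto)
qed

text \<open>The transpose \<open>p\<close> of the idempotent \<open>r\<close> splits the group, and
  the characters of its image \<open>S\<close> come from the range of \<open>r\<close>. By
  \<open>comm\<close> these are commensurable with \<open>\<eta>0\<close>, so a one-parameter
  subgroup of \<open>S\<close> is determined by its frequency under \<open>\<eta>0\<close>; \<rho>
  supplies the one of frequency 1. The two exponents \<open>n\<close> and \<open>n'\<close> express
  an integer power of either sign by natural powers.\<close>

lemma rank_one_retraction_splits:
  assumes conn: "connected_space X"
    and r: "\<And>\<eta>. \<eta> \<in> char_group G X \<Longrightarrow> r \<eta> \<in> char_group G X"
    and rmult: "\<And>\<eta> \<kappa>. \<eta> \<in> char_group G X \<Longrightarrow> \<kappa> \<in> char_group G X \<Longrightarrow> r (\<lambda>x. \<eta> x * \<kappa> x) = (\<lambda>x. r \<eta> x * r \<kappa> x)"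
    and ridem: "\<And>\<eta>. \<eta> \<in> char_group G X \<Longrightarrow> r (r \<eta>) = r \<eta>"
    and \<rho>: "\<And>\<eta> \<kappa>. \<eta> \<in> char_group G X \<Longrightarrow> \<kappa> \<in> char_group G X \<Longrightarrow> \<rho> (\<lambda>x. \<eta> x * \<kappa> x) = \<rho> \<eta> + (\<rho> \<kappa> :: real)"
    and \<rho>r: "\<And>\<eta>. \<eta> \<in> char_group G X \<Longrightarrow> \<rho> (r \<eta>) = \<rho> \<eta>"
    and \<eta>0: "\<eta>0 \<in> char_group G X" "\<rho> \<eta>0 = 1"
    and comm: "\<And>\<eta>. \<eta> \<in> char_group G X \<Longrightarrow> \<exists>m>0. \<exists>n n'. (\<lambda>x. r \<eta> x ^ m * \<eta>0 x ^ n') = (\<lambda>x. \<eta>0 x ^ n)"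
  shows "\<exists>S L. subgroup S G \<and> subgroup L G \<and>
       solenoid (G\<lparr>carrier := S\<rparr>) (subtopology X S) \<and>
       top_iso (G\<lparr>carrier := S\<rparr> \<times>\<times> G\<lparr>carrier := L\<rparr>)
               (prod_topology (subtopology X S) (subtopology X L)) G X (\<lambda>(s, l). s \<otimes> l)"
proof -
  have "\<exists>k'\<in>carrier G. \<forall>\<eta>\<in>char_group G X. \<eta> k' = r \<eta> k" for k
  proof -
    have "bidual G X (\<lambda>\<eta>. r \<eta> k)"
      unfolding bidual_def using r char_group_norm rmult by metis
    from duality[OF this] show ?thesis by metis
  qed
  then obtain p where p: "\<And>k. p k \<in> carrier G" "\<And>\<eta> k. \<eta> \<in> char_group G X \<Longrightarrow> \<eta> (p k) = r \<eta> k"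
    by metis
  have pc: "continuous_map X X p"
  proof (rule continuous_map_charI)
    fix \<eta> assume \<eta>: "\<eta> \<in> char_group G X"
    show "continuous_map X euclidean (\<lambda>y. \<eta> (p y))"
      unfolding p(2)[OF \<eta>] by (rule char_group_continuous[OF r[OF \<eta>]])
  qed (use p in auto)
  have pm: "p (x \<otimes> y) = p x \<otimes> p y" if "x \<in> carrier G" "y \<in> carrier G" for x y
  proof (rule char_ext)
    fix \<eta> assume \<eta>: "\<eta> \<in> char_group G X"
    show "\<eta> (p (x \<otimes> y)) = \<eta> (p x \<otimes> p y)"
      unfolding char_group_hom[OF \<eta> p(1) p(1)] p(2)[OF \<eta>] by (rule char_group_hom[OF r[OF \<eta>] that])
  qed (use p in auto)
  have pp: "p (p x) = p x" for x
  proof (rule char_ext)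
    fix \<eta> assume \<eta>: "\<eta> \<in> char_group G X"
    show "\<eta> (p (p x)) = \<eta> (p x)"
      unfolding p(2)[OF \<eta>] p(2)[OF r[OF \<eta>]] ridem[OF \<eta>] ..
  qed (use p in auto)
  define S where "S = p ` carrier G"
  define L where "L = {x \<in> carrier G. p x = \<one>}"
  note split = idempotent_splits[OF pc pm pp, folded S_def L_def]
  have SG: "S \<subseteq> carrier G" using p by (auto simp: S_def)
  interpret S: compact_ab_group "G\<lparr>carrier := S\<rparr>" "subtopology X S"
    by (rule closed_subgroup[OF split(1,3)])
  have connS: "connected_space (subtopology X S)"
    unfolding S_def by (rule connected_space_image[OF conn pc])
  obtain b where b: "continuous_map euclideanreal X b" "\<And>x y. b (x + y) = b x \<otimes> b y" "\<And>x. b x \<in> carrier G"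
    "\<And>\<eta> x. \<eta> \<in> char_group G X \<Longrightarrow> \<eta> (b x) = cis (x * \<rho> \<eta>)"
  proof -
    have "\<forall>\<eta>\<in>char_group G X. \<forall>\<kappa>\<in>char_group G X. \<rho> (\<lambda>x. \<eta> x * \<kappa> x) = \<rho> \<eta> + \<rho> \<kappa>"
      by (intro ballI \<rho>)
    from one_parameter_subgroup[OF this] show ?thesis using that by metis
  qed
  \<comment> \<open>\<open>r\<close> does not change \<rho>, so no character tells
    \<open>p (b x)\<close> from \<open>b x\<close>: the line lies in the image of
    \<open>p\<close>.\<close>
  have bS: "b x \<in> S" for x
  proof -
    have "p (b x) = b x"
    proof (rule char_ext)
      fix \<eta> assume \<eta>: "\<eta> \<in> char_group G X"
      show "\<eta> (p (b x)) = \<eta> (b x)"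
        unfolding p(2)[OF \<eta>] b(4)[OF \<eta>] b(4)[OF r[OF \<eta>]] \<rho>r[OF \<eta>] ..
    qed (use p b in auto)
    then show ?thesis unfolding S_def using b(3) by (metis imageI)
  qed
  have bc: "continuous_map euclideanreal (subtopology X S) b"
    using b bS by (auto simp: continuous_map_in_subtopology)
  have \<rho>pow: "\<rho> (\<lambda>x. \<eta> x ^ n) = of_nat n * \<rho> \<eta>" if \<eta>: "\<eta> \<in> char_group G X" for \<eta> n
  proof (induction n)
    case 0
    show ?case using \<rho>[OF char_group_one char_group_one] by simp
  next
    case (Suc n)
    then show ?case using \<rho>[OF \<eta> char_group_power[OF \<eta>, of n]] by (simp add: algebra_simps)
  qed
  have main: "\<exists>c. \<psi> = (\<lambda>x. b (c * x))"
    if \<psi>c: "continuous_map euclideanreal (subtopology X S) \<psi>" and \<psi>a: "\<And>x y. \<psi> (x + y) = \<psi> x \<otimes> \<psi> y" for \<psi>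
  proof -
    have \<psi>S: "\<psi> x \<in> S" for x using \<psi>c by (auto simp: continuous_map_def)
    then have \<psi>G: "\<psi> x \<in> carrier G" for x using SG by blast
    have \<psi>X: "continuous_map euclideanreal X \<psi>" using \<psi>c continuous_map_into_fulltopology by blast
    have ch: "\<exists>c. \<forall>x. \<eta> (\<psi> x) = cis (c * x)" if \<eta>: "\<eta> \<in> char_group G X" for \<eta>
    proof -
      have "continuous_map euclideanreal euclidean (\<eta> \<circ> \<psi>)"
        by (rule continuous_map_compose[OF \<psi>X char_group_continuous[OF \<eta>]])
      then have "continuous_on UNIV (\<lambda>x. \<eta> (\<psi> x))" by (simp add: o_def)
      from real_character_cis[OF this] show ?thesis
        using char_group_norm[OF \<eta>] \<psi>a \<psi>G by (metis char_group_hom[OF \<eta>])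
    qed
    obtain c where c: "\<And>x. \<eta>0 (\<psi> x) = cis (c * x)" using ch[OF \<eta>0(1)] by auto
    have "\<psi> x = b (c * x)" for x
    proof (rule char_ext[OF \<psi>G b(3)])
      fix \<eta> assume \<eta>: "\<eta> \<in> char_group G X"
      obtain y where y: "\<psi> x = p y" using \<psi>S[of x] by (auto simp: S_def)
      \<comment> \<open>On \<open>S\<close> a character agrees with its retraction, and only the
        retraction is commensurable with \<open>\<eta>0\<close>.\<close>
      have \<eta>r: "\<eta> (\<psi> x) = r \<eta> (\<psi> x)" 
        unfolding y p(2)[OF \<eta>] p(2)[OF r[OF \<eta>]] ridem[OF \<eta>] ..
      obtain d where d: "\<And>x. r \<eta> (\<psi> x) = cis (d * x)" using ch[OF r[OF \<eta>]] by auto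
      obtain m n n' where m: "m > 0" and eq: "(\<lambda>x. r \<eta> x ^ m * \<eta>0 x ^ n') = (\<lambda>x. \<eta>0 x ^ n)"
        using comm[OF \<eta>] by blast
      have "of_nat m * \<rho> (r \<eta>) + of_nat n' * 1 = of_nat n * (1::real)"
        using arg_cong[OF eq, of \<rho>] \<rho>[OF char_group_power[OF r[OF \<eta>]] char_group_power[OF \<eta>0(1)]]
        by (simp add: \<rho>pow r \<eta> \<eta>0)
      then have \<rho>eq: "of_nat m * \<rho> \<eta> = of_nat n - of_nat n'" using \<rho>r[OF \<eta>] by simp
      \<comment> \<open>Frequencies along \<psi> and values of \<rho> satisfy the same integer
        relation. As \<open>m > 0\<close> it can be solved for \<open>d\<close>, which yields
        \<open>d = c * \<rho> \<eta>\<close>.\<close>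
      have "of_nat m * d + of_nat n' * c = of_nat n * c"
      proof (rule cis_linear_inj)
        fix z
        have "cis ((of_nat m * d + of_nat n' * c) * z) = r \<eta> (\<psi> z) ^ m * \<eta>0 (\<psi> z) ^ n'"
          unfolding c d Complex.DeMoivre cis_mult by (simp add: algebra_simps)
        also have "\<dots> = \<eta>0 (\<psi> z) ^ n" using fun_cong[OF eq, of "\<psi> z"] .
        also have "\<dots> = cis (of_nat n * c * z)"
          unfolding c Complex.DeMoivre by (simp add: algebra_simps)
        finally show "cis ((of_nat m * d + of_nat n' * c) * z) = cis (of_nat n * c * z)" .
      qed
      then have "of_nat m * d = c * (of_nat n - of_nat n')" by (simp only: right_diff_distrib) (simp add: mult.commute)
      then have "of_nat m * d = of_nat m * (c * \<rho> \<eta>)" unfolding \<rho>eq[symmetric] by (simp only: mult_ac)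
      then have "d = c * \<rho> \<eta>" using m by simp
      then show "\<eta> (\<psi> x) = \<eta> (b (c * x))" using \<eta>r d b(4)[OF \<eta>] by (simp add: mult_ac)
    qed
    then show ?thesis by blast
  qed
  have uniq: "c = d" if "(\<lambda>x. b (c * x)) = (\<lambda>x. b (d * x))" for c d
  proof (rule cis_linear_inj)
    fix x
    have "\<eta>0 (b (c * x)) = \<eta>0 (b (d * x))" using fun_cong[OF that, of x] by simp
    then show "cis (c * x) = cis (d * x)" using b(4)[OF \<eta>0(1)] \<eta>0(2) by simp
  qed
  have fin: "finprod (G\<lparr>carrier := S\<rparr>) (\<lambda>i::nat. b (c i * x)) {..<1} = b (c 0 * x)" for c x
    using bS b(3) by (simp add: lessThan_Suc)
  have "has_dim (G\<lparr>carrier := S\<rparr>) (subtopology X S) 1"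
    unfolding has_dim_def
  proof (intro exI[of _ "\<lambda>_. b"] conjI allI impI ballI)
    show "b \<in> cHomR (G\<lparr>carrier := S\<rparr>) (subtopology X S)"
      unfolding cHomR_def using bc b(2) by simp
    fix \<psi> assume "\<psi> \<in> cHomR (G\<lparr>carrier := S\<rparr>) (subtopology X S)"
    then have "continuous_map euclideanreal (subtopology X S) \<psi>" "\<psi> (x + y) = \<psi> x \<otimes> \<psi> y" for x y
      by (simp_all add: cHomR_def)
    from main[OF this] obtain c where c: "\<psi> = (\<lambda>x. b (c * x))" by (elim exE)
    show "\<exists>!c :: nat \<Rightarrow> real. (\<forall>i\<ge>1. c i = 0) \<and> \<psi> = (\<lambda>x. finprod (G\<lparr>carrier := S\<rparr>) (\<lambda>i. b (c i * x)) {..<1})"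
      unfolding fin
    proof (rule ex1I[of _ "\<lambda>i::nat. if i = 0 then c else 0"])
      fix c' :: "nat \<Rightarrow> real" assume c': "(\<forall>i\<ge>1. c' i = 0) \<and> \<psi> = (\<lambda>x. b (c' 0 * x))"
      have "c' 0 = c" using uniq c c' by metis
      show "c' = (\<lambda>i. if i = 0 then c else 0)"
      proof
        fix i show "c' i = (if i = 0 then c else 0)"
          by (cases "i = 0") (use \<open>c' 0 = c\<close> c' in \<open>auto simp: Suc_le_eq\<close>)
      qed
    qed (use c in auto)
  qed
  then have "solenoid (G\<lparr>carrier := S\<rparr>) (subtopology X S)"
    unfolding solenoid_def using S.top_group S.compact S.Hausdorff connS by blast
  then show ?thesis using split by blast
qed

end

section \<open>Solenoid factors from circles and from maps to the dual of the rationals\<close>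

definition split_solenoid :: "('a, 'b) monoid_scheme \<Rightarrow> 'a topology \<Rightarrow> bool" where
  "split_solenoid G X \<longleftrightarrow> (\<exists>S L. subgroup S G \<and> subgroup L G \<and>
       solenoid (G\<lparr>carrier := S\<rparr>) (subtopology X S) \<and>
       top_iso (G\<lparr>carrier := S\<rparr> \<times>\<times> G\<lparr>carrier := L\<rparr>)
               (prod_topology (subtopology X S) (subtopology X L)) G X (\<lambda>(s, l). s \<otimes>\<^bsub>G\<^esub> l))"

lemma clipped_iff: "clipped G X \<longleftrightarrow> \<not> split_solenoid G X"
  unfolding clipped_def split_solenoid_def ..

lemma char_group_powi: 
  assumes \<eta>: "\<eta> \<in> char_group G X" shows "(\<lambda>x. \<eta> x powi k) \<in> char_group G X"
proof (cases "0 \<le> k")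
  case True
  then show ?thesis using char_group_power[OF \<eta>, of "nat k"] by (simp add: power_int_def)
next
  case False
  have "inverse (\<eta> x) = cnj (\<eta> x)" for x
    using char_group_cnj_mult[OF \<eta>, of x] by (metis inverse_unique)
  then show ?thesis using False char_group_power[OF char_group_cnj[OF \<eta>], of "nat (-k)"] by (simp add: power_int_def)
qed

text \<open>\<open>deg \<eta>\<close> is the winding number of \<eta> along \<phi>, an integer that
  arises as a real frequency. A character \<open>\<eta>0\<close> of least positive degree
  \<open>n\<close> generates a cyclic group onto which sending \<eta> to its power
  \<open>l \<eta> = deg \<eta> / n\<close> retracts the dual.\<close>

lemma (in compact_ab_group) circle_hom_splits:
  assumes conn: "connected_space X"
    and \<phi>: "\<phi> \<in> hom circle_group G" "continuous_map circle_top X \<phi>"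
    and z0: "z0 \<in> carrier circle_group" "\<phi> z0 \<noteq> \<one>"
  shows "split_solenoid G X"
proof -
  have \<phi>G: "\<phi> (cis x) \<in> carrier G" for x using \<phi>(1) by (auto simp: hom_def circle_group_def)
  have \<phi>m: "\<phi> (cis (x + y)) = \<phi> (cis x) \<otimes> \<phi> (cis y)" for x y
    using \<phi>(1) by (auto simp: hom_def circle_group_def cis_mult[symmetric])
  have cc: "continuous_map euclideanreal circle_top cis"
    unfolding circle_top_def by (auto simp: continuous_map_in_subtopology intro!: continuous_intros)
  have "\<exists>d. \<forall>x. \<eta> (\<phi> (cis x)) = cis (d * x)" if \<eta>: "\<eta> \<in> char_group G X" for \<eta>
  proof -
    have "continuous_map euclideanreal euclidean (\<eta> \<circ> (\<phi> \<circ> cis))"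
      by (rule continuous_map_compose[OF continuous_map_compose[OF cc \<phi>(2)] char_group_continuous[OF \<eta>]])
    then have "continuous_on UNIV (\<lambda>x. \<eta> (\<phi> (cis x)))" by (simp add: o_def)
    from real_character_cis[OF this] show ?thesis
      using char_group_norm[OF \<eta>] \<phi>m \<phi>G by (metis char_group_hom[OF \<eta>])
  qed
  then obtain deg where deg: "\<And>\<eta> x. \<eta> \<in> char_group G X \<Longrightarrow> \<eta> (\<phi> (cis x)) = cis (deg \<eta> * x)"
    by metis
  have degI: "deg \<eta> = d" if "\<eta> \<in> char_group G X" "\<And>x. \<eta> (\<phi> (cis x)) = cis (d * x)" for \<eta> d
    by (rule cis_linear_inj) (use that deg[OF that(1)] in metis)
  have degm: "deg (\<lambda>x. \<eta> x * \<kappa> x) = deg \<eta> + deg \<kappa>"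
    if "\<eta> \<in> char_group G X" "\<kappa> \<in> char_group G X" for \<eta> \<kappa>
    by (rule degI[OF char_group_mult[OF that]]) (simp add: deg[OF that(1)] deg[OF that(2)] cis_mult distrib_right)
  have degp: "deg (\<lambda>x. \<eta> x powi k) = of_int k * deg \<eta>" if "\<eta> \<in> char_group G X" for \<eta> k
    by (rule degI[OF char_group_powi[OF that]]) (simp add: deg[OF that] cis_power_int mult.assoc)
  have degint: "deg \<eta> \<in> \<int>" if \<eta>: "\<eta> \<in> char_group G X" for \<eta>
  proof -
    have "cis (deg \<eta> * (2 * pi)) = cis (deg \<eta> * 0)"
      unfolding deg[OF \<eta>, symmetric] by simp
    then have "cos (deg \<eta> * (2 * pi)) = 1" by (metis cis.sel(1) cos_zero mult_zero_right)
    then obtain k :: int where "deg \<eta> * (2 * pi) = of_int k * 2 * pi" using cos_one_2pi_int by blast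
    then have "deg \<eta> = of_int k" by simp
    then show ?thesis by simp
  qed
  \<comment> \<open>The least such \<open>n\<close> divides every degree: the remainder on division
    by \<open>n\<close> is again a degree.\<close>
  define Q where "Q n \<longleftrightarrow> 0 < n \<and> (\<exists>\<eta>\<in>char_group G X. deg \<eta> = of_nat n)" for n :: nat
  have "\<exists>n. Q n"
  proof -
    have n1: "cmod z0 = 1" using z0(1) by (simp add: circle_group_def)
    then have "z0 \<noteq> 0" by auto
    then have "cis (Arg z0) = z0" using cis_Arg[of z0] n1 by (simp add: sgn_eq)
    then obtain t where t: "z0 = cis t" by metis
    then obtain \<eta> where \<eta>: "\<eta> \<in> char_group G X" "\<eta> (\<phi> z0) \<noteq> 1"
      using characters_separate[OF _ z0(2)] \<phi>G by metis
    then have nz: "deg \<eta> \<noteq> 0" using deg[OF \<eta>(1), of t] t by auto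
    obtain k where k: "deg \<eta> = of_int k" using degint[OF \<eta>(1)] by (auto elim: Ints_cases)
    have "deg (\<lambda>x. \<eta> x powi sgn k) = of_nat (nat \<bar>k\<bar>)"
      using degp[OF \<eta>(1), of "sgn k"] k by (simp add: sgn_if)
    then have "Q (nat \<bar>k\<bar>)" unfolding Q_def using nz k char_group_powi[OF \<eta>(1)] by auto
    then show ?thesis by blast
  qed
  define n where "n = (LEAST n. Q n)"
  have "Q n" unfolding n_def using \<open>\<exists>n. Q n\<close> by (rule LeastI_ex)
  then obtain \<eta>0 where n: "0 < n" and \<eta>0: "\<eta>0 \<in> char_group G X" "deg \<eta>0 = of_nat n"
    unfolding Q_def by auto
  have "\<exists>l. deg \<eta> = of_int l * of_nat n" if \<eta>: "\<eta> \<in> char_group G X" for \<eta>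
  proof -
    obtain k where k: "deg \<eta> = of_int k" using degint[OF \<eta>] by (auto elim: Ints_cases)
    define l where "l = k div int n"
    have kl: "k = l * int n + k mod int n" by (simp add: l_def)
    have c: "(\<lambda>x. \<eta> x * \<eta>0 x powi (- l)) \<in> char_group G X"
      by (intro char_group_mult char_group_powi \<eta> \<eta>0)
    have "deg (\<lambda>x. \<eta> x * \<eta>0 x powi (- l)) = of_int k + of_int (- l) * of_nat n"
      unfolding degm[OF \<eta> char_group_powi[OF \<eta>0(1)]] degp[OF \<eta>0(1)] k \<eta>0(2) ..
    also have "\<dots> = of_int (k mod int n)"
      using arg_cong[OF kl, of "real_of_int"] by (simp only: of_int_add of_int_mult of_int_minus of_int_of_nat_eq)
    also have "\<dots> = of_nat (nat (k mod int n))" using n by simp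
    finally have "\<exists>\<eta>\<in>char_group G X. deg \<eta> = of_nat (nat (k mod int n))"
      by (rule bexI[OF _ c])
    then have "\<not> 0 < nat (k mod int n) \<or> Q (nat (k mod int n))" unfolding Q_def by simp
    moreover have "nat (k mod int n) < n" using n by (simp add: nat_less_iff)
    ultimately have "k mod int n \<le> 0" using not_less_Least[of "nat (k mod int n)" Q] unfolding n_def by auto
    then have "k = l * int n" using kl n by (smt (verit) of_nat_0_less_iff pos_mod_sign)
    then show ?thesis using k by (metis of_int_mult of_int_of_nat_eq)
  qed
  then obtain l where l: "\<And>\<eta>. \<eta> \<in> char_group G X \<Longrightarrow> deg \<eta> = of_int (l \<eta>) * of_nat n" by metis
  have lI: "l \<eta> = k" if "\<eta> \<in> char_group G X" "deg \<eta> = of_int k * of_nat n" for \<eta> k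
    using l[OF that(1)] that(2) n by simp
  have lm: "l (\<lambda>x. \<eta> x * \<kappa> x) = l \<eta> + l \<kappa>" if "\<eta> \<in> char_group G X" "\<kappa> \<in> char_group G X" for \<eta> \<kappa>
    by (rule lI[OF char_group_mult[OF that]]) (simp add: degm[OF that] l[OF that(1)] l[OF that(2)] distrib_right)
  have lp: "l (\<lambda>x. \<eta>0 x powi k) = k" for k
    by (rule lI[OF char_group_powi[OF \<eta>0(1)]]) (simp add: degp[OF \<eta>0(1)] \<eta>0(2))
  have nz: "\<eta>0 x \<noteq> 0" for x using char_group_norm[OF \<eta>0(1), of x] by auto
  show ?thesis
    unfolding split_solenoid_def
  proof (rule rank_one_retraction_splits[OF conn, of "\<lambda>\<eta> x. \<eta>0 x powi l \<eta>" "\<lambda>\<eta>. of_int (l \<eta>)" \<eta>0])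
    show "(\<lambda>x. \<eta>0 x powi l \<eta>) \<in> char_group G X" for \<eta> by (rule char_group_powi[OF \<eta>0(1)])
    show "\<eta>0 \<in> char_group G X" by (rule \<eta>0(1))
    show "real_of_int (l \<eta>0) = 1" using lI[OF \<eta>0(1), of 1] \<eta>0(2) by simp
    fix \<eta> assume \<eta>: "\<eta> \<in> char_group G X"
    show "(\<lambda>x. \<eta>0 x powi l (\<lambda>x. \<eta>0 x powi l \<eta>)) = (\<lambda>x. \<eta>0 x powi l \<eta>)" by (simp only: lp)
    show "real_of_int (l (\<lambda>x. \<eta>0 x powi l \<eta>)) = of_int (l \<eta>)" by (simp only: lp)
    \<comment> \<open>The negative part of the exponent moves to the left, since the rank one
      condition admits only natural exponents.\<close>
    have "\<eta>0 x powi l \<eta> * \<eta>0 x ^ nat (- l \<eta>) = \<eta>0 x ^ nat (l \<eta>)" for x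
      using nz[of x] by (simp add: power_int_def power_mult_distrib[symmetric])
    then have "(\<lambda>x. (\<eta>0 x powi l \<eta>) ^ 1 * \<eta>0 x ^ nat (- l \<eta>)) = (\<lambda>x. \<eta>0 x ^ nat (l \<eta>))" by simp
    then show "\<exists>m>0. \<exists>n n'. (\<lambda>x. (\<eta>0 x powi l \<eta>) ^ m * \<eta>0 x ^ n') = (\<lambda>x. \<eta>0 x ^ n)"
      by (intro exI[of _ "1::nat"] conjI exI) simp_all
  next
    fix \<eta> \<kappa> assume *: "\<eta> \<in> char_group G X" "\<kappa> \<in> char_group G X"
    show "(\<lambda>x. \<eta>0 x powi l (\<lambda>x. \<eta> x * \<kappa> x)) = (\<lambda>x. \<eta>0 x powi l \<eta> * \<eta>0 x powi l \<kappa>)"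
      unfolding lm[OF *] using nz by (simp add: power_int_add)
    show "real_of_int (l (\<lambda>x. \<eta> x * \<kappa> x)) = of_int (l \<eta>) + of_int (l \<kappa>)"
      unfolding lm[OF *] by simp
  qed
qed

text \<open>The rationals are injective: the partial extensions of \<open>f\<close> are ordered by inclusion of their graphs.\<close>

lemma rat_hom_extension:
  fixes f :: "'a \<Rightarrow> rat" and D :: "('a, 'b) monoid_scheme" (structure)
  assumes "comm_group D" and A: "subgroup A D"
    and f_add: "\<forall>a\<in>A. \<forall>b\<in>A. f (a \<otimes> b) = f a + f b"
  obtains g where "\<forall>a\<in>carrier D. \<forall>b\<in>carrier D. g (a \<otimes> b) = (g a + g b :: rat)" "\<forall>a\<in>A. g a = f a"
proof -
  interpret comm_group D by fact
  have f: "f (a \<otimes> b) = f a + f b" if "a \<in> A" "b \<in> A" for a b using f_add that by blast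
  \<comment> \<open>The last clause makes such a subgroup single-valued: two values at one point
    differ by a value at \<one>.\<close>
  define P where "P = {R :: ('a \<times> rat) set. (\<forall>x a. (x, a) \<in> R \<longrightarrow> x \<in> carrier D) \<and> (\<forall>a\<in>A. (a, f a) \<in> R) \<and>
     (\<forall>x a y b. (x, a) \<in> R \<longrightarrow> (y, b) \<in> R \<longrightarrow> (x \<otimes> y, a + b) \<in> R) \<and>
     (\<forall>x a. (x, a) \<in> R \<longrightarrow> (inv x, - a) \<in> R) \<and> (\<forall>a. (\<one>, a) \<in> R \<longrightarrow> a = 0)}"
  have PG: "x \<in> carrier D" if "R \<in> P" "(x, a) \<in> R" for R x a using that unfolding P_def by blast
  have Pf: "(a, f a) \<in> R" if "R \<in> P" "a \<in> A" for R a using that by (simp add: P_def)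
  have Pm: "(x \<otimes> y, a + b) \<in> R" if "R \<in> P" "(x, a) \<in> R" "(y, b) \<in> R" for R x y a b
    using that by (simp add: P_def)
  have Pi: "(inv x, - a) \<in> R" if "R \<in> P" "(x, a) \<in> R" for R x a using that by (simp add: P_def)
  have P1: "a = 0" if "R \<in> P" "(\<one>, a) \<in> R" for R a using that by (simp add: P_def)
  have AG: "A \<subseteq> carrier D" by (rule subgroup.subset[OF A])
  have f1: "f \<one> = 0" using f[OF subgroup.one_closed[OF A] subgroup.one_closed[OF A]] by simp
  have finv: "f (inv a) = - f a" if a: "a \<in> A" for a
  proof -
    have "f (a \<otimes> inv a) = f a + f (inv a)" by (rule f[OF a subgroup.m_inv_closed[OF A a]])
    then show ?thesis using a AG f1 by (simp add: subset_iff eq_neg_iff_add_eq_0 add.commute)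
  qed
  have "(\<lambda>a. (a, f a)) ` A \<in> P"
    unfolding P_def using AG f f1 finv subgroup.m_closed[OF A] subgroup.m_inv_closed[OF A] by auto
  then have Pne: "P \<noteq> {}" by auto
  have "\<exists>M\<in>P. \<forall>R\<in>P. M \<subseteq> R \<longrightarrow> R = M"
  proof (rule subset_Zorn_nonempty[OF Pne])
    fix \<C> assume ne: "\<C> \<noteq> {}" and ch: "subset.chain P \<C>"
    have CP: "R \<in> P" if "R \<in> \<C>" for R using ch that unfolding subset.chain_def by auto
    have tot: "R \<subseteq> R' \<or> R' \<subseteq> R" if "R \<in> \<C>" "R' \<in> \<C>" for R R'
      using ch that unfolding subset.chain_def by auto
    show "\<Union>\<C> \<in> P"
      unfolding P_def
    proof (intro CollectI conjI allI impI ballI)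
      show "x \<in> carrier D" if "(x, a) \<in> \<Union>\<C>" for x a using that PG CP by (meson UnionE)
      obtain R where "R \<in> \<C>" using ne by auto
      then show "(a, f a) \<in> \<Union>\<C>" if "a \<in> A" for a using Pf[OF CP that] by (meson UnionI)
      show "(inv x, - a) \<in> \<Union>\<C>" if "(x, a) \<in> \<Union>\<C>" for x a using that Pi CP by (meson UnionE UnionI)
      show "a = 0" if "(\<one>, a) \<in> \<Union>\<C>" for a using that P1 CP by (meson UnionE)
      fix x a y b assume "(x, a) \<in> \<Union>\<C>" "(y, b) \<in> \<Union>\<C>"
      then obtain R R' where R: "R \<in> \<C>" "(x, a) \<in> R" "R' \<in> \<C>" "(y, b) \<in> R'" by auto
      obtain R'' where "R'' \<in> \<C>" "(x, a) \<in> R''" "(y, b) \<in> R''" using tot[OF R(1,3)] R by auto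
      then show "(x \<otimes> y, a + b) \<in> \<Union>\<C>" using Pm[OF CP] by (meson UnionI)
    qed
  qed
  then obtain M where MP: "M \<in> P" and max: "\<And>R. R \<in> P \<Longrightarrow> M \<subseteq> R \<Longrightarrow> R = M" by metis
  note MG = PG[OF MP] and Mf = Pf[OF MP] and Mm = Pm[OF MP] and Mi = Pi[OF MP] and M1 = P1[OF MP]
  have M0: "(\<one>, 0) \<in> M" using Mf[OF subgroup.one_closed[OF A]] f1 by simp
  have uniq: "a = b" if "(x, a) \<in> M" "(x, b) \<in> M" for x a b
    using M1[of "a + - b"] Mm[OF that(1) Mi[OF that(2)]] MG[OF that(1)] by simp
  have Mn: "(x [^] (n::nat), of_nat n * a) \<in> M" if "(x, a) \<in> M" for x a n
  proof (induction n)
    case (Suc n)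
    then show ?case using Mm[OF Suc that] by (simp add: algebra_simps)
  qed (simp add: M0)
  have Mk: "(x [^] (k::int), of_int k * a) \<in> M" if "(x, a) \<in> M" for x a k
  proof (cases "k < 0")
    case True
    have 1: "of_int k * a = - (of_nat (nat (- k)) * a)" using True by simp
    have 2: "x [^] k = inv (x [^] nat (- k))" using True by (simp only: int_pow_def2 if_True)
    show ?thesis unfolding 1 2 by (rule Mi[OF Mn[OF that]])
  next
    case False
    have 1: "of_int k * a = of_nat (nat k) * a" using False by simp
    have 2: "x [^] k = x [^] nat k" using False by (simp only: int_pow_def2 if_False)
    show ?thesis unfolding 1 2 by (rule Mn[OF that])
  qed
  have total: "\<exists>a. (x, a) \<in> M" if x: "x \<in> carrier D" for x
  proof -
    \<comment> \<open>The value to give to \<open>x\<close>. If a nonzero power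
      \<open>x [^] n\<close> already has the value \<open>a\<close>, it is forced to be
      \<open>a / n\<close>, and here divisibility of the rationals is used; otherwise it is free and
      taken to be 0.\<close>
    obtain v where v: "\<And>k b. (x [^] (k::int), b) \<in> M \<Longrightarrow> b = of_int k * v"
    proof (cases "\<exists>k::int. k \<noteq> 0 \<and> (\<exists>a. (x [^] k, a) \<in> M)")
      case True
      then obtain n :: int and a where n: "n \<noteq> 0" "(x [^] n, a) \<in> M" by auto
      show ?thesis
      proof (rule that[of "a / of_int n"])
        fix k :: int and b assume b: "(x [^] k, b) \<in> M"
        have "(x [^] (n * k), of_int n * b) \<in> M" "(x [^] (n * k), of_int k * a) \<in> M"
          using Mk[OF b, of n] Mk[OF n(2), of k] x by (simp_all add: int_pow_pow mult.commute)
        then have "of_int n * b = of_int k * a" by (rule uniq)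
        then show "b = of_int k * (a / of_int n)" using n by (simp add: field_simps)
      qed
    next
      case False
      show ?thesis
      proof (rule that[of 0])
        fix k :: int and b assume b: "(x [^] k, b) \<in> M"
        then have "k = 0" using False by auto
        then show "b = of_int k * 0" using M1 b by simp
      qed
    qed
    \<comment> \<open>The extension of \<open>M\<close> to the subgroup generated by its domain and
      \<open>x\<close>; maximality forces \<open>R = M\<close>, so \<open>x\<close> was in the
      domain.\<close>
    define R where "R = {(y \<otimes> x [^] (k::int), b + of_int k * v) | y b k. (y, b) \<in> M}"
    have RI: "(y \<otimes> x [^] (k::int), b + of_int k * v) \<in> R" if "(y, b) \<in> M" for y b k
      using that unfolding R_def by blast
    have MR: "M \<subseteq> R" using RI[of _ _ 0] MG by fastforce
    have "R \<in> P"
      unfolding P_def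
    proof (intro CollectI conjI allI impI ballI)
      show "y \<in> carrier D" if "(y, a) \<in> R" for y a using that MG x unfolding R_def by auto
      show "(a, f a) \<in> R" if "a \<in> A" for a using Mf[OF that] MR by auto
    next
      fix y a assume "(y, a) \<in> R"
      then obtain y' a' k where y: "(y', a') \<in> M" "y = y' \<otimes> x [^] (k::int)" "a = a' + of_int k * v"
        unfolding R_def by auto

      have "inv y = inv y' \<otimes> x [^] (- k)" using y MG[OF y(1)] x by (simp add: int_pow_neg inv_mult)
      then show "(inv y, - a) \<in> R" using RI[OF Mi[OF y(1)], of "- k"] y(3) by simp
    next
      fix y a z c assume "(y, a) \<in> R" "(z, c) \<in> R"
      then obtain y' a' k where y: "(y', a') \<in> M" "y = y' \<otimes> x [^] (k::int)" "a = a' + of_int k * v"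
        unfolding R_def by auto
      have "(z, c) \<in> R" by fact
      then obtain z' c' j where z: "(z', c') \<in> M" "z = z' \<otimes> x [^] (j::int)" "c = c' + of_int j * v"
        unfolding R_def by auto
      have "y \<otimes> z = (y' \<otimes> z') \<otimes> x [^] (k + j)"
        using y z MG[OF y(1)] MG[OF z(1)] x by (simp add: int_pow_mult m_ac)
      then show "(y \<otimes> z, a + c) \<in> R"
        using RI[OF Mm[OF y(1) z(1)], of "k + j"] y(3) z(3) by (simp add: algebra_simps)
    next
      fix a assume "(\<one>, a) \<in> R"
      then obtain y b k where y: "(y, b) \<in> M" "\<one> = y \<otimes> x [^] (k::int)" "a = b + of_int k * v"
        unfolding R_def by auto
      have "inv y = x [^] k" using y(2) MG[OF y(1)] x by (metis int_pow_closed inv_equality inv_inv inv_closed m_comm)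
      then have "(x [^] k, - b) \<in> M" using Mi[OF y(1)] by simp
      then have "- b = of_int k * v" by (rule v)
      then show "a = 0" using y(3) by simp
    qed
    then have "R = M" using max MR by blast
    moreover have "(\<one> \<otimes> x [^] (1::int), 0 + of_int 1 * v) \<in> R" by (rule RI[OF M0])
    ultimately show ?thesis using x by auto
  qed
  define g where "g x = (THE a. (x, a) \<in> M)" for x
  have g: "g x = a" if "(x, a) \<in> M" for x a
    unfolding g_def using that uniq by blast
  have gM: "(x, g x) \<in> M" if "x \<in> carrier D" for x
    using total[OF that] g by auto
  show ?thesis
  proof
    show "\<forall>a\<in>carrier D. \<forall>b\<in>carrier D. g (a \<otimes> b) = g a + g b"
      by (intro ballI g Mm gM)
    show "\<forall>a\<in>A. g a = f a" by (intro ballI g Mf)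
  qed
qed

definition char_monoid :: "('a, 'b) monoid_scheme \<Rightarrow> 'a topology \<Rightarrow> ('a \<Rightarrow> complex) monoid" where
  "char_monoid G X = \<lparr>carrier = char_group G X, mult = (\<lambda>\<eta> \<kappa> x. \<eta> x * \<kappa> x), one = (\<lambda>x. 1)\<rparr>"

lemma comm_group_char_monoid: "comm_group (char_monoid G X)"
proof (rule comm_groupI)
  fix \<eta> assume "\<eta> \<in> carrier (char_monoid G X)"
  then have \<eta>: "\<eta> \<in> char_group G X" by (simp add: char_monoid_def)
  then have "(\<lambda>x. cnj (\<eta> x) * \<eta> x) = (\<lambda>x. 1)" using char_group_cnj_mult[OF \<eta>] by (simp add: mult.commute)
  then show "\<exists>\<kappa>\<in>carrier (char_monoid G X). \<kappa> \<otimes>\<^bsub>char_monoid G X\<^esub> \<eta> = \<one>\<^bsub>char_monoid G X\<^esub>"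
    using char_group_cnj[OF \<eta>] by (auto simp: char_monoid_def intro!: bexI[of _ "\<lambda>x. cnj (\<eta> x)"])
qed (auto simp: char_monoid_def char_group_one char_group_mult mult_ac)

text \<open>The image is connected and consists of roots of unity of bounded order, so it is a
  single point.\<close>

lemma (in compact_ab_group) char_torsion_free:
  assumes conn: "connected_space X" and \<eta>: "\<eta> \<in> char_group G X"
    and n: "n > 0" "\<And>x. x \<in> carrier G \<Longrightarrow> \<eta> x ^ n = 1"
  shows "\<eta> = (\<lambda>x. 1)"
proof -
  have "connected_space (subtopology euclidean (\<eta> ` carrier G))"
    by (rule connected_space_image[OF conn char_group_continuous[OF \<eta>]])
  then have "connected (\<eta> ` carrier G)" by (simp flip: connectedin_iff_connected add: connectedin_def)
  moreover have "finite (\<eta> ` carrier G)"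
    by (rule finite_subset[OF _ finite_roots_unity[of n]]) (use n in auto)
  ultimately obtain z where z: "\<eta> ` carrier G = {z}"
    using connected_finite_iff_sing[of "\<eta> ` carrier G"] one_closed by auto
  have "\<eta> x = 1" if "x \<in> carrier G" for x
    using z that one_closed char_one[OF \<eta>] by (metis imageI singletonD)
  then show ?thesis by (intro char_group_eqI[OF \<eta> char_group_one]) auto
qed

text \<open>The transpose of \<phi> is a homomorphism \<open>c\<close> from the rationals to the
  dual. It is injective, its inverse extends to a map \<open>g\<close> on the whole dual, and
  \<open>c\<close> after \<open>g\<close> is the required retraction; \<rho> is \<open>g\<close>
  read as a real number and \<open>\<eta>0\<close> is \<open>c 1\<close>.\<close>

lemma (in compact_ab_group) Qdual_hom_splits:
  assumes conn: "connected_space X"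
    and \<phi>: "\<phi> \<in> hom G Qdual_group" "continuous_map X Qdual_top \<phi>"
    and k0: "k0 \<in> carrier G" "\<phi> k0 \<noteq> \<one>\<^bsub>Qdual_group\<^esub>"
  shows "split_solenoid G X"
proof -
  define c where "c = (\<lambda>q k. if k \<in> carrier G then \<phi> k q else 1)"
  have \<phi>Q: "\<phi> k \<in> carrier Qdual_group" if "k \<in> carrier G" for k using \<phi>(1) that by (auto simp: hom_def)
  have cadd: "c (p + q) = (\<lambda>k. c p k * c q k)" for p q
    unfolding c_def using \<phi>Q by (auto simp: Qdual_group_def)
  have cC: "c q \<in> char_group G X" for q
  proof -
    have "continuous_map X (product_topology (\<lambda>_. euclidean) UNIV) \<phi>"
      using \<phi>(2) unfolding Qdual_top_def by (rule continuous_map_into_fulltopology)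
    then have "continuous_map X euclidean (\<lambda>k. \<phi> k q)"
      by (simp add: continuous_map_componentwise_UNIV)
    then have "continuous_map X euclidean (c q)"
      by (rule continuous_map_eq) (simp add: c_def)
    moreover have "\<phi> (x \<otimes> y) q = \<phi> x q * \<phi> y q" if "x \<in> carrier G" "y \<in> carrier G" for x y
      using \<phi>(1) that by (simp add: hom_def Qdual_group_def)
    moreover have "cmod (\<phi> x q) = 1" if "x \<in> carrier G" for x
      using \<phi>Q[OF that] by (simp add: Qdual_group_def)
    ultimately show ?thesis unfolding char_group_def by (auto simp: c_def)
  qed
  have cnz: "c q x \<noteq> 0" for q x using char_group_norm[OF cC, of q x] by auto
  have c0: "c 0 = (\<lambda>x. 1)"
  proof
    fix x show "c 0 x = 1" using fun_cong[OF cadd[of 0 0], of x] cnz[of 0 x] by simp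
  qed
  have cpow: "c (of_nat n * q) = (\<lambda>x. c q x ^ n)" for n q
    by (induction n) (simp_all add: c0 cadd distrib_right)
  \<comment> \<open>If a nonzero rational is killed, then every \<open>c q'\<close> has a trivial
    positive power, as any two rationals are commensurable. Torsion-freeness then kills all of
    \<open>c\<close>, against the choice of \<open>k0\<close>.\<close>
  have cker: "q = 0" if q: "c q = (\<lambda>x. 1)" for q
  proof (rule ccontr)
    assume q0: "q \<noteq> 0"
    have "c q' = (\<lambda>x. 1)" for q'
    proof -
      obtain a b where ab: "b > 0" "q' / q = of_int a / of_int b"
        using quotient_of_div[of "q' / q"] quotient_of_denom_pos[of "q' / q"] by (metis surj_pair)
      define m where "m = nat \<bar>a\<bar>"
      have eq: "of_int b * q' = of_int a * q" using ab q0 by (simp add: field_simps)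
      have m1: "c (of_nat m * q) = (\<lambda>x. 1)" unfolding cpow q by simp
      have "c (of_int a * q) = (\<lambda>x. 1)"
      proof (cases "0 \<le> a")
        case True
        then show ?thesis using m1 by (simp add: m_def)
      next
        case False
        then have "of_nat m * q + of_int a * q = 0" by (simp add: m_def)
        then have "(\<lambda>x. c (of_nat m * q) x * c (of_int a * q) x) = (\<lambda>x. 1)" using cadd c0 by metis
        then show ?thesis unfolding m1 by simp
      qed
      then have "(\<lambda>x. c q' x ^ nat b) = (\<lambda>x. 1)" using eq ab(1) cpow[of "nat b" q'] by simp
      then show ?thesis
        using ab(1) by (intro char_torsion_free[OF conn cC, of "nat b"]) (auto dest: fun_cong)
    qed
    then have "c q' k0 = 1" for q' by simp
    then have "\<phi> k0 q' = 1" for q' using k0(1) by (simp add: c_def)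
    then show False using k0(2) by (auto simp: Qdual_group_def)
  qed
  have cinj: "p = q" if "c p = c q" for p q
  proof -
    have "(\<lambda>x. c (p - q) x * c q x) = c q" using cadd[of "p - q" q] that by simp
    then have "c (p - q) = (\<lambda>x. 1)" using cnz by (metis (no_types, lifting) mult_cancel_right1 ext)
    then show ?thesis using cker by force
  qed
  define f where "f \<eta> = (THE q. c q = \<eta>)" for \<eta>
  have f: "f (c q) = q" for q unfolding f_def using cinj by blast
  interpret D: comm_group "char_monoid G X" by (rule comm_group_char_monoid)
  have A: "subgroup (range c) (char_monoid G X)"
  proof (rule D.subgroupI)
    show "range c \<subseteq> carrier (char_monoid G X)" using cC by (auto simp: char_monoid_def)
    show "a \<otimes>\<^bsub>char_monoid G X\<^esub> b \<in> range c" if "a \<in> range c" "b \<in> range c" for a b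
      using that cadd by (auto simp: char_monoid_def) (metis rangeI)
    show "inv\<^bsub>char_monoid G X\<^esub> a \<in> range c" if a: "a \<in> range c" for a
    proof -
      obtain q where q: "a = c q" using a by auto
      have "(\<lambda>x. c (- q) x * c q x) = (\<lambda>x. 1)" using cadd[of "-q" q] c0 by simp
      then have "inv\<^bsub>char_monoid G X\<^esub> a = c (- q)"
        unfolding q by (intro D.inv_equality) (auto simp: char_monoid_def cC)
      then show ?thesis by simp
    qed
  qed simp
  have "\<forall>a\<in>range c. \<forall>b\<in>range c. f (a \<otimes>\<^bsub>char_monoid G X\<^esub> b) = f a + f b"
    using f by (auto simp: char_monoid_def cadd[symmetric])
  from rat_hom_extension[OF comm_group_char_monoid A this]
  obtain g where g: "\<forall>a\<in>carrier (char_monoid G X). \<forall>b\<in>carrier (char_monoid G X).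
      g (a \<otimes>\<^bsub>char_monoid G X\<^esub> b) = (g a + g b :: rat)" "\<forall>a\<in>range c. g a = f a"
    by metis
  have gm: "g (\<lambda>x. a x * b x) = g a + g b" if "a \<in> char_group G X" "b \<in> char_group G X" for a b
    using g(1) that by (simp add: char_monoid_def)
  have gc: "g (c q) = q" for q
    using g(2) f by simp
  show ?thesis
    unfolding split_solenoid_def
  proof (rule rank_one_retraction_splits[OF conn, of "\<lambda>\<eta>. c (g \<eta>)" "\<lambda>\<eta>. of_rat (g \<eta>)" "c 1"])
    show "c (g \<eta>) \<in> char_group G X" for \<eta> by (rule cC)
    show "c 1 \<in> char_group G X" by (rule cC)
    show "real_of_rat (g (c 1)) = 1" by (simp add: gc)
    fix \<eta> assume \<eta>: "\<eta> \<in> char_group G X"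
    show "c (g (c (g \<eta>))) = c (g \<eta>)" by (simp only: gc)
    show "real_of_rat (g (c (g \<eta>))) = of_rat (g \<eta>)" by (simp only: gc)
    obtain a b where ab: "b > 0" "g \<eta> = of_int a / of_int b"
      using quotient_of_div[of "g \<eta>"] quotient_of_denom_pos[of "g \<eta>"] by (metis surj_pair)
    \<comment> \<open>Numerator and denominator of \<open>g \<eta>\<close> give the relation with
      \<open>c 1\<close>; the numerator is split into positive and negative part to keep the
      exponents natural.\<close>
    have eq: "of_nat (nat b) * g \<eta> + of_nat (nat (- a)) * 1 = (of_nat (nat a) * 1 :: rat)"
      using ab by (cases "0 \<le> a") auto
    have "(\<lambda>x. c (g \<eta>) x ^ nat b * c 1 x ^ nat (- a)) = (\<lambda>x. c 1 x ^ nat a)"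
      using arg_cong[OF eq, of c] by (simp only: cadd cpow)
    then show "\<exists>m>0. \<exists>n n'. (\<lambda>x. c (g \<eta>) x ^ m * c 1 x ^ n') = (\<lambda>x. c 1 x ^ n)"
      using ab(1) by (intro exI[of _ "nat b"] conjI exI) simp_all
  next
    fix \<eta> \<kappa> assume *: "\<eta> \<in> char_group G X" "\<kappa> \<in> char_group G X"
    show "c (g (\<lambda>x. \<eta> x * \<kappa> x)) = (\<lambda>x. c (g \<eta>) x * c (g \<kappa>) x)"
      unfolding gm[OF *] cadd ..
    show "real_of_rat (g (\<lambda>x. \<eta> x * \<kappa> x)) = of_rat (g \<eta>) + of_rat (g \<kappa>)"
      unfolding gm[OF *] by (simp add: of_rat_add)
  qed
qed

section \<open>The decomposition\<close>

text \<open>Gaussian elimination: a pivot \<open>p\<close> clears coordinate \<open>n\<close> of the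
  other vectors, which leaves one vector and one coordinate fewer.\<close>

lemma exists_linear_relation:
  fixes v :: "'j \<Rightarrow> nat \<Rightarrow> real"
  assumes "finite J" "n < card J"
  obtains c where "\<exists>j\<in>J. c j \<noteq> 0" "\<And>i. i < n \<Longrightarrow> (\<Sum>j\<in>J. c j * v j i) = 0"
proof -
  have "\<exists>c. (\<exists>j\<in>J. c j \<noteq> 0) \<and> (\<forall>i<n. (\<Sum>j\<in>J. c j * v j i) = 0)"
    using assms
  proof (induction n arbitrary: J v)
    case 0
    then have "J \<noteq> {}" by auto
    then show ?case by (intro exI[of _ "\<lambda>_. 1"]) auto
  next
    case (Suc n)
    show ?case
    proof (cases "\<forall>j\<in>J. v j n = 0")
      case True
      obtain c where "\<exists>j\<in>J. c j \<noteq> 0" "\<forall>i<n. (\<Sum>j\<in>J. c j * v j i) = 0"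
        using Suc.IH[of J v] Suc.prems by auto
      then show ?thesis using True by (intro exI[of _ c]) (auto simp: less_Suc_eq)
    next
      case False
      then obtain p where p: "p \<in> J" "v p n \<noteq> 0" by auto
      define w where "w = (\<lambda>j i. v j i - v j n / v p n * v p i)"
      obtain c where c: "\<exists>j\<in>J - {p}. c j \<noteq> 0" "\<forall>i<n. (\<Sum>j\<in>J - {p}. c j * w j i) = 0"
      proof -
        have "n < card (J - {p})" using Suc.prems p(1) by simp
        moreover have "finite (J - {p})" using Suc.prems by simp
        ultimately show ?thesis using Suc.IH[of "J - {p}" w] that by blast
      qed
      \<comment> \<open>The coefficient at the pivot undoes the elimination, so \<open>d\<close> on
        the original vectors gives the same sums as \<open>c\<close> on the reduced ones.\<close>
      define d where "d = c(p := - (\<Sum>j\<in>J - {p}. c j * (v j n / v p n)))"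
      have "(\<Sum>j\<in>J. d j * v j i) = (\<Sum>j\<in>J - {p}. c j * w j i)" for i
      proof -
        have "(\<Sum>j\<in>J. d j * v j i) = d p * v p i + (\<Sum>j\<in>J - {p}. d j * v j i)"
          by (rule sum.remove[OF Suc.prems(1) p(1)])
        also have "(\<Sum>j\<in>J - {p}. d j * v j i) = (\<Sum>j\<in>J - {p}. c j * v j i)"
          by (rule sum.cong) (auto simp: d_def)
        finally show ?thesis
          by (simp add: d_def w_def algebra_simps sum_subtractf sum_distrib_left sum_distrib_right)
      qed
      moreover have "(\<Sum>j\<in>J - {p}. c j * w j n) = 0" using p(2) by (simp add: w_def)
      moreover have "\<exists>j\<in>J. d j \<noteq> 0" using c(1) by (auto simp: d_def)
      ultimately show ?thesis using c(2) by (intro exI[of _ d]) (auto simp: less_Suc_eq)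
    qed
  qed
  then show ?thesis using that by blast
qed

text \<open>Linear independence in the real vector space cHom(R, G), where a scalar acts by
  rescaling the argument.\<close>

definition independent_family :: "('a, 'b) monoid_scheme \<Rightarrow> 'a topology \<Rightarrow> nat \<Rightarrow> (nat \<Rightarrow> real \<Rightarrow> 'a) \<Rightarrow> bool" where
  "independent_family G X m b \<longleftrightarrow> (\<forall>i<m. b i \<in> cHomR G X) \<and>
     (\<forall>c. (\<forall>x. finprod G (\<lambda>i. b i (c i * x)) {..<m} = \<one>\<^bsub>G\<^esub>) \<longrightarrow> (\<forall>i<m. c i = 0))"

section \<open>One-parameter subgroups and direct factors\<close>

context compact_ab_group
begin

lemma cHomR_closed: "\<psi> \<in> cHomR G X \<Longrightarrow> \<psi> x \<in> carrier G"
  unfolding cHomR_def continuous_map_def by auto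

lemma cHomR_add: "\<psi> \<in> cHomR G X \<Longrightarrow> \<psi> (x + y) = \<psi> x \<otimes> \<psi> y"
  unfolding cHomR_def by auto

lemma cHomR_0: "\<psi> \<in> cHomR G X \<Longrightarrow> \<psi> 0 = \<one>"
  using cHomR_add[of \<psi> 0 0] cHomR_closed[of \<psi> 0] by (simp add: l_cancel_one)

text \<open>In the coordinates of a basis of size \<open>n\<close>, more than \<open>n\<close>
  members satisfy a nontrivial linear relation, and the relation carries over to the one-parameter
  subgroups.\<close>

lemma independent_family_bound:
  assumes dim: "has_dim G X n" and b: "independent_family G X m b"
  shows "m \<le> n"
proof (rule ccontr)
  assume "\<not> m \<le> n"
  then have nm: "n < card {..<m}" by simp
  obtain e :: "nat \<Rightarrow> real \<Rightarrow> 'a" where e: "\<And>i. i < n \<Longrightarrow> e i \<in> cHomR G X"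
    and rep: "\<And>\<psi>. \<psi> \<in> cHomR G X \<Longrightarrow> \<exists>c::nat \<Rightarrow> real. \<psi> = (\<lambda>x. finprod G (\<lambda>i. e i (c i * x)) {..<n})"
    using dim unfolding has_dim_def by (auto dest!: ex1_implies_ex) metis
  have bH: "b j \<in> cHomR G X" if "j < m" for j using b that unfolding independent_family_def by blast
  have "\<forall>j. \<exists>v::nat \<Rightarrow> real. j < m \<longrightarrow> b j = (\<lambda>x. finprod G (\<lambda>i. e i (v i * x)) {..<n})"
    using rep[OF bH] by blast
  then obtain v :: "nat \<Rightarrow> nat \<Rightarrow> real"
    where v: "\<And>j. j < m \<Longrightarrow> b j = (\<lambda>x. finprod G (\<lambda>i. e i (v j i * x)) {..<n})" by metis
  obtain c where c: "\<exists>j\<in>{..<m}. c j \<noteq> 0" "\<And>i. i < n \<Longrightarrow> (\<Sum>j\<in>{..<m}. c j * v j i) = 0"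
    using exists_linear_relation[OF _ nm, of v] by auto
  have eG: "e i y \<in> carrier G" if "i < n" for i y by (rule cHomR_closed[OF e[OF that]])
  \<comment> \<open>A combination of the \<open>b j\<close> has the coordinates prescribed by the
    matrix \<open>v\<close>. For \<open>k = m\<close> these all vanish by the choice of
    \<open>c\<close>.\<close>
  have "finprod G (\<lambda>j. b j (c j * x)) {..<k} = finprod G (\<lambda>i. e i ((\<Sum>j<k. c j * v j i) * x)) {..<n}"
    if "k \<le> m" for k x
    using that
  proof (induction k)
    case 0
    have "finprod G (\<lambda>i. e i 0) {..<n} = \<one>"
      by (rule finprod_one_eqI) (use e cHomR_0 in auto)
    then show ?case by simp
  next
    case (Suc k)
    have bG: "b j y \<in> carrier G" if "j < Suc k" for j y using bH[of j] cHomR_closed that Suc.prems by auto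
    have "finprod G (\<lambda>j. b j (c j * x)) {..<Suc k} = b k (c k * x) \<otimes> finprod G (\<lambda>j. b j (c j * x)) {..<k}"
      unfolding lessThan_Suc by (rule finprod_insert) (use bG in auto)
    also have "\<dots> = finprod G (\<lambda>i. e i (v k i * (c k * x))) {..<n} \<otimes>
        finprod G (\<lambda>i. e i ((\<Sum>j<k. c j * v j i) * x)) {..<n}"
      using Suc v[of k] by simp
    also have "\<dots> = finprod G (\<lambda>i. e i (v k i * (c k * x)) \<otimes> e i ((\<Sum>j<k. c j * v j i) * x)) {..<n}"
      by (rule finprod_multf[symmetric]) (use eG in auto)
    also have "\<dots> = finprod G (\<lambda>i. e i ((\<Sum>j<Suc k. c j * v j i) * x)) {..<n}"
      by (rule finprod_cong') (use eG e in \<open>auto simp: cHomR_add[symmetric] algebra_simps\<close>)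
    finally show ?case .
  qed
  from this[of m] have "finprod G (\<lambda>j. b j (c j * x)) {..<m} = finprod G (\<lambda>i. e i ((\<Sum>j<m. c j * v j i) * x)) {..<n}" for x
    by simp
  also have "\<dots>x = \<one>" for x
    by (rule finprod_one_eqI) (use c(2) e cHomR_0 in auto)
  finally have "\<forall>x. finprod G (\<lambda>j. b j (c j * x)) {..<m} = \<one>" by blast
  then show False using b c(1) unfolding independent_family_def by blast
qed

text \<open>A converse to \<open>internal_direct_product\<close>. The factors are closed as images
  of slices under a closed map, and connected as images of the group under the projections obtained
  from the inverse map.\<close>

lemma top_iso_internalD:
  assumes A: "subgroup A G" and B: "subgroup B G"
    and iso: "top_iso (G\<lparr>carrier := A\<rparr> \<times>\<times> G\<lparr>carrier := B\<rparr>)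
               (prod_topology (subtopology X A) (subtopology X B)) G X (\<lambda>(a, b). a \<otimes> b)"
  shows "A \<inter> B \<subseteq> {\<one>}" "\<And>x. x \<in> carrier G \<Longrightarrow> \<exists>a\<in>A. \<exists>b\<in>B. x = a \<otimes> b"
    "closedin X A" "closedin X B"
    "connected_space X \<Longrightarrow> connected_space (subtopology X A)"
    "connected_space X \<Longrightarrow> connected_space (subtopology X B)"
proof -
  have AG: "A \<subseteq> carrier G" and BG: "B \<subseteq> carrier G" using A B subgroup.subset by blast+
  have oA: "\<one> \<in> A" and oB: "\<one> \<in> B" using A B subgroup.one_closed by auto
  have bij: "bij_betw (\<lambda>(a, b). a \<otimes> b) (A \<times> B) (carrier G)"
    and hm: "homeomorphic_map (prod_topology (subtopology X A) (subtopology X B)) X (\<lambda>(a, b). a \<otimes> b)"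
    using iso by (auto simp: top_iso_def iso_def)
  show int: "A \<inter> B \<subseteq> {\<one>}"
  proof
    fix x assume x: "x \<in> A \<inter> B"
    then have xG: "x \<in> carrier G" using AG by auto
    have "(\<lambda>(a, b). a \<otimes> b) (x, \<one>) = (\<lambda>(a, b). a \<otimes> b) (\<one>, x)" using xG by simp
    then have "(x, \<one>) = (\<one>, x)"
      using bij_betw_imp_inj_on[OF bij] x oA oB by (elim inj_onD) auto
    then show "x \<in> {\<one>}" by blast
  qed
  show prod: "\<exists>a\<in>A. \<exists>b\<in>B. x = a \<otimes> b" if "x \<in> carrier G" for x
  proof -
    have "x \<in> (\<lambda>(a, b). a \<otimes> b) ` (A \<times> B)" using bij_betw_imp_surj_on[OF bij] that by simp
    then show ?thesis by auto
  qed
  have cl1: "closedin (subtopology X A) {\<one>}" "closedin (subtopology X B) {\<one>}"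
    using oA oB AG BG Hausdorff by (auto intro!: closedin_Hausdorff_singleton Hausdorff_space_subtopology)
  have clA: "closedin (subtopology X A) A" and clB: "closedin (subtopology X B) B"
    using closedin_topspace[of "subtopology X A"] closedin_topspace[of "subtopology X B"] AG BG
    by (auto simp: Int_absorb1)
  have "closedin X ((\<lambda>(a, b). a \<otimes> b) ` (A \<times> {\<one>}))" "closedin X ((\<lambda>(a, b). a \<otimes> b) ` ({\<one>} \<times> B))"
    using homeomorphic_imp_closed_map[OF hm] cl1 clA clB
    by (auto simp: closed_map_def closedin_prod_Times_iff)
  moreover have "(\<lambda>(a, b). a \<otimes> b) ` (A \<times> {\<one>}) = A" "(\<lambda>(a, b). a \<otimes> b) ` ({\<one>} \<times> B) = B"
    using AG BG by (auto simp: image_iff subset_iff intro!: bexI[of _ _ A] bexI[of _ _ B])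
  ultimately show "closedin X A" "closedin X B" by simp_all
  obtain g where g: "homeomorphic_maps (prod_topology (subtopology X A) (subtopology X B)) X (\<lambda>(a, b). a \<otimes> b) g"
    using hm unfolding homeomorphic_map_maps by blast
  then have gc: "continuous_map X (prod_topology (subtopology X A) (subtopology X B)) g"
    and gi: "\<And>a b. a \<in> A \<Longrightarrow> b \<in> B \<Longrightarrow> g (a \<otimes> b) = (a, b)"
    using AG BG by (auto simp: homeomorphic_maps_def)
  have gA: "continuous_map X X (fst \<circ> g)" and gB: "continuous_map X X (snd \<circ> g)"
    using continuous_map_compose[OF gc continuous_map_into_fulltopology[OF continuous_map_fst]]
      continuous_map_compose[OF gc continuous_map_into_fulltopology[OF continuous_map_snd]] by auto
  have img: "(fst \<circ> g) ` carrier G = A" "(snd \<circ> g) ` carrier G = B"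
  proof -
    show "(fst \<circ> g) ` carrier G = A"
    proof
      show "(fst \<circ> g) ` carrier G \<subseteq> A" using prod gi by fastforce
      show "A \<subseteq> (fst \<circ> g) ` carrier G"
      proof
        fix a assume a: "a \<in> A"
        then have "(fst \<circ> g) (a \<otimes> \<one>) = a" using gi oB by simp
        then show "a \<in> (fst \<circ> g) ` carrier G" using a AG by (metis imageI m_closed one_closed subsetD)
      qed
    qed
    show "(snd \<circ> g) ` carrier G = B"
    proof
      show "(snd \<circ> g) ` carrier G \<subseteq> B" using prod gi by fastforce
      show "B \<subseteq> (snd \<circ> g) ` carrier G"
      proof
        fix b assume b: "b \<in> B"
        then have "(snd \<circ> g) (\<one> \<otimes> b) = b" using gi oA by simp
        then show "b \<in> (snd \<circ> g) ` carrier G" using b BG by (metis imageI m_closed one_closed subsetD)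
      qed
    qed
  qed
  show "connected_space (subtopology X A)" if "connected_space X"
    using connected_space_image[OF that gA] unfolding img .
  show "connected_space (subtopology X B)" if "connected_space X"
    using connected_space_image[OF that gB] unfolding img .
qed

text \<open>The single basis vector. A rescaling of it that is trivial would give the trivial
  homomorphism two coordinates, \<open>c\<close> and 0, and coordinates are unique.\<close>

lemma solenoid_one_parameter:
  assumes S: "subgroup S G" "closedin X S" and sol: "solenoid (G\<lparr>carrier := S\<rparr>) (subtopology X S)"
  obtains b where "b \<in> cHomR G X" "\<And>x. b x \<in> S" "\<And>c. (\<And>x. b (c * x) = \<one>) \<Longrightarrow> c = 0"
proof -
  interpret S: compact_ab_group "G\<lparr>carrier := S\<rparr>" "subtopology X S" by (rule closed_subgroup[OF S])
  have SG: "S \<subseteq> carrier G" using S(1) by (rule subgroup.subset)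
  have "has_dim (G\<lparr>carrier := S\<rparr>) (subtopology X S) 1" using sol by (simp add: solenoid_def)
  then obtain e :: "nat \<Rightarrow> real \<Rightarrow> 'a" where e: "e 0 \<in> cHomR (G\<lparr>carrier := S\<rparr>) (subtopology X S)"
    and u: "\<And>\<psi>. \<psi> \<in> cHomR (G\<lparr>carrier := S\<rparr>) (subtopology X S) \<Longrightarrow> \<exists>!c::nat \<Rightarrow> real. (\<forall>i\<ge>1. c i = 0) \<and>
       \<psi> = (\<lambda>x. finprod (G\<lparr>carrier := S\<rparr>) (\<lambda>i. e i (c i * x)) {..<1})"
    unfolding has_dim_def by auto
  have eS: "e 0 x \<in> S" for x using S.cHomR_closed[OF e] by simp
  have e0: "e 0 0 = \<one>" using S.cHomR_0[OF e] by simp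
  have fin: "finprod (G\<lparr>carrier := S\<rparr>) (\<lambda>i. e i (c i * x)) {..<1} = e 0 (c 0 * x)" for c :: "nat \<Rightarrow> real" and x
    using eS SG by (simp add: lessThan_Suc subset_iff)
  have one: "(\<lambda>x. \<one>) \<in> cHomR (G\<lparr>carrier := S\<rparr>) (subtopology X S)"
    using subgroup.one_closed[OF S(1)] by (auto simp: cHomR_def)
  show ?thesis
  proof
    show "e 0 \<in> cHomR G X" using e by (auto simp: cHomR_def continuous_map_in_subtopology)
    show "e 0 x \<in> S" for x by (rule eS)
    fix c assume c: "\<And>x. e 0 (c * x) = \<one>"
    define c1 where "c1 = (\<lambda>i::nat. if i = 0 then c else 0)"
    have ex1D: "a = b" if "\<exists>!x. P x" "P a" "P b" for P and a b :: "nat \<Rightarrow> real" using that by blast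
    have "c1 = (\<lambda>i. 0)"
      by (rule ex1D[OF u[OF one]], unfold fin) (simp_all add: c1_def c e0)
    then show "c = 0" by (metis c1_def)
  qed
qed

text \<open>Serves to find fresh indices of the carrier type. In a finite group of order
  \<open>N\<close> each \<open>b x\<close> would be the N-th power of \<open>b (x / N)\<close>,
  hence trivial.\<close>

lemma solenoid_infinite:
  assumes S: "subgroup S G" "closedin X S" and sol: "solenoid (G\<lparr>carrier := S\<rparr>) (subtopology X S)"
  shows "infinite (carrier G)"
proof
  assume fin: "finite (carrier G)"
  obtain b where b: "b \<in> cHomR G X" "\<And>c. (\<And>x. b (c * x) = \<one>) \<Longrightarrow> c = 0"
    using solenoid_one_parameter[OF assms] by metis
  define N where "N = order G"
  have N: "N > 0" unfolding N_def order_def using fin one_closed by (auto simp: card_gt_0_iff)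
  have pow: "b (of_nat n * x) = b x [^] n" for n x
    by (induction n) (simp_all add: cHomR_0[OF b(1)] distrib_right cHomR_add[OF b(1)] m_comm cHomR_closed[OF b(1)])
  have "b (1 * x) = \<one>" for x
  proof -
    have "b (of_nat N * (x / of_nat N)) = \<one>"
      unfolding pow N_def by (rule pow_order_eq_1) (rule cHomR_closed[OF b(1)])
    then show ?thesis using N by simp
  qed
  then have "(1::real) = 0" by (rule b(2))
  then show False by simp
qed

end

section \<open>Adding a solenoid to a finite product\<close>

definition finitely_factored :: "'a monoid \<Rightarrow> 'a topology \<Rightarrow> bool" where
  "finitely_factored T Y \<longleftrightarrow> (\<exists>(I :: 'a set) (S :: 'a \<Rightarrow> 'a monoid) (Z :: 'a \<Rightarrow> 'a topology)
      (f :: ('a \<Rightarrow> 'a) \<Rightarrow> 'a). finite I \<and>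
      (\<forall>i\<in>I. solenoid (S i) (Z i)) \<and> top_iso (product_group I S) (product_topology Z I) T Y f)"

lemma finitely_factored_imp_totally_factored: "finitely_factored T Y \<Longrightarrow> totally_factored T Y"
  unfolding finitely_factored_def totally_factored_def by blast

lemma (in comm_group) finprod_subgroup:
  assumes H: "subgroup H G" and "f \<in> A \<rightarrow> H"
  shows "finprod (G\<lparr>carrier := H\<rparr>) f A = finprod G f A"
proof -
  interpret H: comm_group "G\<lparr>carrier := H\<rparr>"
    by (rule group.group_comm_groupI[OF subgroup_imp_group[OF H]])
       (use subgroup.subset[OF H] m_comm in auto)
  show ?thesis
    using assms(2)
  proof (induction A rule: infinite_finite_induct)
    case (insert a A)
    have "f \<in> A \<rightarrow> carrier G" "f a \<in> carrier G" "f \<in> A \<rightarrow> H" "f a \<in> H"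
      using insert.prems subgroup.subset[OF H] by auto
    then show ?case using insert by simp
  qed simp_all
qed

text \<open>\<open>finitely_factored\<close> and \<open>clipped\<close> speak about records of type
  \<open>'a monoid\<close>, so the structure is fixed to that type.\<close>

locale compact_ab_group_unit = compact_ab_group G X for G :: "'a monoid" (structure) and X
begin

lemma finitely_factored_trivial: "finitely_factored (G\<lparr>carrier := {\<one>}\<rparr>) (subtopology X {\<one>})"
proof -
  let ?f = "\<lambda>_ :: 'a \<Rightarrow> 'a. \<one>"
  have "?f \<in> iso (product_group {} (\<lambda>_. G)) (G\<lparr>carrier := {\<one>}\<rparr>)"
    by (auto simp: iso_def hom_def bij_betw_def)
  moreover have "homeomorphic_map (product_topology (\<lambda>_. X) {}) (subtopology X {\<one>}) ?f"
    by (rule continuous_imp_homeomorphic_map)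
       (auto simp: compact_space_product_topology Hausdorff_space_subtopology Hausdorff)
  ultimately show ?thesis
    unfolding finitely_factored_def top_iso_def
    by (intro exI[of _ "{}"] exI[of _ "\<lambda>_. G"] exI[of _ "\<lambda>_. X"] exI[of _ ?f]) simp
qed

text \<open>The new coordinate is multiplied with the old isomorphism applied to the remaining ones.
  The result is a continuous bijection from a compact to a Hausdorff space, hence a
  homeomorphism.\<close>

lemma finitely_factored_extend:
  assumes S: "subgroup S G" "closedin X S" and sol: "solenoid (G\<lparr>carrier := S\<rparr>) (subtopology X S)"
    and T: "subgroup T G" "closedin X T" and ff: "finitely_factored (G\<lparr>carrier := T\<rparr>) (subtopology X T)"
    and int: "S \<inter> T \<subseteq> {\<one>}"
  defines "U \<equiv> (\<lambda>(s, t). s \<otimes> t) ` (S \<times> T)"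
  shows "finitely_factored (G\<lparr>carrier := U\<rparr>) (subtopology X U)"
proof -
  have SG: "S \<subseteq> carrier G" and TG: "T \<subseteq> carrier G" using S T subgroup.subset by blast+
  obtain I :: "'a set" and Sg :: "'a \<Rightarrow> 'a monoid" and Z :: "'a \<Rightarrow> 'a topology" and f
    where I: "finite I" "\<And>i. i \<in> I \<Longrightarrow> solenoid (Sg i) (Z i)"
    and f: "top_iso (product_group I Sg) (product_topology Z I) (G\<lparr>carrier := T\<rparr>) (subtopology X T) f"
    using ff unfolding finitely_factored_def by blast
  have "infinite (UNIV :: 'a set)"
    using solenoid_infinite[OF S sol] finite_subset[OF subset_UNIV] by blast
  \<comment> \<open>The index set lives in the carrier type; a finite index set inside an infinite
    type always leaves an index for one more factor.\<close>
  then obtain j where j: "j \<notin> I" using I(1) ex_new_if_finite by blast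
  define Sg' where "Sg' = Sg(j := G\<lparr>carrier := S\<rparr>)"
  define Z' where "Z' = Z(j := subtopology X S)"
  define J where "J = insert j I"
  define f' where "f' = (\<lambda>g. g j \<otimes> f (restrict g I))"
  have solJ: "solenoid (Sg' i) (Z' i)" if "i \<in> J" for i
    using that I(2) sol j by (auto simp: J_def Sg'_def Z'_def)
  have Sg'I: "Sg' i = Sg i" "Z' i = Z i" if "i \<in> I" for i using that j by (auto simp: Sg'_def Z'_def)
  have top: "topspace (Z' i) = carrier (Sg' i)" if "i \<in> J" for i
    using solJ[OF that] by (simp add: solenoid_def top_ab_group_def)
  have resI: "restrict g I \<in> Pi\<^sub>E I (\<lambda>i. carrier (Sg i))" "g j \<in> S"
    if "g \<in> Pi\<^sub>E J (\<lambda>i. carrier (Sg' i))" for g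
  proof -
    show "restrict g I \<in> Pi\<^sub>E I (\<lambda>i. carrier (Sg i))"
      using that Sg'I by (force simp: J_def PiE_iff)
    show "g j \<in> S" using that PiE_mem[OF that, of j] by (simp add: J_def Sg'_def)
  qed
  have fh: "f \<in> hom (product_group I Sg) (G\<lparr>carrier := T\<rparr>)"
    and fb: "bij_betw f (Pi\<^sub>E I (\<lambda>i. carrier (Sg i))) T"
    and fm: "homeomorphic_map (product_topology Z I) (subtopology X T) f"
    using f by (auto simp: top_iso_def iso_def)
  have fT: "f g \<in> T" if "g \<in> Pi\<^sub>E I (\<lambda>i. carrier (Sg i))" for g using fb that by (auto simp: bij_betw_def)
  have f'U: "f' g \<in> U" if "g \<in> Pi\<^sub>E J (\<lambda>i. carrier (Sg' i))" for g
    using resI[OF that] fT unfolding f'_def U_def by auto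
  have inj: "inj_on f' (Pi\<^sub>E J (\<lambda>i. carrier (Sg' i)))"
  proof (rule inj_onI)
    fix g h assume g: "g \<in> Pi\<^sub>E J (\<lambda>i. carrier (Sg' i))" and h: "h \<in> Pi\<^sub>E J (\<lambda>i. carrier (Sg' i))"
      and eq: "f' g = f' h"
    have "g j = h j \<and> f (restrict g I) = f (restrict h I)"
      by (rule direct_product_unique[OF S(1) T(1) int]) (use resI[OF g] resI[OF h] fT eq in \<open>auto simp: f'_def\<close>)
    then have gj: "g j = h j" and "restrict g I = restrict h I"
      using fb resI[OF g] resI[OF h] unfolding bij_betw_def inj_on_def by blast+
    then have "g i = h i" if "i \<in> J" for i using that unfolding J_def by (metis insert_iff restrict_apply')
    then show "g = h" by (rule PiE_ext[OF g h])
  qed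
  have surj: "f' ` Pi\<^sub>E J (\<lambda>i. carrier (Sg' i)) = U"
  proof
    show "f' ` Pi\<^sub>E J (\<lambda>i. carrier (Sg' i)) \<subseteq> U" using f'U by auto
    show "U \<subseteq> f' ` Pi\<^sub>E J (\<lambda>i. carrier (Sg' i))"
    proof
      fix u assume "u \<in> U"
      then obtain s t where st: "s \<in> S" "t \<in> T" "u = s \<otimes> t" unfolding U_def by auto
      obtain g where g: "g \<in> Pi\<^sub>E I (\<lambda>i. carrier (Sg i))" "f g = t" using fb st(2) by (auto simp: bij_betw_def)
      have 1: "restrict (g(j := s)) I = g"
        using g(1) j by (auto simp: fun_eq_iff restrict_def PiE_iff extensional_def)
      have "g(j := s) \<in> Pi\<^sub>E J (\<lambda>i. carrier (Sg' i))"
        using g(1) st(1) j unfolding J_def by (auto simp: PiE_iff extensional_def Sg'_def)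
      moreover have "f' (g(j := s)) = u" unfolding f'_def 1 using g(2) st(3) by simp
      ultimately show "u \<in> f' ` Pi\<^sub>E J (\<lambda>i. carrier (Sg' i))" by blast
    qed
  qed
  have UG: "U \<subseteq> carrier G" using SG TG unfolding U_def by auto
  have hom: "f' \<in> hom (product_group J Sg') (G\<lparr>carrier := U\<rparr>)"
  proof (rule homI)
    fix g assume "g \<in> carrier (product_group J Sg')"
    then show "f' g \<in> carrier (G\<lparr>carrier := U\<rparr>)" using f'U by simp
  next
    fix g h assume "g \<in> carrier (product_group J Sg')" "h \<in> carrier (product_group J Sg')"
    then have g: "g \<in> Pi\<^sub>E J (\<lambda>i. carrier (Sg' i))" and h: "h \<in> Pi\<^sub>E J (\<lambda>i. carrier (Sg' i))" by auto
    let ?gh = "g \<otimes>\<^bsub>product_group J Sg'\<^esub> h"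
    have ghj: "?gh j = g j \<otimes> h j" by (simp add: J_def Sg'_def)
    have "restrict ?gh I = restrict g I \<otimes>\<^bsub>product_group I Sg\<^esub> restrict h I"
      using Sg'I by (auto simp: J_def fun_eq_iff)
    then have "f (restrict ?gh I) = f (restrict g I) \<otimes> f (restrict h I)"
      using hom_mult[OF fh, of "restrict g I" "restrict h I"] resI(1)[OF g] resI(1)[OF h] by simp
    then show "f' ?gh = f' g \<otimes>\<^bsub>G\<lparr>carrier := U\<rparr>\<^esub> f' h"
      unfolding f'_def ghj using resI[OF g] resI[OF h] fT SG TG by (simp add: subset_iff m_ac)
  qed
  have "continuous_map (product_topology Z' J) X f'"
    unfolding f'_def
  proof (rule continuous_map_m)
    have "continuous_map (product_topology Z' J) (Z' j) (\<lambda>g. g j)"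
      by (rule continuous_map_product_projection) (simp add: J_def)
    then show "continuous_map (product_topology Z' J) X (\<lambda>g. g j)"
      unfolding Z'_def by (simp add: continuous_map_in_subtopology)
    have "continuous_map (product_topology Z' J) (product_topology Z I) (\<lambda>g. restrict g I)"
    proof (subst continuous_map_componentwise, intro conjI ballI)
      fix i assume i: "i \<in> I"
      have "continuous_map (product_topology Z' J) (Z' i) (\<lambda>g. g i)"
        by (rule continuous_map_product_projection) (use i in \<open>simp add: J_def\<close>)
      then show "continuous_map (product_topology Z' J) (Z i) (\<lambda>g. restrict g I i)"
        using i Sg'I by simp
    qed auto
    from continuous_map_compose[OF this homeomorphic_imp_continuous_map[OF fm]]
    show "continuous_map (product_topology Z' J) X (\<lambda>g. f (restrict g I))"
      by (simp add: o_def continuous_map_in_subtopology)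
  qed
  moreover have ts: "topspace (product_topology Z' J) = Pi\<^sub>E J (\<lambda>i. carrier (Sg' i))"
    using top by (auto intro!: PiE_cong)
  ultimately have cont: "continuous_map (product_topology Z' J) (subtopology X U) f'"
    using f'U by (simp add: continuous_map_in_subtopology image_subset_iff)
  have "homeomorphic_map (product_topology Z' J) (subtopology X U) f'"
  proof (rule continuous_imp_homeomorphic_map[OF cont])
    show "compact_space (product_topology Z' J)"
      unfolding compact_space_product_topology using solJ by (simp add: solenoid_def)
    show "Hausdorff_space (subtopology X U)" by (rule Hausdorff_space_subtopology[OF Hausdorff])
    show "f' ` topspace (product_topology Z' J) = topspace (subtopology X U)"
      unfolding ts surj using UG by auto
    show "inj_on f' (topspace (product_topology Z' J))" unfolding ts by (rule inj)
  qed
  then have "top_iso (product_group J Sg') (product_topology Z' J) (G\<lparr>carrier := U\<rparr>) (subtopology X U) f'"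
    unfolding top_iso_def iso_def using hom inj surj by (simp add: bij_betw_def)
  then show ?thesis
    unfolding finitely_factored_def using solJ I(1)
    by (intro exI[of _ J] exI[of _ Sg'] exI[of _ Z'] exI[of _ f']) (auto simp: J_def)
qed

end

text \<open>Splitting off a solenoid lowers the bound \<open>n\<close> for the complement, so
  induction applies there and the solenoid joins the factored part. Closedness, trivial intersection
  and generation are recorded because they combine easily along the induction; compactness turns
  them into a topological isomorphism afterwards.\<close>

lemma main_decomposition:
  fixes G :: "'a monoid" and X :: "'a topology"
  assumes "compact_ab_group G X" "connected_space X" "\<forall>m b. independent_family G X m b \<longrightarrow> m \<le> n"
  shows "\<exists>K T. subgroup K G \<and> subgroup T G \<and> closedin X K \<and> closedin X T \<and>
      K \<inter> T \<subseteq> {\<one>\<^bsub>G\<^esub>} \<and> (\<forall>x\<in>carrier G. \<exists>k\<in>K. \<exists>t\<in>T. x = k \<otimes>\<^bsub>G\<^esub> t) \<and>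
      finitely_factored (G\<lparr>carrier := T\<rparr>) (subtopology X T) \<and>
      clipped (G\<lparr>carrier := K\<rparr>) (subtopology X K)"
  using assms
proof (induction n arbitrary: G X rule: less_induct)
  case (less n)
  interpret compact_ab_group_unit G X using less.prems(1) by (simp add: compact_ab_group_unit_def)
  show ?case
  proof (cases "split_solenoid G X")
    case False
    have GG: "G\<lparr>carrier := carrier G\<rparr> = G" by simp
    have XX: "subtopology X (carrier G) = X" using subtopology_topspace[of X] by simp
    have "closedin X (carrier G)" using closedin_topspace[of X] by simp
    moreover have "closedin X {\<one>\<^bsub>G\<^esub>}" using Hausdorff by (auto intro!: closedin_Hausdorff_singleton)
    moreover have "clipped (G\<lparr>carrier := carrier G\<rparr>) (subtopology X (carrier G))"
      unfolding GG XX clipped_iff by (rule False)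
    ultimately show ?thesis
      using finitely_factored_trivial subgroup_self triv_subgroup
      by (intro exI[of _ "carrier G"] exI[of _ "{\<one>\<^bsub>G\<^esub>}"]) auto
  next
    case True
    then obtain S L where S: "subgroup S G" and L: "subgroup L G"
      and sol: "solenoid (G\<lparr>carrier := S\<rparr>) (subtopology X S)"
      and iso: "top_iso (G\<lparr>carrier := S\<rparr> \<times>\<times> G\<lparr>carrier := L\<rparr>)
               (prod_topology (subtopology X S) (subtopology X L)) G X (\<lambda>(s, l). s \<otimes>\<^bsub>G\<^esub> l)"
      unfolding split_solenoid_def by blast
    note split = top_iso_internalD[OF S L iso]
    have SG: "S \<subseteq> carrier G" and LG: "L \<subseteq> carrier G" using S L subgroup.subset by blast+
    interpret L: compact_ab_group "G\<lparr>carrier := L\<rparr>" "subtopology X L"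
      by (rule closed_subgroup[OF L split(4)])
    obtain e where e: "e \<in> cHomR G X" "\<And>x. e x \<in> S" "\<And>c. (\<And>x. e (c * x) = \<one>\<^bsub>G\<^esub>) \<Longrightarrow> c = 0"
      using solenoid_one_parameter[OF S split(3) sol] by metis
    \<comment> \<open>The line \<open>e\<close> of the solenoid enlarges any independent family of
      \<open>L\<close> to one of the whole group.\<close>
    have ind: "Suc m \<le> n" if b: "independent_family (G\<lparr>carrier := L\<rparr>) (subtopology X L) m b" for m b
    proof (rule less.prems(3)[rule_format])
      have bH: "b i \<in> cHomR (G\<lparr>carrier := L\<rparr>) (subtopology X L)" if "i < m" for i
        using b that unfolding independent_family_def by blast
      have bL: "b i x \<in> L" if "i < m" for i x using L.cHomR_closed[OF bH[OF that]] by simp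
      have bG: "b i \<in> cHomR G X" if "i < m" for i
        using bH[OF that] by (auto simp: cHomR_def continuous_map_in_subtopology)
      show "independent_family G X (Suc m) (b(m := e))"
        unfolding independent_family_def
      proof (intro conjI allI impI)
        fix i assume "i < Suc m"
        then show "(b(m := e)) i \<in> cHomR G X" using bG e(1) by auto
      next
        fix c i assume c: "\<forall>x. finprod G (\<lambda>i. (b(m := e)) i (c i * x)) {..<Suc m} = \<one>\<^bsub>G\<^esub>" and i: "i < Suc m"
        have both: "e (c m * x) = \<one>\<^bsub>G\<^esub> \<and> finprod G (\<lambda>i. b i (c i * x)) {..<m} = \<one>\<^bsub>G\<^esub>" for x
        proof -
          let ?p = "finprod G (\<lambda>i. b i (c i * x)) {..<m}"
          have "?p = finprod (G\<lparr>carrier := L\<rparr>) (\<lambda>i. b i (c i * x)) {..<m}"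
            by (rule finprod_subgroup[symmetric, OF L]) (use bL in auto)
          also have "\<dots> \<in> carrier (G\<lparr>carrier := L\<rparr>)"
            by (rule L.finprod_closed) (use bL in auto)
          finally have pL: "?p \<in> L" by simp
          have bc: "b i y \<in> carrier G" if "i < m" for i y using bL[OF that] LG by blast
          have eG: "e y \<in> carrier G" for y using e(2) SG by blast
          have "finprod G (\<lambda>i. (b(m := e)) i (c i * x)) {..<Suc m}
             = e (c m * x) \<otimes>\<^bsub>G\<^esub> finprod G (\<lambda>i. (b(m := e)) i (c i * x)) {..<m}"
            unfolding lessThan_Suc by (subst finprod_insert) (use bc eG in auto)
          also have "finprod G (\<lambda>i. (b(m := e)) i (c i * x)) {..<m} = ?p"
            by (rule finprod_cong') (use bc in auto)
          finally have "e (c m * x) \<otimes>\<^bsub>G\<^esub> ?p = \<one>\<^bsub>G\<^esub>" using c by simp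
          \<comment> \<open>An element of \<open>S\<close> equals the inverse of an element of
            \<open>L\<close>, so both are trivial and the relation splits into one for
            \<open>e\<close> and one for \<open>b\<close>.\<close>
          then have "e (c m * x) = inv\<^bsub>G\<^esub> ?p" using eG pL LG by (metis inv_equality subsetD)
          then have "e (c m * x) \<in> S \<inter> L" using e(2)[of "c m * x"] subgroup.m_inv_closed[OF L pL] by simp
          then have 1: "e (c m * x) = \<one>\<^bsub>G\<^esub>" using split(1) by blast
          then show ?thesis using \<open>e (c m * x) \<otimes>\<^bsub>G\<^esub> ?p = \<one>\<^bsub>G\<^esub>\<close> pL LG by (auto simp: subset_iff)
        qed
        have cm: "c m = 0" by (rule e(3)) (use both in blast)
        have "finprod (G\<lparr>carrier := L\<rparr>) (\<lambda>i. b i (c i * x)) {..<m} = \<one>\<^bsub>G\<lparr>carrier := L\<rparr>\<^esub>" for x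
          using both[of x] finprod_subgroup[OF L, of "\<lambda>i. b i (c i * x)" "{..<m}"] bL by auto
        then have "\<forall>i<m. c i = 0" using b unfolding independent_family_def by blast
        then show "c i = 0" using cm i by (auto simp: less_Suc_eq)
      qed
    qed
    \<comment> \<open>The empty family yields \<open>1 \<le> n\<close>, so that \<open>n - 1\<close>
      is a genuine decrease on natural numbers.\<close>
    have "independent_family (G\<lparr>carrier := L\<rparr>) (subtopology X L) 0 (\<lambda>_. e)"
      by (simp add: independent_family_def)
    then have n: "n - 1 < n" using ind by fastforce
    have "\<forall>m b. independent_family (G\<lparr>carrier := L\<rparr>) (subtopology X L) m b \<longrightarrow> m \<le> n - 1"
      using ind by fastforce
    from less.IH[OF n L.compact_ab_group_axioms split(6)[OF less.prems(2)] this]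
    obtain K T where K: "subgroup K (G\<lparr>carrier := L\<rparr>)" and T: "subgroup T (G\<lparr>carrier := L\<rparr>)"
      and cl: "closedin (subtopology X L) K" "closedin (subtopology X L) T"
      and KT: "K \<inter> T \<subseteq> {\<one>\<^bsub>G\<^esub>}" "\<And>x. x \<in> L \<Longrightarrow> \<exists>k\<in>K. \<exists>t\<in>T. x = k \<otimes>\<^bsub>G\<^esub> t"
      and ff: "finitely_factored (G\<lparr>carrier := T\<rparr>) (subtopology (subtopology X L) T)"
      and clip: "clipped (G\<lparr>carrier := K\<rparr>) (subtopology (subtopology X L) K)"
      by auto
    have KL: "K \<subseteq> L" and TL: "T \<subseteq> L" using cl closedin_subset by fastforce+
    have KG: "subgroup K G" "closedin X K" and TG: "subgroup T G" "closedin X T"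
      using incl_subgroup[OF L K] incl_subgroup[OF L T] closedin_trans_full[OF cl(1) split(4)]
        closedin_trans_full[OF cl(2) split(4)] by auto
    have sub: "subtopology (subtopology X L) K = subtopology X K" "subtopology (subtopology X L) T = subtopology X T"
      using KL TL by (simp_all add: subtopology_subtopology Int_absorb1)
    define U where "U = (\<lambda>(s, t). s \<otimes>\<^bsub>G\<^esub> t) ` (S \<times> T)"
    have UG: "subgroup U G"
    proof -
      have "U = S <#>\<^bsub>G\<^esub> T" by (auto simp: U_def set_mult_def)
      then show ?thesis using mult_subgroups[OF S TG(1)] by simp
    qed
    have Ucl: "closedin X U"
    proof -
      have "compactin X S" "compactin X T"
        using split(3) TG(2) compact closedin_compact_space by blast+
      then have "compactin (prod_topology X X) (S \<times> T)" by (simp add: compactin_Times)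
      moreover have "continuous_map (prod_topology X X) X (\<lambda>(s, t). s \<otimes>\<^bsub>G\<^esub> t)"
        using top_group by (simp add: top_ab_group_def)
      ultimately have "compactin X U" unfolding U_def by (rule image_compactin)
      then show ?thesis using Hausdorff compactin_imp_closedin by blast
    qed
    have "K \<inter> U \<subseteq> {\<one>\<^bsub>G\<^esub>}"
    proof
      fix k assume k: "k \<in> K \<inter> U"
      then obtain s t where st: "s \<in> S" "t \<in> T" "k = s \<otimes>\<^bsub>G\<^esub> t" unfolding U_def by auto
      have G: "s \<in> carrier G" "t \<in> carrier G" "t \<in> L" "k \<in> L" using st SG TL LG KL k by auto
      \<comment> \<open>Since \<open>k\<close> and \<open>t\<close> lie in \<open>L\<close>, so does
        \<open>s\<close>; being also in \<open>S\<close> it is trivial, and the intersection reduces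
        to that of \<open>K\<close> and \<open>T\<close>.\<close>
      have "s = k \<otimes>\<^bsub>G\<^esub> inv\<^bsub>G\<^esub> t" using st(3) G by (simp add: m_assoc)
      then have "s \<in> L" using G subgroup.m_closed[OF L] subgroup.m_inv_closed[OF L] by simp
      then have "s = \<one>\<^bsub>G\<^esub>" using st(1) split(1) by blast
      then have "k = t" using st(3) G by simp
      then show "k \<in> {\<one>\<^bsub>G\<^esub>}" using KT(1) k st(2) by blast
    qed
    moreover have "\<exists>k\<in>K. \<exists>u\<in>U. x = k \<otimes>\<^bsub>G\<^esub> u" if x: "x \<in> carrier G" for x
    proof -
      obtain s l where sl: "s \<in> S" "l \<in> L" "x = s \<otimes>\<^bsub>G\<^esub> l" using split(2)[OF x] by blast
      obtain k t where kt: "k \<in> K" "t \<in> T" "l = k \<otimes>\<^bsub>G\<^esub> t" using KT(2)[OF sl(2)] by blast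
      have "s \<in> carrier G" "k \<in> carrier G" "t \<in> carrier G" using sl kt SG KL TL LG by auto
      then have "x = k \<otimes>\<^bsub>G\<^esub> (s \<otimes>\<^bsub>G\<^esub> t)" using sl(3) kt(3) by (simp add: m_lcomm)
      moreover have "s \<otimes>\<^bsub>G\<^esub> t \<in> U" unfolding U_def using sl kt by auto
      ultimately show ?thesis using kt(1) by blast
    qed
    moreover have "finitely_factored (G\<lparr>carrier := U\<rparr>) (subtopology X U)"
      unfolding U_def
    proof (rule finitely_factored_extend[OF S split(3) sol TG])
      show "finitely_factored (G\<lparr>carrier := T\<rparr>) (subtopology X T)" using ff sub by simp
      show "S \<inter> T \<subseteq> {\<one>\<^bsub>G\<^esub>}" using split(1) TL by blast
    qed
    ultimately show ?thesis using KG UG Ucl clip sub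
      by (intro exI[of _ K] exI[of _ U]) auto
  qed
qed

theorem theorem5p2:
  fixes G :: "'a monoid" and X :: "'a topology"
  assumes "top_ab_group G X" and "compact_space X" and "connected_space X"
    and "Hausdorff_space X" and "finite_dim G X"
  shows "\<exists>K T. subgroup K G \<and> subgroup T G \<and>
      top_iso (G\<lparr>carrier := K\<rparr> \<times>\<times> G\<lparr>carrier := T\<rparr>)
              (prod_topology (subtopology X K) (subtopology X T)) G X (\<lambda>(k, t). k \<otimes>\<^bsub>G\<^esub> t) \<and>
      totally_factored (G\<lparr>carrier := T\<rparr>) (subtopology X T) \<and>
      clipped (G\<lparr>carrier := K\<rparr>) (subtopology X K) \<and>
      (\<forall>\<phi>. \<phi> \<in> hom circle_group (G\<lparr>carrier := K\<rparr>) \<and> continuous_map circle_top (subtopology X K) \<phi>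
             \<longrightarrow> (\<forall>z\<in>carrier circle_group. \<phi> z = \<one>\<^bsub>G\<^esub>)) \<and>
      (\<forall>\<phi>. \<phi> \<in> hom (G\<lparr>carrier := K\<rparr>) Qdual_group \<and> continuous_map (subtopology X K) Qdual_top \<phi>
             \<longrightarrow> (\<forall>k\<in>K. \<phi> k = \<one>\<^bsub>Qdual_group\<^esub>))"
proof -
  interpret compact_ab_group G X by unfold_locales (use assms in auto)
  obtain n where n: "has_dim G X n" using assms(5) unfolding finite_dim_def by blast
  have "\<forall>m b. independent_family G X m b \<longrightarrow> m \<le> n"
    using independent_family_bound[OF n] by blast
  from main_decomposition[OF compact_ab_group_axioms assms(3) this]
  obtain K T where K: "subgroup K G" "closedin X K" and T: "subgroup T G" "closedin X T"
    and KT: "K \<inter> T \<subseteq> {\<one>\<^bsub>G\<^esub>}" "\<And>x. x \<in> carrier G \<Longrightarrow> \<exists>k\<in>K. \<exists>t\<in>T. x = k \<otimes>\<^bsub>G\<^esub> t"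
    and ff: "finitely_factored (G\<lparr>carrier := T\<rparr>) (subtopology X T)"
    and clip: "clipped (G\<lparr>carrier := K\<rparr>) (subtopology X K)"
    by auto
  have iso: "top_iso (G\<lparr>carrier := K\<rparr> \<times>\<times> G\<lparr>carrier := T\<rparr>)
              (prod_topology (subtopology X K) (subtopology X T)) G X (\<lambda>(k, t). k \<otimes>\<^bsub>G\<^esub> t)"
    by (rule internal_direct_product[OF K T KT])
  interpret K: compact_ab_group "G\<lparr>carrier := K\<rparr>" "subtopology X K" by (rule closed_subgroup[OF K])
  \<comment> \<open>\<open>K\<close> is the image of the connected group under a projection; both
    splitting lemmas require connectedness.\<close>
  have conn: "connected_space (subtopology X K)" by (rule top_iso_internalD(5)[OF K(1) T(1) iso assms(3)])
  have nsplit: "\<not> split_solenoid (G\<lparr>carrier := K\<rparr>) (subtopology X K)" using clip by (simp add: clipped_iff)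
  have "\<phi> z = \<one>\<^bsub>G\<^esub>"
    if "\<phi> \<in> hom circle_group (G\<lparr>carrier := K\<rparr>)" "continuous_map circle_top (subtopology X K) \<phi>"
      "z \<in> carrier circle_group" for \<phi> z
    using K.circle_hom_splits[OF conn that] nsplit by auto
  moreover have "\<phi> k = \<one>\<^bsub>Qdual_group\<^esub>"
    if "\<phi> \<in> hom (G\<lparr>carrier := K\<rparr>) Qdual_group" "continuous_map (subtopology X K) Qdual_top \<phi>" "k \<in> K" for \<phi> k
    using K.Qdual_hom_splits[OF conn that(1,2), of k] that(3) nsplit by auto
  ultimately show ?thesis
    using K(1) T(1) iso clip finitely_factored_imp_totally_factored[OF ff]
    by (intro exI[of _ K] exI[of _ T]) blast
qed

end
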